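(* Let $K$ be an algebraic number field with ring of integers $\mathcal{O}_K$, and let $\boldsymbol{\alpha}=(\alpha_1,\dots,\alpha_r)$, $\boldsymbol{\beta}=(\beta_1,\dots,\beta_s)$ with all $\alpha_i,\beta_j\in K\setminus\mathbb{Z}_{\le0}$. The following are equivalent: (i) $F_{\boldsymbol{\alpha},\boldsymbol{\beta}}(z)$ is N-integral in $K$, i.e. there is a nonzero $c\in K$ with $F_{\boldsymbol{\alpha},\boldsymbol{\beta}}(cz)\in\mathcal{O}_K[[z]]$; (ii) $F_{\boldsymbol{\alpha},\boldsymbol{\beta}}(z)\in\mathcal{O}_{K,\mathfrak{p}}[[z]]$ for all but finitely many prime ideals $\mathfrak{p}$ of $\mathcal{O}_K$; (iii) for all but finitely many prime numbers $p$ and for all field monomorphisms $\sigma_p:K\to\mathbb{C}_p$, one has $\sigma_p(F_{\boldsymbol{\alpha},\boldsymbol{\beta}}(z))\in\mathcal{O}_p[[z]]$.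
   Context: $(x)_0=1$, $(x)_n=x(x+1)\cdots(x+n-1)$; $F_{\boldsymbol{\alpha},\boldsymbol{\beta}}(z)=\sum_{n\ge0}\frac{(\alpha_1)_n\cdots(\alpha_r)_n}{(\beta_1)_n\cdots(\beta_s)_n}z^n\in K[[z]]$. For a prime ideal $\mathfrak{p}$ of $\mathcal{O}_K$, $K_{\mathfrak{p}}$ is the $\mathfrak{p}$-adic completion of $K$ and $\mathcal{O}_{K,\mathfrak{p}}$ its valuation ring (coefficients of $F$ are viewed in $K\subset K_{\mathfrak p}$). $\mathbb{C}_p$ is the completion of an algebraic closure of $\mathbb{Q}_p$ and $\mathcal{O}_p$ its valuation ring. For $\sigma_p:K\to\mathbb{C}_p$, $\sigma_p(F_{\boldsymbol{\alpha},\boldsymbol{\beta}}(z))=\sum_n\sigma_p\big(\frac{(\alpha_1)_n\cdots(\alpha_r)_n}{(\beta_1)_n\cdots(\beta_s)_n}\big)z^n$. *)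

theory Defs
  imports
    "HOL-Algebra.Algebra"
    "HOL-Algebra.Algebraic_Closure_Type"
    "HOL-Computational_Algebra.Computational_Algebra"
    "HOL-Library.Nonpos_Ints"
begin

text \<open>
  A field that is given as a type is viewed as a ring record through \<open>ring_of_type_algebra\<close>.
  Completions have to be records, because the fields of \<open>p\<close>-adic numbers depend on \<open>p\<close>.
\<close>

section \<open>Completion of a field with respect to an absolute value\<close>

definition absolute_value :: "('a, 'm) ring_scheme \<Rightarrow> ('a \<Rightarrow> real) \<Rightarrow> bool" where
  "absolute_value R v \<longleftrightarrow>
     (\<forall>x\<in>carrier R. 0 \<le> v x \<and> (v x = 0 \<longleftrightarrow> x = \<zero>\<^bsub>R\<^esub>)) \<and>
     (\<forall>x\<in>carrier R. \<forall>y\<in>carrier R. v (x \<otimes>\<^bsub>R\<^esub> y) = v x * v y) \<and>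
     (\<forall>x\<in>carrier R. \<forall>y\<in>carrier R. v (x \<oplus>\<^bsub>R\<^esub> y) \<le> v x + v y)"

definition cauchy_seq_ring :: "('a, 'm) ring_scheme \<Rightarrow> ('a \<Rightarrow> real) \<Rightarrow> (nat \<Rightarrow> 'a) ring" where
  "cauchy_seq_ring R v =
     \<lparr>carrier = {s. (\<forall>n. s n \<in> carrier R) \<and>
                    (\<forall>e>0. \<exists>N. \<forall>m\<ge>N. \<forall>n\<ge>N. v (s m \<ominus>\<^bsub>R\<^esub> s n) < e)},
      monoid.mult = (\<lambda>s t n. s n \<otimes>\<^bsub>R\<^esub> t n),
      one = (\<lambda>n. \<one>\<^bsub>R\<^esub>),
      ring.zero = (\<lambda>n. \<zero>\<^bsub>R\<^esub>),
      add = (\<lambda>s t n. s n \<oplus>\<^bsub>R\<^esub> t n)\<rparr>"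

definition null_seqs :: "('a, 'm) ring_scheme \<Rightarrow> ('a \<Rightarrow> real) \<Rightarrow> (nat \<Rightarrow> 'a) set" where
  "null_seqs R v = {s. (\<forall>n. s n \<in> carrier R) \<and> (\<lambda>n. v (s n)) \<longlonglongrightarrow> 0}"

definition completion :: "('a, 'm) ring_scheme \<Rightarrow> ('a \<Rightarrow> real) \<Rightarrow> (nat \<Rightarrow> 'a) set ring" where
  "completion R v = cauchy_seq_ring R v Quot null_seqs R v"

definition completion_embed ::
    "('a, 'm) ring_scheme \<Rightarrow> ('a \<Rightarrow> real) \<Rightarrow> 'a \<Rightarrow> (nat \<Rightarrow> 'a) set" where
  "completion_embed R v x = null_seqs R v +>\<^bsub>cauchy_seq_ring R v\<^esub> (\<lambda>n. x)"

definition completion_abs ::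
    "('a, 'm) ring_scheme \<Rightarrow> ('a \<Rightarrow> real) \<Rightarrow> (nat \<Rightarrow> 'a) set \<Rightarrow> real" where
  "completion_abs R v S = (THE l. \<exists>s\<in>S. (\<lambda>n. v (s n)) \<longlonglongrightarrow> l)"

definition completion_valuation_ring ::
    "('a, 'm) ring_scheme \<Rightarrow> ('a \<Rightarrow> real) \<Rightarrow> (nat \<Rightarrow> 'a) set set" where
  "completion_valuation_ring R v = {S \<in> carrier (completion R v). completion_abs R v S \<le> 1}"


section \<open>Primes of a number field and their completions\<close>

definition ring_of_integers :: "'k::field_char_0 ring" where
  "ring_of_integers = ring_of_type_algebra \<lparr>carrier := {x. algebraic_int x}\<rparr>"

definition integer_order :: "'k::field_char_0 set \<Rightarrow> 'k \<Rightarrow> nat" where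
  "integer_order P a = (GREATEST n. a \<in> P [^]\<^bsub>ideals_set ring_of_integers\<^esub> n)"

definition prime_order :: "'k::field_char_0 set \<Rightarrow> 'k \<Rightarrow> int" where
  "prime_order P x =
     (THE k. \<exists>a b. algebraic_int a \<and> algebraic_int b \<and> a \<noteq> 0 \<and> b \<noteq> 0 \<and> x = a / b \<and>
                   k = int (integer_order P a) - int (integer_order P b))"

text \<open>
  Any base greater than 1 in place of Euler's number gives an equivalent absolute value, hence
  the same completion and the same valuation ring.
\<close>

definition prime_abs :: "'k::field_char_0 set \<Rightarrow> 'k \<Rightarrow> real" where
  "prime_abs P x = (if x = 0 then 0 else exp (- real_of_int (prime_order P x)))"

definition prime_embed :: "'k::field_char_0 set \<Rightarrow> 'k \<Rightarrow> (nat \<Rightarrow> 'k) set" where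
  "prime_embed P = completion_embed ring_of_type_algebra (prime_abs P)"

definition prime_valuation_ring :: "'k::field_char_0 set \<Rightarrow> (nat \<Rightarrow> 'k) set set" where
  "prime_valuation_ring P = completion_valuation_ring ring_of_type_algebra (prime_abs P)"


section \<open>The field of complex \<open>p\<close>-adic numbers\<close>

definition padic_order :: "nat \<Rightarrow> rat \<Rightarrow> int" where
  "padic_order p x =
     int (multiplicity (int p) (fst (quotient_of x))) -
     int (multiplicity (int p) (snd (quotient_of x)))"

definition padic_abs :: "nat \<Rightarrow> rat \<Rightarrow> real" where
  "padic_abs p x = (if x = 0 then 0 else real p powi (- padic_order p x))"

definition Qp :: "nat \<Rightarrow> (nat \<Rightarrow> rat) set ring" where
  "Qp p = completion ring_of_type_algebra (padic_abs p)"

definition Qp_abs :: "nat \<Rightarrow> (nat \<Rightarrow> rat) set \<Rightarrow> real" where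
  "Qp_abs p = completion_abs ring_of_type_algebra (padic_abs p)"

type_synonym qp_closure = "((nat \<Rightarrow> rat) set list \<times> nat) multiset \<Rightarrow> (nat \<Rightarrow> rat) set"

definition Qp_closure :: "nat \<Rightarrow> qp_closure ring" where
  "Qp_closure p = field.alg_closure (Qp p)"

text \<open>
  The \<open>p\<close>-adic absolute value extends uniquely to the algebraic closure, so the choice below is
  determined on the carrier (and only there). The map \<open>indexed_const\<close> is the embedding of a field
  into its algebraic closure.
\<close>

definition Qp_closure_abs :: "nat \<Rightarrow> qp_closure \<Rightarrow> real" where
  "Qp_closure_abs p =
     (SOME v. absolute_value (Qp_closure p) v \<and>
              (\<forall>x\<in>carrier (Qp p). v (ring.indexed_const (Qp p) x) = Qp_abs p x))"

definition Cp :: "nat \<Rightarrow> (nat \<Rightarrow> qp_closure) set ring" where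
  "Cp p = completion (Qp_closure p) (Qp_closure_abs p)"

definition Cp_valuation_ring :: "nat \<Rightarrow> (nat \<Rightarrow> qp_closure) set set" where
  "Cp_valuation_ring p = completion_valuation_ring (Qp_closure p) (Qp_closure_abs p)"


section \<open>Hypergeometric series\<close>

text \<open>There is no implicit factor \<open>n!\<close> in the denominator.\<close>

definition hypergeometric_series :: "'k::field_char_0 list \<Rightarrow> 'k list \<Rightarrow> 'k fps" where
  "hypergeometric_series as bs =
     Abs_fps (\<lambda>n. (\<Prod>a\<leftarrow>as. pochhammer a n) / (\<Prod>b\<leftarrow>bs. pochhammer b n))"

definition N_integral :: "'k::field_char_0 fps \<Rightarrow> bool" where
  "N_integral F \<longleftrightarrow>
     (\<exists>c. c \<noteq> 0 \<and> (\<forall>n. fps_nth (F oo (fps_const c * fps_X)) n \<in> carrier ring_of_integers))"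

end

theory Submission
  imports Defs
begin

text \<open>
  A prime ideal \<open>P\<close> above a prime number \<open>p\<close> and an embedding \<open>\<sigma>\<close> into the complex \<open>p\<close>-adic numbers both
  give a non-archimedean absolute value \<open>w\<close> on the number field with \<open>w p < 1\<close>, and the integrality
  conditions say that \<open>w\<close> is at most 1 on the coefficients. If \<open>c\<close> witnesses N-integrality, then
  \<open>w c = 1\<close> for all but finitely many \<open>p\<close>, which gives the finiteness of both exceptional sets.

  Conversely, Pochhammer symbols are bounded above and below \<open>p\<close>-adically by geometric sequences: there
  is one exponent \<open>N\<close> such that \<open>p\<^bsup>N n\<^esup>\<close> times the \<open>n\<close>-th coefficient is \<open>w\<close>-integral for all \<open>p\<close> and \<open>w\<close>. If
  only finitely many ideals \<open>P\<close> are exceptional, the product of \<open>p\<^bsup>N\<^esup>\<close> over the primes below them is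
  therefore a witness for N-integrality, since an element that is integral at all \<open>P\<close> is an algebraic
  integer.

  If the images of an element \<open>x\<close> under all embeddings into the complex \<open>p\<close>-adic numbers are integral,
  then so are all roots of its minimal polynomial, hence its coefficients, hence \<open>x\<close> at every \<open>P\<close> above
  \<open>p\<close>. So every exceptional ideal lies above an exceptional prime number.
\<close>

section \<open>Algebraic integers\<close>

text \<open>The exponent \<open>N\<close> can be uniform because estimates are measured against 2: a
  nonzero integer of absolute value at most 2^c has p-adic order at most c for every prime p. A
  single factor b + k is compared with such an integer through an integer polynomial that kills D b,
  where D is a denominator of b; this plays the part of the norm of D (b + k).

  Minimal polynomials spare a matching of prime ideals with embeddings: their coefficients are
  rational, and for a rational number integrality at p forces w <= 1 for every w with w p < 1.

  \<open>prime_order\<close> and \<open>Qp_closure_abs\<close> are given by greatest elements,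
  descriptions and choice, so each must first be shown to exist and to behave as a valuation. For
  ideals this rests on the finiteness of the residues modulo p, mostly through the pigeonhole
  principle. For the closure of Q_p it rests on a maximal subring that contains Z_p but not 1/p,
  which turns out to be a valuation ring of rank one.\<close>

interpretation Z: Modules.module "\<lambda>(n::int) (x::'a::comm_ring_1). of_int n * x"
  by unfold_locales (auto simp: algebra_simps)

lemma Z_span_finite_support:
  assumes "x \<in> Z.span V"
  obtains W where "finite W" "W \<subseteq> V" "x \<in> Z.span W"
proof -
  obtain t r where t: "finite t" "t \<subseteq> V" "x = (\<Sum>a\<in>t. of_int (r a) * a)"
    using assms unfolding Z.span_explicit by blast
  have "x \<in> Z.span t"
    unfolding t(3) by (intro Z.span_sum Z.span_scale Z.span_base)
  with t that show ?thesis by blast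
qed

text \<open>Induction on the generators: after subtracting multiples of one element \<open>u\<close>
  of the span of \<open>V\<close>, every element of \<open>V\<close> falls into the span of one
  generator fewer. \<open>W\<close> is chosen inside \<open>V\<close> itself, so that later it
  consists of actual powers of \<open>x\<close>.\<close>

lemma Z_span_noetherian:
  fixes F V :: "'a::comm_ring_1 set"
  assumes "finite F" "V \<subseteq> Z.span F"
  shows "\<exists>W. finite W \<and> W \<subseteq> V \<and> V \<subseteq> Z.span W"
  using assms
proof (induction F arbitrary: V rule: finite_induct)
  case empty
  then show ?case by (intro exI[of _ "{}"]) auto
next
  case (insert f F)
  \<comment> \<open>The coefficients of \<open>f\<close> that occur modulo the span of
    \<open>F\<close> form an ideal of the integers. It is generated by its least positive member
    \<open>d\<close> (or by 0), and \<open>u\<close> realizes \<open>d\<close>.\<close>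
  define J where "J = {n::int. \<exists>g\<in>Z.span V. g - of_int n * f \<in> Z.span F}"
  have J0: "0 \<in> J" unfolding J_def using Z.span_zero[of V] Z.span_zero[of F] by fastforce
  have Jadd: "a + b * c \<in> J" if ab: "a \<in> J" "b \<in> J" for a b c
  proof -
    obtain g h where g: "g \<in> Z.span V" "g - of_int a * f \<in> Z.span F"
      and h: "h \<in> Z.span V" "h - of_int b * f \<in> Z.span F"
      using ab unfolding J_def by blast
    have "g + of_int c * h \<in> Z.span V" using g h by (intro Z.span_add Z.span_scale)
    moreover have "(g - of_int a * f) + of_int c * (h - of_int b * f) \<in> Z.span F"
      using g h by (intro Z.span_add Z.span_scale)
    hence "(g + of_int c * h) - of_int (a + b * c) * f \<in> Z.span F"
      by (simp add: algebra_simps)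
    ultimately show ?thesis unfolding J_def by blast
  qed
  obtain d where d: "d \<in> J" "\<And>n. n \<in> J \<Longrightarrow> d dvd n"
  proof (cases "J \<subseteq> {0}")
    case True
    then show ?thesis using that[of 0] J0 by auto
  next
    case False
    then obtain n where n: "n \<in> J" "n \<noteq> 0" by auto
    have "\<bar>n\<bar> \<in> J" using Jadd[OF J0 n(1), of 1] Jadd[OF J0 n(1), of "-1"] by (cases "n \<ge> 0") auto
    hence ex: "\<exists>k. k > 0 \<and> int k \<in> J" using n(2) by (intro exI[of _ "nat \<bar>n\<bar>"]) auto
    define k where "k = (LEAST k. k > 0 \<and> int k \<in> J)"
    have k: "k > 0" "int k \<in> J" using LeastI_ex[OF ex] unfolding k_def by auto
    have "int k dvd m" if m: "m \<in> J" for m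
    proof -
      have "m mod int k \<in> J"
        using Jadd[OF m k(2), of "-(m div int k)"]
        by (metis minus_mult_right ab_group_add_class.ab_diff_conv_add_uminus minus_mult_div_eq_mod)
      moreover have "m mod int k < int k" "m mod int k \<ge> 0" using k by auto
      ultimately have "\<not> m mod int k > 0"
        using not_less_Least[of "nat (m mod int k)" "\<lambda>k. k > 0 \<and> int k \<in> J"]
        unfolding k_def[symmetric] by (auto simp: nat_less_iff)
      thus ?thesis using \<open>m mod int k \<ge> 0\<close> by (simp add: dvd_eq_mod_eq_0)
    qed
    then show ?thesis using that k(2) by blast
  qed
  obtain u where u: "u \<in> Z.span V" "u - of_int d * f \<in> Z.span F"
    using d(1) unfolding J_def by blast
  have "\<exists>m. v - of_int m * u \<in> Z.span F" if v: "v \<in> V" for v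
  proof -
    have "v \<in> Z.span (insert f F)" using v insert.prems by blast
    then obtain n where n: "v - of_int n * f \<in> Z.span F" unfolding Z.span_insert by auto
    hence "n \<in> J" unfolding J_def using v Z.span_base by blast
    then obtain m where m: "n = d * m" using d(2) dvdE by blast
    have "(v - of_int n * f) - of_int m * (u - of_int d * f) \<in> Z.span F"
      by (rule Z.span_diff[OF n Z.span_scale[OF u(2)]])
    moreover have "(v - of_int n * f) - of_int m * (u - of_int d * f) = v - of_int m * u"
      by (simp add: m right_diff_distrib mult_ac)
    ultimately show ?thesis by metis
  qed
  then obtain m where m: "\<forall>v\<in>V. v - of_int (m v) * u \<in> Z.span F" by metis
  define h where "h = (\<lambda>v. v - of_int (m v) * u)"
  have "h ` V \<subseteq> Z.span F" using m by (auto simp: h_def)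
  from insert.IH[OF this] obtain W' where W': "finite W'" "W' \<subseteq> h ` V" "h ` V \<subseteq> Z.span W'" by blast
  then obtain W1 where W1: "finite W1" "W1 \<subseteq> V" "W' = h ` W1" by (meson finite_subset_image)
  \<comment> \<open>\<open>u\<close> is only in the span of \<open>V\<close>; finitely many members
    of \<open>V\<close> that generate it are added instead.\<close>
  obtain W2 where W2: "finite W2" "W2 \<subseteq> V" "u \<in> Z.span W2"
    using u(1) by (rule Z_span_finite_support)
  have uW: "u \<in> Z.span (W1 \<union> W2)" using W2 Z.span_mono by blast
  have "h ` W1 \<subseteq> Z.span (W1 \<union> W2)"
    unfolding h_def using uW by (intro image_subsetI Z.span_diff Z.span_scale) (auto intro: Z.span_base)
  hence hV: "h ` V \<subseteq> Z.span (W1 \<union> W2)"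
    using W' W1 Z.span_minimal[OF _ Z.subspace_span] by blast
  have "v \<in> Z.span (W1 \<union> W2)" if "v \<in> V" for v
  proof -
    have "h v + of_int (m v) * u \<in> Z.span (W1 \<union> W2)"
      using hV that uW by (intro Z.span_add Z.span_scale) auto
    thus ?thesis by (simp add: h_def)
  qed
  then show ?case using W1 W2 by (intro exI[of _ "W1 \<union> W2"]) auto
qed

lemma algebraic_int_if_power_eq:
  fixes x :: "'a::field"
  assumes "x ^ k = (\<Sum>i<k. of_int (c i) * x ^ i)"
  shows "algebraic_int x"
proof -
  define r :: "'a poly" where "r = (\<Sum>i<k. monom (of_int (c i)) i)"
  have deg: "coeff r i = (if i < k then of_int (c i) else 0)" for i
    by (simp add: r_def coeff_sum)
  define p where "p = monom 1 k - r"
  have "coeff p k = 1" by (simp add: p_def deg)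
  moreover have "degree p \<le> k"
    by (rule degree_le) (auto simp: p_def deg)
  ultimately have "degree p = k" by (simp add: le_degree antisym)
  have "poly p x = 0" using assms by (simp add: p_def r_def poly_sum poly_monom)
  moreover have "\<forall>i. coeff p i \<in> \<int>" by (auto simp: p_def deg)
  ultimately show ?thesis
    using \<open>coeff p k = 1\<close> \<open>degree p = k\<close> by (intro algebraic_int.intros[of p]) auto
qed

text \<open>The determinant-free version of the usual criterion: the powers of \<open>x\<close> all lie in one
  finitely generated, hence Noetherian, abelian group.\<close>

lemma algebraic_int_if_powers_in_span:
  fixes x :: "'a::field"
  assumes "finite F" "\<And>k. x ^ k \<in> Z.span F"
  shows "algebraic_int x"
proof -
  have "range (\<lambda>k. x ^ k) \<subseteq> Z.span F" using assms by auto
  from Z_span_noetherian[OF assms(1) this]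
  obtain W where W: "finite W" "W \<subseteq> range (\<lambda>k. x ^ k)" "range (\<lambda>k. x ^ k) \<subseteq> Z.span W" by blast
  then obtain I where I: "finite I" "W = (\<lambda>k. x ^ k) ` I" by (meson finite_subset_image)
  \<comment> \<open>\<open>k\<close> exceeds every exponent in \<open>I\<close>, so expressing
    \<open>x ^ k\<close> through \<open>W\<close> is already a monic equation for
    \<open>x\<close>.\<close>
  obtain k where k: "\<And>i. i \<in> I \<Longrightarrow> i < k"
    using I(1) by (metis finite_nat_set_iff_bounded)
  have sub: "W \<subseteq> (\<lambda>i. x ^ i) ` {..<k}" using I k by auto
  have "Z.span ((\<lambda>i. x ^ i) ` {..<k}) \<subseteq> {y. \<exists>c. y = (\<Sum>i<k. of_int (c i) * x ^ i)}" (is "_ \<subseteq> ?S")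
  proof (rule Z.span_minimal)
    show "(\<lambda>i. x ^ i) ` {..<k} \<subseteq> ?S"
    proof safe
      fix i assume "i < k"
      hence "x ^ i = (\<Sum>j<k. of_int (if j = i then 1 else 0) * x ^ j)"
        by (subst sum.remove[of _ i]) auto
      thus "\<exists>c. x ^ i = (\<Sum>j<k. of_int (c j) * x ^ j)"
        by (rule exI[where x="\<lambda>j. if j = i then 1 else 0"])
    qed
    show "Z.subspace ?S"
    proof (rule Z.subspaceI)
      show "0 \<in> ?S" by (auto intro!: exI[of _ "\<lambda>_. 0"])
    next
      fix a b assume "a \<in> ?S" "b \<in> ?S"
      then obtain c d where "a = (\<Sum>i<k. of_int (c i) * x ^ i)" "b = (\<Sum>i<k. of_int (d i) * x ^ i)" by auto
      thus "a + b \<in> ?S"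
        by (intro CollectI exI[of _ "\<lambda>i. c i + d i"]) (simp add: distrib_right sum.distrib)
    next
      fix n a assume "a \<in> ?S"
      then obtain c where a: "a = (\<Sum>i<k. of_int (c i) * x ^ i)" by auto
      have "of_int n * a = (\<Sum>i<k. of_int (n * c i) * x ^ i)"
        unfolding a sum_distrib_left of_int_mult by (intro sum.cong refl mult.assoc[symmetric])
      thus "of_int n * a \<in> ?S" by (intro CollectI exI[of _ "\<lambda>i. n * c i"])
    qed
  qed
  moreover have "x ^ k \<in> Z.span W" using W by auto
  ultimately show ?thesis
    using Z.span_mono[OF sub] algebraic_int_if_power_eq[of x k] by blast
qed

lemma Z_span_stable:
  assumes "\<And>b. b \<in> F \<Longrightarrow> x * b \<in> Z.span F" "m \<in> Z.span F"
  shows "x * m \<in> Z.span F"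
  using assms(2)
proof (induction rule: Z.span_induct_alt)
  case base
  then show ?case by (simp add: Z.span_zero)
next
  case (step c b m)
  have "of_int c * (x * b) + x * m \<in> Z.span F"
    using step assms(1) by (intro Z.span_add Z.span_scale)
  then show ?case by (simp add: algebra_simps)
qed

lemma algebraic_int_if_stable:
  fixes x :: "'a::field"
  assumes "finite F" "1 \<in> Z.span F" "\<And>m. m \<in> Z.span F \<Longrightarrow> x * m \<in> Z.span F"
  shows "algebraic_int x"
proof (rule algebraic_int_if_powers_in_span[OF assms(1)])
  show "x ^ k \<in> Z.span F" for k
    by (induction k) (use assms in auto)
qed

lemma algebraic_intE_power:
  fixes x :: "'a::field_char_0"
  assumes "algebraic_int x"
  obtains k c where "x ^ k = (\<Sum>i<k. of_int (c i) * x ^ i)"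
proof -
  obtain p where p: "poly (map_poly of_int p) x = 0" "lead_coeff p = 1"
    using assms unfolding algebraic_int_altdef_ipoly by blast
  define k where "k = degree p"
  have "0 = (\<Sum>i\<le>k. of_int (coeff p i) * x ^ i)"
    using p(1) by (simp add: poly_altdef k_def coeff_map_poly degree_map_poly)
  also have "\<dots> = (\<Sum>i<k. of_int (coeff p i) * x ^ i) + x ^ k"
    using p(2) by (simp add: lessThan_Suc_atMost[symmetric] k_def)
  finally have "x ^ k = (\<Sum>i<k. of_int (- coeff p i) * x ^ i)"
    by (simp add: sum_negf eq_neg_iff_add_eq_0 add.commute)
  thus ?thesis using that[of k "\<lambda>i. - coeff p i"] by blast
qed

text \<open>The products \<open>x ^ i * y ^ j\<close> below both degrees span the module. The
  assumption on \<open>x\<close> only asks for a monic equation with coefficients polynomial in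
  \<open>y\<close>, so that the lemma serves for sums and products and also for transitivity of
  integrality.\<close>

lemma common_stable_module:
  fixes x y :: "'a::field"
  assumes x: "x ^ k \<in> Z.span ((\<lambda>(i,j). x ^ i * y ^ j) ` ({..<k} \<times> UNIV))" (is "_ \<in> Z.span ?H")
    and y: "y ^ l = (\<Sum>i<l. of_int (d i) * y ^ i)"
  obtains F where "finite F" "1 \<in> Z.span F"
    "\<And>m. m \<in> Z.span F \<Longrightarrow> x * m \<in> Z.span F" "\<And>m. m \<in> Z.span F \<Longrightarrow> y * m \<in> Z.span F"
proof -
  define G where "G = (\<lambda>(i,j). x ^ i * y ^ j) ` ({..<k} \<times> {..<l})"
  have finG: "finite G" by (auto simp: G_def)
  have Gb: "x ^ i * y ^ j \<in> Z.span G" if "i < k" "j < l" for i j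
    using that by (intro Z.span_base) (auto simp: G_def)
  have ystab: "y * m \<in> Z.span G" if "m \<in> Z.span G" for m
  proof (rule Z_span_stable[OF _ that])
    fix b assume "b \<in> G"
    then obtain i j where ij: "i < k" "j < l" "b = x ^ i * y ^ j" by (auto simp: G_def)
    show "y * b \<in> Z.span G"
    proof (cases "Suc j < l")
      case True
      then show ?thesis using Gb[of i "Suc j"] ij by (simp add: algebra_simps)
    next
      case False
      hence "Suc j = l" using ij by simp
      hence "y * b = x ^ i * y ^ l" using ij by (auto simp: algebra_simps)
      also have "\<dots> = (\<Sum>a<l. of_int (d a) * (x ^ i * y ^ a))"
        by (simp add: y sum_distrib_left algebra_simps)
      also have "\<dots> \<in> Z.span G" using ij by (intro Z.span_sum Z.span_scale Gb) auto
      finally show ?thesis .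
    qed
  qed
  have ypow: "y ^ n * m \<in> Z.span G" if "m \<in> Z.span G" for m n
    by (induction n) (use that ystab in \<open>auto simp: mult.assoc\<close>)
  show ?thesis
  proof (cases "l = 0")
    case True
    hence "1 = (0::'a)" using y by auto
    thus ?thesis by simp
  next
    case l: False
    have "?H \<subseteq> Z.span G"
    proof safe
      fix i j assume "i < k"
      thus "x ^ i * y ^ j \<in> Z.span G"
        using ypow[OF Gb[of i 0], of j] l by (simp add: mult.commute)
    qed
    hence xk: "x ^ k \<in> Z.span G"
      using x Z.span_minimal[OF _ Z.subspace_span] by blast
    have xstab: "x * m \<in> Z.span G" if "m \<in> Z.span G" for m
    proof (rule Z_span_stable[OF _ that])
      fix b assume "b \<in> G"
      then obtain i j where ij: "i < k" "j < l" "b = x ^ i * y ^ j" by (auto simp: G_def)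
      show "x * b \<in> Z.span G"
      proof (cases "Suc i < k")
        case True
        then show ?thesis using Gb[of "Suc i" j] ij by (simp add: algebra_simps)
      next
        case False
        hence "Suc i = k" using ij by simp
        hence "x * b = y ^ j * x ^ k" using ij by (auto simp: algebra_simps)
        thus ?thesis using ypow[OF xk] by simp
      qed
    qed
    show ?thesis
    \<comment> \<open>For \<open>k = 0\<close> the set \<open>G\<close> is empty, but then the
      relation for \<open>x ^ k\<close> itself says that 1 lies in its span.\<close>
    proof (cases "k = 0")
      case True
      hence "1 \<in> Z.span G" using xk by simp
      thus ?thesis using that finG xstab ystab by blast
    next
      case False
      hence "1 \<in> Z.span G" using Gb[of 0 0] l by simp
      thus ?thesis using that finG xstab ystab by blast
    qed
  qed
qed

lemma
  fixes x y :: "'a::field_char_0"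
  assumes "algebraic_int x" "algebraic_int y"
  shows algebraic_int_add: "algebraic_int (x + y)"
    and algebraic_int_mult: "algebraic_int (x * y)"
proof -
  obtain k c where x: "x ^ k = (\<Sum>i<k. of_int (c i) * x ^ i)"
    using assms(1) by (rule algebraic_intE_power)
  obtain l d where y: "y ^ l = (\<Sum>i<l. of_int (d i) * y ^ i)"
    using assms(2) by (rule algebraic_intE_power)
  have "(\<Sum>i<k. of_int (c i) * (x ^ i * y ^ 0)) \<in> Z.span ((\<lambda>(i,j). x ^ i * y ^ j) ` ({..<k} \<times> UNIV))"
    by (intro Z.span_sum Z.span_scale Z.span_base image_eqI[where x="(_, 0)"]) auto
  hence "x ^ k \<in> Z.span ((\<lambda>(i,j). x ^ i * y ^ j) ` ({..<k} \<times> UNIV))" by (simp add: x)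
  then obtain F where F: "finite F" "1 \<in> Z.span F"
    "\<And>m. m \<in> Z.span F \<Longrightarrow> x * m \<in> Z.span F" "\<And>m. m \<in> Z.span F \<Longrightarrow> y * m \<in> Z.span F"
    using y by (rule common_stable_module) blast
  show "algebraic_int (x + y)"
    using F by (intro algebraic_int_if_stable[of F]) (auto simp: distrib_right Z.span_add)
  show "algebraic_int (x * y)"
    using F by (intro algebraic_int_if_stable[of F]) (auto simp: mult.assoc)
qed

lemma algebraic_int_diff:
  "algebraic_int x \<Longrightarrow> algebraic_int y \<Longrightarrow> algebraic_int (x - y :: 'a::field_char_0)"
  using algebraic_int_add[of x "- y"] by simp

lemma algebraic_int_power: "algebraic_int x \<Longrightarrow> algebraic_int (x ^ n :: 'a::field_char_0)"
  by (induction n) (auto intro: algebraic_int_mult)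

lemma algebraic_int_sum:
  "(\<And>i. i \<in> A \<Longrightarrow> algebraic_int (f i)) \<Longrightarrow> algebraic_int (\<Sum>i\<in>A. f i :: 'a::field_char_0)"
  by (induction A rule: infinite_finite_induct) (auto intro: algebraic_int_add)

lemmas algebraic_int_intros =
  algebraic_int_add algebraic_int_mult algebraic_int_diff algebraic_int_power algebraic_int_sum
  algebraic_int_minus algebraic_int_of_int algebraic_int_of_nat algebraic_int_0 algebraic_int_1

text \<open>Transitivity of integrality: \<open>x\<close> is a root of the monic polynomial X^n -
  X^m - c with the integral constant c = x^n - x^m. The pigeonhole argument for the inverse of a
  prime ideal produces such differences.\<close>

lemma algebraic_int_if_power_diff:
  fixes x :: "'a::field_char_0"
  assumes "algebraic_int (x ^ n - x ^ m)" "m < n"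
  shows "algebraic_int x"
proof -
  obtain l d where y: "(x ^ n - x ^ m) ^ l = (\<Sum>i<l. of_int (d i) * (x ^ n - x ^ m) ^ i)"
    using assms(1) by (rule algebraic_intE_power)
  have "x ^ m * (x ^ n - x ^ m) ^ 0 + x ^ 0 * (x ^ n - x ^ m) ^ 1
      \<in> Z.span ((\<lambda>(i,j). x ^ i * (x ^ n - x ^ m) ^ j) ` ({..<n} \<times> UNIV))"
    using assms(2)
    by (intro Z.span_add Z.span_base image_eqI[where x="(m, 0)"] image_eqI[where x="(0, 1)"]) auto
  hence "x ^ n \<in> Z.span ((\<lambda>(i,j). x ^ i * (x ^ n - x ^ m) ^ j) ` ({..<n} \<times> UNIV))" by simp
  thus ?thesis
    using y by (rule common_stable_module) (rule algebraic_int_if_stable)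
qed

text \<open>Multiplying an integer equation of degree n with leading coefficient a by a^(n-1) makes
  it monic in a x.\<close>

lemma algebraic_imp_int_mult:
  fixes x :: "'a::field_char_0"
  assumes "algebraic x"
  obtains m :: int where "m > 0" "algebraic_int (of_int m * x)"
proof -
  obtain p :: "int poly" where p: "p \<noteq> 0" "poly (map_poly of_int p) x = 0"
    using assms by (rule algebraicE')
  define n where "n = degree p"
  define a where "a = lead_coeff p"
  have a: "a \<noteq> 0" using p by (simp add: a_def)
  have n: "n > 0"
  proof (rule Nat.gr0I)
    assume "n = 0"
    then obtain c where "p = [:c:]" by (metis n_def degree_eq_zeroE)
    thus False using p by (auto simp: map_poly_pCons)
  qed
  have "0 = of_int (a ^ (n - 1)) * (\<Sum>i\<le>n. of_int (coeff p i) * x ^ i)"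
    using p(2) by (simp add: poly_altdef n_def coeff_map_poly degree_map_poly)
  also have "\<dots> = of_int (a ^ (n - 1)) * (\<Sum>i<n. of_int (coeff p i) * x ^ i) + of_int (a ^ (n - 1)) * (of_int a * x ^ n)"
    by (simp add: lessThan_Suc_atMost[symmetric] a_def n_def distrib_left)
  also have "of_int (a ^ (n - 1)) * (of_int a * x ^ n) = (of_int a * x) ^ n"
    using power_minus_mult[OF n, of "of_int a :: 'a"] by (simp add: power_mult_distrib flip: mult.assoc)
  also have "of_int (a ^ (n - 1)) * (\<Sum>i<n. of_int (coeff p i) * x ^ i) = (\<Sum>i<n. of_int (coeff p i * a ^ (n - 1 - i)) * (of_int a * x) ^ i)"
    unfolding sum_distrib_left
  proof (rule sum.cong)
    fix i assume "i \<in> {..<n}"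
    hence "a ^ (n - 1) = a ^ (n - 1 - i) * a ^ i" by (simp add: power_add[symmetric])
    thus "of_int (a ^ (n - 1)) * (of_int (coeff p i) * x ^ i) = of_int (coeff p i * a ^ (n - 1 - i)) * (of_int a * x) ^ i"
      by (simp add: power_mult_distrib)
  qed simp
  finally have "(of_int a * x) ^ n = (\<Sum>i<n. of_int (- (coeff p i * a ^ (n - 1 - i))) * (of_int a * x) ^ i)"
    by (simp add: sum_negf eq_neg_iff_add_eq_0 add.commute)
  hence ai: "algebraic_int (of_int a * x)" by (rule algebraic_int_if_power_eq)
  show ?thesis
  proof (cases "a > 0")
    case True then show ?thesis using that ai by blast
  next
    case False
    have "algebraic_int (- (of_int a * x))" using ai by blast
    hence "algebraic_int (of_int (- a) * x)" by simp
    thus ?thesis using that[of "- a"] False a by auto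
  qed
qed

text \<open>\<open>m\<close> clears the denominator of \<open>inverse a\<close>. Hence every nonzero
  ideal contains a positive integer.\<close>

lemma algebraic_int_dvd_int:
  fixes a :: "'a::field_char_0"
  assumes "algebraic_int a" "a \<noteq> 0"
  obtains m :: int and b where "m > 0" "algebraic_int b" "a * b = of_int m"
proof -
  have "algebraic (inverse a)" using assms by blast
  then obtain m :: int where "m > 0" "algebraic_int (of_int m * inverse a)"
    by (rule algebraic_imp_int_mult)
  thus ?thesis using that[of m "of_int m * inverse a"] assms by simp
qed

section \<open>Non-archimedean absolute values\<close>

locale nonarch_abs =
  fixes w :: "'a::field_char_0 \<Rightarrow> real"
  assumes nonneg [simp]: "w x \<ge> 0"
    and eq_0_iff [simp]: "w x = 0 \<longleftrightarrow> x = 0"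
    and mult: "w (x * y) = w x * w y"
    and ultra: "w (x + y) \<le> max (w x) (w y)"
begin

lemma one [simp]: "w 1 = 1"
  using mult[of 1 1] eq_0_iff[of 1] by (metis mult_cancel_left2 one_neq_zero mult_1)

lemma pos: "x \<noteq> 0 \<Longrightarrow> w x > 0"
  using eq_0_iff[of x] nonneg[of x] by linarith

lemma uminus [simp]: "w (- x) = w x"
proof -
  have "w (- 1) * w (- 1) = 1" using mult[of "- 1" "- 1"] by simp
  hence "w (- 1) = 1" using nonneg[of "- 1"] by (metis abs_of_nonneg abs_mult_self_eq power2_eq_square power2_eq_1_iff abs_1 abs_minus)
  thus ?thesis using mult[of "- 1" x] by simp
qed

lemma diff: "w (x - y) \<le> max (w x) (w y)"
  using ultra[of x "- y"] by simp

lemma power: "w (x ^ n) = w x ^ n"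
  by (induction n) (auto simp: mult)

lemma inverse: "w (inverse x) = inverse (w x)"
proof (cases "x = 0")
  case True
  then show ?thesis by (metis eq_0_iff inverse_zero)
next
  case False
  hence "w x * w (inverse x) = 1" using mult[of x "inverse x"] by simp
  then show ?thesis by (metis inverse_unique)
qed

lemma divide: "w (x / y) = w x / w y"
  by (simp add: field_class.field_divide_inverse mult inverse)

lemma prod: "w (\<Prod>i\<in>A. f i) = (\<Prod>i\<in>A. w (f i))"
  by (induction A rule: infinite_finite_induct) (auto simp: mult)

lemma sum_le: "B \<ge> 0 \<Longrightarrow> (\<And>i. i \<in> A \<Longrightarrow> w (f i) \<le> B) \<Longrightarrow> w (\<Sum>i\<in>A. f i) \<le> B"
proof (induction A rule: infinite_finite_induct)
  case (insert a A)
  hence "max (w (f a)) (w (sum f A)) \<le> B" by simp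
  from order.trans[OF ultra this] show ?case using insert.hyps by simp
qed (auto simp: eq_0_iff[THEN iffD2])

lemma of_nat_le_1: "w (of_nat n) \<le> 1"
proof (induction n)
  case (Suc n)
  then show ?case using ultra[of "1" "of_nat n"] by simp
qed (simp add: eq_0_iff[THEN iffD2])

lemma of_int_le_1: "w (of_int n) \<le> 1"
  using of_nat_le_1[of "nat \<bar>n\<bar>"] by (cases "n \<ge> 0") (auto simp: of_nat_nat)

text \<open>If \<open>w x > 1\<close>, the leading power strictly dominates all lower terms, so they
  cannot cancel it.\<close>

lemma monic_root_le_1:
  assumes "poly p x = 0" "lead_coeff p = 1" "\<And>i. w (coeff p i) \<le> 1"
  shows "w x \<le> 1"
proof (rule ccontr)
  assume "\<not> w x \<le> 1"
  hence gt: "w x > 1" by simp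
  define n where "n = degree p"
  have "0 = (\<Sum>i\<le>n. coeff p i * x ^ i)" using assms(1) by (simp add: poly_altdef n_def)
  also have "\<dots> = (\<Sum>i<n. coeff p i * x ^ i) + x ^ n"
    using assms(2) by (simp add: lessThan_Suc_atMost[symmetric] n_def)
  finally have eq: "x ^ n = - (\<Sum>i<n. coeff p i * x ^ i)" by (metis eq_neg_iff_add_eq_0 add.commute)
  have n: "n > 0"
  proof (rule Nat.gr0I)
    assume "n = 0"
    thus False using eq by simp
  qed
  have "w (\<Sum>i<n. coeff p i * x ^ i) \<le> w x ^ (n - 1)"
  proof (rule sum_le)
    fix i assume i: "i \<in> {..<n}"
    have "w (coeff p i * x ^ i) \<le> 1 * w x ^ i"
      unfolding mult power using assms(3) by (intro mult_right_mono) auto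
    also have "\<dots> \<le> w x ^ (n - 1)" using i gt by (auto intro!: power_increasing)
    finally show "w (coeff p i * x ^ i) \<le> w x ^ (n - 1)" .
  qed simp
  hence "w x ^ n \<le> w x ^ (n - 1)" using eq by (metis power uminus)
  moreover have "w x ^ (n - 1) < w x ^ n" using gt n by (intro power_strict_increasing) auto
  ultimately show False by simp
qed

lemma algebraic_int_le_1: "algebraic_int x \<Longrightarrow> w x \<le> 1"
  by (elim algebraic_int.cases, rule monic_root_le_1) (auto, metis Ints_cases of_int_le_1)

end

section \<open>Absolute values above a prime number\<close>

lemma (in nonarch_abs) coprime_eq_1:
  assumes "w (of_int p) < 1" "coprime p m"
  shows "w (of_int m) = 1"
proof (rule ccontr)
  assume "w (of_int m) \<noteq> 1"
  hence lt: "w (of_int m) < 1" using of_int_le_1[of m] by simp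
  obtain u v where "u * p + v * m = 1" using assms(2) bezout_int[of p m] by auto
  hence "1 = w (of_int u * of_int p + of_int v * of_int m)"
    by (metis of_int_1 of_int_add of_int_mult one)
  also have "\<dots> \<le> max (w (of_int u * of_int p)) (w (of_int v * of_int m))" by (rule ultra)
  finally have "1 \<le> max (w (of_int u * of_int p)) (w (of_int v * of_int m))" .
  moreover have "w (of_int u * of_int p) \<le> 1 * w (of_int p)"
    unfolding mult using of_int_le_1 by (intro mult_right_mono) auto
  moreover have "w (of_int v * of_int m) \<le> 1 * w (of_int m)"
    unfolding mult using of_int_le_1 by (intro mult_right_mono) auto
  ultimately show False using lt assms(1) by auto
qed

text \<open>The value at \<open>p\<close> is not normalized; bounds are therefore expressed as
  powers of \<open>w (of_nat p)\<close>, with exponents that depend on neither \<open>w\<close> nor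
  \<open>p\<close>.\<close>

locale padic_nonarch_abs = nonarch_abs w for w :: "'a::field_char_0 \<Rightarrow> real" +
  fixes p :: nat
  assumes prime: "Factorial_Ring.prime p" and less_1: "w (of_nat p) < 1"
begin

lemma not_dvd_int_eq_1: "\<not> int p dvd m \<Longrightarrow> w (of_int m) = 1"
  using coprime_eq_1[of "int p" m] less_1 prime by (simp add: prime_imp_coprime)

lemma not_dvd_nat_eq_1: "\<not> p dvd m \<Longrightarrow> w (of_nat m) = 1"
  using not_dvd_int_eq_1[of "int m"] by simp

lemma p_pos: "w (of_nat p) > 0"
  using prime by (intro pos) (auto simp: prime_gt_0_nat)

text \<open>The exponent of \<open>p\<close> in \<open>h\<close> is at most \<open>c\<close> because
  \<open>p >= 2\<close>; a bound by a power of 2 thus serves all primes at once.\<close>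

lemma int_ge:
  assumes "h \<noteq> 0" "\<bar>h\<bar> \<le> 2 ^ c"
  shows "w (of_int h) \<ge> w (of_nat p) ^ c"
proof -
  have pp: "Factorial_Ring.prime (int p)" using prime by simp
  obtain y where y: "h = int p ^ multiplicity (int p) h * y" "\<not> int p dvd y"
    using multiplicity_decompose'[of h "int p"] assms(1) pp by (metis not_prime_unit)
  define k where "k = multiplicity (int p) h"
  have "2 ^ k \<le> int p ^ k" using prime_ge_2_nat[OF prime] by (intro power_mono) auto
  also have "int p ^ k dvd h" by (simp add: k_def multiplicity_dvd)
  hence "int p ^ k \<le> \<bar>h\<bar>" using assms(1) by (intro zdvd_imp_le) auto
  also have "\<bar>h\<bar> \<le> 2 ^ c" by fact
  finally have "k \<le> c" by simp
  have "w (of_int h) = w (of_nat p ^ k * of_int y)" using y(1) unfolding k_def by (metis of_int_mult of_int_of_nat_eq of_int_power)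
  also have "\<dots> = w (of_nat p) ^ k" by (simp add: mult power not_dvd_int_eq_1 y(2))
  also have "\<dots> \<ge> w (of_nat p) ^ c" using \<open>k \<le> c\<close> less_1 by (intro power_decreasing) auto
  finally show ?thesis .
qed

text \<open>Among the factors of the factorial only the multiples of \<open>p\<close> have absolute
  value below 1, and dividing \<open>p\<close> out of these leaves \<open>fact q\<close>.\<close>

lemma fact_mult: "w (fact (p * q)) = w (of_nat p) ^ q * w (fact q)"
proof (induction q)
  case (Suc q)
  have step: "w (fact (p * q + r)) = w (fact (p * q))" if "r < p" for r
    using that
  proof (induction r)
    case (Suc r)
    have "\<not> p dvd (p * q + Suc r)"
      using Suc.prems by (metis dvd_add_right_iff dvd_triv_left nat_dvd_not_less zero_less_Suc)
    hence "w (of_nat (p * q + Suc r)) = 1" by (rule not_dvd_nat_eq_1)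
    thus ?case using Suc by (simp add: mult del: of_nat_Suc of_nat_add of_nat_mult)
  qed simp
  have "p * Suc q = Suc (p * q + (p - 1))" using prime_gt_0_nat[OF prime] by simp
  hence "fact (p * Suc q) = (of_nat (p * Suc q) * fact (p * q + (p - 1)) :: 'a)"
    by (metis fact_Suc)
  hence "w (fact (p * Suc q)) = w (of_nat p) * w (of_nat (Suc q)) * w (fact (p * q))"
    using step[of "p - 1"] prime_gt_0_nat[OF prime] by (simp only: mult of_nat_mult)
  thus ?case using Suc by (simp add: mult del: of_nat_Suc)
qed simp

text \<open>A crude form of Legendre's formula: for \<open>n = p * q\<close> the exponent of
  \<open>p\<close> is at most q + q by \<open>fact_mult\<close> and induction, and
  \<open>2 * q <= n\<close>. Other \<open>n\<close> inherit the bound from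
  \<open>n - 1\<close>.\<close>

lemma fact_ge: "w (fact n) \<ge> w (of_nat p) ^ n"
proof (induction n rule: less_induct)
  case (less n)
  show ?case
  proof (cases "n = 0")
    case False
    show ?thesis
    proof (cases "p dvd n")
      case True
      then obtain q where q: "n = p * q" by blast
      have "q < n" using q False prime_gt_1_nat[OF prime] by simp
      have "w (of_nat p) ^ n \<le> w (of_nat p) ^ (2 * q)"
        using q less_1 prime_ge_2_nat[OF prime] by (intro power_decreasing) auto
      also have "\<dots> = w (of_nat p) ^ q * w (of_nat p) ^ q" by (simp add: power_add[symmetric] mult_2)
      also have "\<dots> \<le> w (of_nat p) ^ q * w (fact q)"
        using less[OF \<open>q < n\<close>] by (intro mult_left_mono) auto
      also have "\<dots> = w (fact n)" using fact_mult q by simp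
      finally show ?thesis .
    next
      case ndvd: False
      obtain m where m: "n = Suc m" using False by (cases n) auto
      have "w (of_nat p) ^ n \<le> w (of_nat p) ^ m" using less_1 m by (intro power_decreasing) auto
      also have "\<dots> \<le> w (fact m)" using less m by simp
      also have "\<dots> = w (fact n)" using not_dvd_nat_eq_1[OF ndvd] m by (simp add: mult del: of_nat_Suc)
      finally show ?thesis .
    qed
  qed simp
qed

end

section \<open>Geometric bounds for Pochhammer symbols\<close>

lemma integer_poly_growth:
  fixes g :: "int poly" and D :: int
  obtains c :: nat where "\<And>k. \<bar>poly g (- D * int k)\<bar> \<le> 2 ^ (c * Suc k)"
proof -
  define d where "d = degree g"
  \<comment> \<open>The value is at most \<open>S * (k + 1)^d\<close>, and \<open>S\<close> and
    \<open>k + 1\<close> are each below 2 to that exponent, so the exponent of 2 becomes linear in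
    \<open>k\<close>. The argument \<open>- D * k\<close> is the value of D b for which b + k
    vanishes.\<close>
  define S where "S = (\<Sum>i\<le>d. \<bar>coeff g i\<bar> * \<bar>D\<bar> ^ i)"
  have S0: "S \<ge> 0" by (auto simp: S_def intro!: sum_nonneg)
  have less2: "int n \<le> 2 ^ n" for n
    using of_nat_less_two_power[of n, where ?'a = int] by simp
  have "\<bar>poly g (- D * int k)\<bar> \<le> 2 ^ ((nat S + d) * Suc k)" for k
  proof -
    have "\<bar>poly g (- D * int k)\<bar> \<le> (\<Sum>i\<le>d. \<bar>coeff g i * (- D * int k) ^ i\<bar>)"
      unfolding poly_altdef d_def by (rule sum_abs)
    also have "\<dots> \<le> (\<Sum>i\<le>d. \<bar>coeff g i\<bar> * \<bar>D\<bar> ^ i * int (Suc k) ^ d)"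
    proof (rule sum_mono)
      fix i assume i: "i \<in> {..d}"
      have "int k ^ i \<le> int (Suc k) ^ i" by (intro power_mono) auto
      moreover have "int (Suc k) ^ i \<le> int (Suc k) ^ d" using i by (intro power_increasing) auto
      ultimately have "int k ^ i \<le> int (Suc k) ^ d" by (rule order.trans)
      hence "(\<bar>coeff g i\<bar> * \<bar>D\<bar> ^ i) * int k ^ i \<le> (\<bar>coeff g i\<bar> * \<bar>D\<bar> ^ i) * int (Suc k) ^ d"
        by (intro mult_left_mono) auto
      thus "\<bar>coeff g i * (- D * int k) ^ i\<bar> \<le> \<bar>coeff g i\<bar> * \<bar>D\<bar> ^ i * int (Suc k) ^ d"
        by (simp add: abs_mult power_abs power_mult_distrib)
    qed
    also have "\<dots> = S * int (Suc k) ^ d" by (simp add: S_def sum_distrib_right)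
    also have "\<dots> \<le> 2 ^ nat S * (2 ^ Suc k) ^ d"
      using S0 less2[of "nat S"] less2[of "Suc k"]
      by (intro mult_mono power_mono) auto
    also have "\<dots> = 2 ^ (nat S + d * Suc k)" by (simp only: power_add power_mult[symmetric] mult.commute)
    also have "\<dots> \<le> 2 ^ ((nat S + d) * Suc k)" by (intro power_increasing) auto
    finally show ?thesis by simp
  qed
  thus ?thesis using that by blast
qed

lemma algebraic_int_poly:
  fixes x :: "'a::field_char_0"
  assumes "algebraic_int x"
  shows "algebraic_int (poly (map_poly of_int g) x)"
  unfolding poly_altdef using assms by (auto simp: coeff_map_poly intro!: algebraic_int_intros)

lemma map_poly_of_int_mult:
  "map_poly of_int (p * q) = (map_poly of_int p * map_poly of_int q :: 'a::comm_ring_1 poly)"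
  by (intro poly_eqI) (simp add: coeff_map_poly coeff_mult)

text \<open>A nonzero integer polynomial of least degree that kills \<open>x\<close> works: an
  integer root \<open>m\<close> different from \<open>x\<close> could be divided out, since
  \<open>[:- m, 1:]\<close> is monic.\<close>

lemma algebraic_int_nonvanishing_poly:
  fixes x :: "'a::field_char_0"
  assumes "algebraic_int x"
  obtains g :: "int poly" where "poly (map_poly of_int g) x = 0" 
    "\<And>m. x \<noteq> of_int m \<Longrightarrow> poly g m \<noteq> 0"
proof -
  define P where "P = (\<lambda>g::int poly. poly (map_poly of_int g) x = 0 \<and> g \<noteq> 0)"
  obtain g0 :: "int poly" where "poly (map_poly of_int g0) x = 0" "lead_coeff g0 = 1"
    using assms unfolding algebraic_int_altdef_ipoly by blast
  hence "P g0" by (auto simp: P_def)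
  define g where "g = arg_min degree P"
  have g: "P g" "\<And>h. P h \<Longrightarrow> degree g \<le> degree h"
    using arg_min_nat_lemma[of P g0 degree] \<open>P g0\<close> unfolding g_def by auto
  have "poly g m \<noteq> 0" if "x \<noteq> of_int m" for m
  proof
    assume "poly g m = 0"
    then obtain h where h: "g = [:- m, 1:] * h" by (auto simp: poly_eq_0_iff_dvd)
    have "h \<noteq> 0" using g(1) h by (auto simp: P_def)
    have "poly (map_poly of_int g) x = (x - of_int m) * poly (map_poly of_int h) x"
      unfolding h map_poly_of_int_mult by (simp add: map_poly_pCons algebra_simps)
    hence "P h" using g(1) that \<open>h \<noteq> 0\<close> by (auto simp: P_def)
    hence "degree g \<le> degree h" by (rule g(2))
    moreover have "degree g = Suc (degree h)" unfolding h using \<open>h \<noteq> 0\<close> by (subst degree_mult_eq) auto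
    ultimately show False by simp
  qed
  thus ?thesis using that g(1) by (auto simp: P_def)
qed


text \<open>Over the integers X - m divides g - g(m); the quotient evaluated at \<open>x\<close> is
  \<open>z\<close>.\<close>

lemma algebraic_int_poly_diff_factor:
  fixes x :: "'a::field_char_0"
  assumes "algebraic_int x"
  obtains z where "algebraic_int z"
    "poly (map_poly of_int g) x - of_int (poly g m) = (x - of_int m) * z"
proof -
  have "poly (g - [:poly g m:]) m = 0" by simp
  then obtain h where h: "g - [:poly g m:] = [:- m, 1:] * h" by (metis poly_eq_0_iff_dvd dvdE)
  hence g: "g = [:- m, 1:] * h + [:poly g m:]" by (metis diff_add_cancel)
  have add: "map_poly of_int (a + b) = (map_poly of_int a + map_poly of_int b :: 'a poly)" for a b
    by (intro poly_eqI) (simp add: coeff_map_poly)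
  have "poly (map_poly of_int g) x = (x - of_int m) * poly (map_poly of_int h) x + of_int (poly g m)"
    by (subst g, subst add, subst map_poly_of_int_mult) (simp add: map_poly_pCons algebra_simps)
  thus ?thesis using that[of "poly (map_poly of_int h) x"] algebraic_int_poly[OF assms] by simp
qed

text \<open>Since \<open>g\<close> kills \<open>D * b\<close>, the integer g(- D k) is D (b + k)
  times an algebraic integer, so its absolute value bounds that of b + k from below; and being
  nonzero of controlled size, it is itself bounded below by \<open>int_ge\<close>.\<close>

lemma (in padic_nonarch_abs) shifted_ge:
  assumes "algebraic_int (of_int D * b)" "D \<noteq> 0"
    and "poly (map_poly of_int g) (of_int D * b) = 0" "\<bar>poly g (- D * int k)\<bar> \<le> 2 ^ c"
    and "poly g (- D * int k) \<noteq> 0"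
  shows "w (b + of_nat k) \<ge> w (of_nat p) ^ c"
proof -
  obtain z where z: "algebraic_int z" "poly (map_poly of_int g) (of_int D * b) - of_int (poly g (- D * int k))
      = (of_int D * b - of_int (- D * int k)) * z"
    using algebraic_int_poly_diff_factor[OF assms(1)] by blast
  have "w (of_nat p) ^ c \<le> w (of_int (poly g (- D * int k)))" using assms by (intro int_ge)
  also have "of_int (poly g (- D * int k)) = - (of_int D * (b + of_nat k) * z)"
  proof -
    have "of_int D * b - of_int (- D * int k) = of_int D * (b + of_nat k)" by (simp add: distrib_left)
    thus ?thesis using z(2) assms(3) by (metis diff_0 minus_minus)
  qed
  also have "w (- (of_int D * (b + of_nat k) * z)) = w (of_int D * (b + of_nat k) * z)" by (rule uminus)
  also have "\<dots> = w (b + of_nat k) * (w (of_int D) * w z)" by (simp add: mult)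
  also have "\<dots> \<le> w (b + of_nat k) * (1 * 1)"
    using of_int_le_1 algebraic_int_le_1[OF z(1)] by (intro mult_left_mono mult_mono) auto
  finally show ?thesis by simp
qed

text \<open>If \<open>b + k\<^sub>0\<close> is the \<open>p\<close>-adically smallest factor of the Pochhammer symbol, every other factor
  \<open>b + k\<close> is at least as large as \<open>k - k\<^sub>0\<close>, and the product of the differences divides \<open>n!\<close>.\<close>

lemma (in padic_nonarch_abs) pochhammer_ge:
  assumes "n > 0" "\<And>k. k < n \<Longrightarrow> w (b + of_nat k) \<ge> B"
  shows "w (pochhammer b n) \<ge> B * w (of_nat p) ^ n"
proof -
  define k0 where "k0 = arg_min_on (\<lambda>k. w (b + of_nat k)) {..<n}"
  have k0: "k0 < n" "\<And>k. k < n \<Longrightarrow> w (b + of_nat k0) \<le> w (b + of_nat k)"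
    using arg_min_if_finite(1)[of "{..<n}" "\<lambda>k. w (b + of_nat k)"]
      arg_min_least[of "{..<n}" _ "\<lambda>k. w (b + of_nat k)"] assms(1)
    unfolding k0_def by auto
  have ge: "w (b + of_nat k) \<ge> w (of_int (int k - int k0))" if "k < n" for k
    using diff[of "b + of_nat k" "b + of_nat k0"] k0(2)[OF that] by simp
  have e1: "(\<Prod>k<k0. w (of_int (int k - int k0))) = w (fact k0)"
  proof -
    have "(\<Prod>k<k0. w (of_int (int k - int k0))) = (\<Prod>k<k0. w (of_nat (k0 - k)))"
    proof (rule prod.cong)
      fix k assume "k \<in> {..<k0}"
      hence "(of_int (int k - int k0) :: 'a) = - of_nat (k0 - k)" by (simp add: of_nat_diff)
      thus "w (of_int (int k - int k0)) = w (of_nat (k0 - k))" by (metis uminus)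
    qed simp
    also have "\<dots> = w (\<Prod>k<k0. of_nat (k0 - k))" by (simp add: prod)
    also have "(\<Prod>k<k0. of_nat (k0 - k)) = (fact k0 :: 'a)"
      by (simp add: fact_prod_rev atLeast0LessThan)
    finally show ?thesis .
  qed
  define m where "m = n - Suc k0"
  have e2: "(\<Prod>k\<in>{Suc k0..<n}. w (of_int (int k - int k0))) = w (fact m)"
  proof -
    have "(\<Prod>k\<in>{Suc k0..<n}. w (of_int (int k - int k0))) = (\<Prod>k\<in>{1..m}. w (of_nat k))"
      using k0(1) by (intro prod.reindex_bij_witness[of _ "\<lambda>k. k + k0" "\<lambda>k. k - k0"])
        (auto simp: m_def of_nat_diff)
    also have "\<dots> = w (fact m)" by (simp add: fact_prod flip: prod)
    finally show ?thesis .
  qed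
  have split: "{0..<n} = insert k0 ({..<k0} \<union> {Suc k0..<n})" using k0(1) by auto
  have "w (pochhammer b n) = (\<Prod>k\<in>{0..<n}. w (b + of_nat k))"
    by (simp add: pochhammer_prod prod)
  also have "\<dots> = w (b + of_nat k0) * ((\<Prod>k<k0. w (b + of_nat k)) * (\<Prod>k\<in>{Suc k0..<n}. w (b + of_nat k)))"
    unfolding split by (subst prod.insert, force, force, subst prod.union_disjoint) auto
  also have "\<dots> \<ge> w (b + of_nat k0) * ((\<Prod>k<k0. w (of_int (int k - int k0))) * (\<Prod>k\<in>{Suc k0..<n}. w (of_int (int k - int k0))))"
    using k0(1) ge by (intro mult_left_mono mult_mono prod_mono prod_nonneg) auto
  also have "(\<Prod>k<k0. w (of_int (int k - int k0))) * (\<Prod>k\<in>{Suc k0..<n}. w (of_int (int k - int k0))) = w (fact k0) * w (fact m)"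
    by (simp only: e1 e2)
  finally have 1: "w (b + of_nat k0) * (w (fact k0) * w (fact m)) \<le> w (pochhammer b n)" .
  \<comment> \<open>\<open>k0 + m = n - 1\<close>, so the two factorials together cost at most
    \<open>n\<close> powers of \<open>p\<close>.\<close>
  have "w (of_nat p) ^ n \<le> w (of_nat p) ^ (k0 + m)" using k0(1) less_1 by (intro power_decreasing) (auto simp: m_def)
  also have "\<dots> = w (of_nat p) ^ k0 * w (of_nat p) ^ m" by (rule power_add)
  also have "\<dots> \<le> w (fact k0) * w (fact m)" by (intro mult_mono fact_ge) auto
  finally have "w (b + of_nat k0) * w (of_nat p) ^ n \<le> w (b + of_nat k0) * (w (fact k0) * w (fact m))"
    by (intro mult_left_mono) auto
  moreover have "B * w (of_nat p) ^ n \<le> w (b + of_nat k0) * w (of_nat p) ^ n"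
    using assms(2)[OF k0(1)] by (intro mult_right_mono) auto
  ultimately show ?thesis using 1 by linarith
qed

text \<open>The exponent is \<open>c + 1\<close>: \<open>c\<close> pays for the smallest factor,
  since \<open>c * Suc k <= c * n\<close> for \<open>k < n\<close>, and 1 for the factorials in
  \<open>pochhammer_ge\<close>. That \<open>b\<close> is no nonpositive integer keeps all values g(-
  D k) nonzero.\<close>

lemma pochhammer_lower_bound:
  fixes b :: "'a::field_char_0"
  assumes "algebraic b" "b \<notin> \<int>\<^sub>\<le>\<^sub>0"
  obtains N where "\<And>w p n. padic_nonarch_abs w p \<Longrightarrow> w (of_nat p) ^ (N * n) \<le> w (pochhammer b n)"
proof -
  obtain D :: int where D: "D > 0" "algebraic_int (of_int D * b)"
    using assms(1) by (rule algebraic_imp_int_mult)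
  obtain g :: "int poly" where g: "poly (map_poly of_int g) (of_int D * b) = 0" 
    "\<And>m. of_int D * b \<noteq> of_int m \<Longrightarrow> poly g m \<noteq> 0"
    using algebraic_int_nonvanishing_poly[OF D(2)] by blast
  obtain c :: nat where c: "\<And>k. \<bar>poly g (- D * int k)\<bar> \<le> 2 ^ (c * Suc k)"
    using integer_poly_growth by blast
  have nz: "poly g (- D * int k) \<noteq> 0" for k
  proof (rule g(2))
    have "b \<noteq> - of_nat k" using assms(2) by auto
    thus "of_int D * b \<noteq> of_int (- D * int k)" using D(1)
      by (metis mult_minus_left mult_minus_right mult_left_cancel of_int_0_eq_iff of_int_minus of_int_mult of_int_of_nat_eq less_irrefl)
  qed
  have "w (of_nat p) ^ ((c + 1) * n) \<le> w (pochhammer b n)" if "padic_nonarch_abs w p" for w p n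
  proof -
    interpret padic_nonarch_abs w p by fact
    show ?thesis
    proof (cases "n = 0")
      case False
      have "w (b + of_nat k) \<ge> w (of_nat p) ^ (c * n)" if "k < n" for k
      proof -
        have "w (of_nat p) ^ (c * n) \<le> w (of_nat p) ^ (c * Suc k)"
          using less_1 that by (intro power_decreasing mult_left_mono) auto
        also have "\<dots> \<le> w (b + of_nat k)"
          using shifted_ge[OF D(2) _ g(1) c nz] D(1) by simp
        finally show ?thesis .
      qed
      hence "w (of_nat p) ^ (c * n) * w (of_nat p) ^ n \<le> w (pochhammer b n)"
        using False by (intro pochhammer_ge) auto
      thus ?thesis by (simp add: power_add[symmetric] algebra_simps)
    qed simp
  qed
  thus ?thesis using that by blast
qed

text \<open>\<open>D\<close> clears the denominator of every factor, and \<open>D <= 2^c\<close>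
  bounds the power of \<open>p\<close> in \<open>D\<close> by \<open>c\<close>. The choice
  \<open>c = nat D\<close> is wasteful but independent of \<open>p\<close>.\<close>

lemma pochhammer_upper_bound:
  fixes a :: "'a::field_char_0"
  assumes "algebraic a"
  obtains N where "\<And>w p n. padic_nonarch_abs w p \<Longrightarrow> w (of_nat p) ^ (N * n) * w (pochhammer a n) \<le> 1"
proof -
  obtain D :: int where D: "D > 0" "algebraic_int (of_int D * a)"
    using assms(1) by (rule algebraic_imp_int_mult)
  define c where "c = nat D"
  have c: "\<bar>D\<bar> \<le> 2 ^ c"
    using of_nat_less_two_power[of c, where ?'a = int] D(1) by (simp add: c_def)
  have "w (of_nat p) ^ (c * n) * w (pochhammer a n) \<le> 1" if "padic_nonarch_abs w p" for w p n
  proof -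
    interpret padic_nonarch_abs w p by fact
    have le: "w (of_nat p) ^ c * w (a + of_nat k) \<le> 1" for k
    proof -
      have "w (of_nat p) ^ c * w (a + of_nat k) \<le> w (of_int D) * w (a + of_nat k)"
        using int_ge[OF _ c] D(1) by (intro mult_right_mono) auto
      also have "\<dots> = w (of_int D * a + of_int (D * int k))" by (simp add: mult[symmetric] algebra_simps)
      also have "\<dots> \<le> 1"
        using ultra[of "of_int D * a" "of_int (D * int k)"] algebraic_int_le_1[OF D(2)] of_int_le_1[of "D * int k"]
        by simp
      finally show ?thesis .
    qed
    show ?thesis
    proof (induction n)
      case (Suc n)
      have "w (of_nat p) ^ (c * Suc n) * w (pochhammer a (Suc n)) =
          (w (of_nat p) ^ (c * n) * w (pochhammer a n)) * (w (of_nat p) ^ c * w (a + of_nat n))"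
        by (simp add: pochhammer_Suc mult power_add)
      also have "\<dots> \<le> 1 * 1" using Suc le[of n] by (intro mult_mono) auto
      finally show ?case by simp
    qed simp
  qed
  thus ?thesis using that by blast
qed

lemma pochhammer_list_upper_bound:
  fixes as :: "'a::field_char_0 list"
  assumes "\<And>a. a \<in> set as \<Longrightarrow> algebraic a"
  shows "\<exists>N. \<forall>w p n. padic_nonarch_abs w p \<longrightarrow> w (of_nat p) ^ (N * n) * w (\<Prod>a\<leftarrow>as. pochhammer a n) \<le> 1"
  using assms
proof (induction as)
  case Nil
  have "w (of_nat p) ^ (0 * n) * w 1 \<le> 1" if "padic_nonarch_abs w p" for w :: "'a \<Rightarrow> real" and p n
  proof -
    interpret padic_nonarch_abs w p by fact
    show ?thesis by simp
  qed
  thus ?case by (auto intro!: exI[of _ 0])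
next
  case (Cons a as)
  obtain N where N: "\<forall>w p n. padic_nonarch_abs w p \<longrightarrow> w (of_nat p) ^ (N * n) * w (\<Prod>a\<leftarrow>as. pochhammer a n) \<le> 1"
    using Cons by auto
  obtain M where M: "\<forall>w p n. padic_nonarch_abs w p \<longrightarrow> w (of_nat p) ^ (M * n) * w (pochhammer a n) \<le> 1"
    using Cons.prems[of a] by (auto elim: pochhammer_upper_bound)
  have "w (of_nat p) ^ ((N + M) * n) * w (\<Prod>a\<leftarrow>a # as. pochhammer a n) \<le> 1" if "padic_nonarch_abs w p" for w p n
  proof -
    interpret padic_nonarch_abs w p by fact
    have "w (of_nat p) ^ ((N + M) * n) * w (\<Prod>a\<leftarrow>a # as. pochhammer a n)
      = (w (of_nat p) ^ (N * n) * w (\<Prod>a\<leftarrow>as. pochhammer a n)) * (w (of_nat p) ^ (M * n) * w (pochhammer a n))"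
      by (simp add: mult distrib_right power_add)
    also have "\<dots> \<le> 1 * 1" using N[rule_format, OF that] M[rule_format, OF that] by (intro mult_mono) auto
    finally show ?thesis by simp
  qed
  thus ?case by blast
qed

lemma pochhammer_list_lower_bound:
  fixes bs :: "'a::field_char_0 list"
  assumes "\<And>b. b \<in> set bs \<Longrightarrow> algebraic b" "set bs \<inter> \<int>\<^sub>\<le>\<^sub>0 = {}"
  shows "\<exists>N. \<forall>w p n. padic_nonarch_abs w p \<longrightarrow> w (of_nat p) ^ (N * n) \<le> w (\<Prod>b\<leftarrow>bs. pochhammer b n)"
  using assms
proof (induction bs)
  case Nil
  have "w (of_nat p) ^ (0 * n) \<le> w 1" if "padic_nonarch_abs w p" for w :: "'a \<Rightarrow> real" and p n
  proof -
    interpret padic_nonarch_abs w p by fact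
    show ?thesis by simp
  qed
  thus ?case by (auto intro!: exI[of _ 0])
next
  case (Cons b bs)
  obtain N where N: "\<forall>w p n. padic_nonarch_abs w p \<longrightarrow> w (of_nat p) ^ (N * n) \<le> w (\<Prod>b\<leftarrow>bs. pochhammer b n)"
    using Cons by auto
  obtain M where M: "\<forall>w p n. padic_nonarch_abs w p \<longrightarrow> w (of_nat p) ^ (M * n) \<le> w (pochhammer b n)"
  proof -
    have "algebraic b" "b \<notin> \<int>\<^sub>\<le>\<^sub>0" using Cons.prems by auto
    thus ?thesis by (rule pochhammer_lower_bound) (use that in blast)
  qed
  have "w (of_nat p) ^ ((N + M) * n) \<le> w (\<Prod>b\<leftarrow>b # bs. pochhammer b n)" if "padic_nonarch_abs w p" for w p n
  proof -
    interpret padic_nonarch_abs w p by fact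
    have "w (of_nat p) ^ ((N + M) * n) = w (of_nat p) ^ (N * n) * w (of_nat p) ^ (M * n)"
      by (simp add: distrib_right power_add)
    also have "\<dots> \<le> w (\<Prod>b\<leftarrow>bs. pochhammer b n) * w (pochhammer b n)"
      using N[rule_format, OF that] M[rule_format, OF that] by (intro mult_mono) auto
    finally show ?thesis by (simp add: mult mult_ac)
  qed
  thus ?case by blast
qed

theorem hypergeometric_growth:
  fixes as bs :: "'a::field_char_0 list"
  assumes "\<And>a. a \<in> set as \<union> set bs \<Longrightarrow> algebraic a" "set bs \<inter> \<int>\<^sub>\<le>\<^sub>0 = {}"
  obtains N where "\<And>w p n. padic_nonarch_abs w p \<Longrightarrow>
    w (of_nat p) ^ (N * n) * w (fps_nth (hypergeometric_series as bs) n) \<le> 1"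
proof -
  obtain N where N: "\<forall>w p n. padic_nonarch_abs w p \<longrightarrow> w (of_nat p) ^ (N * n) * w (\<Prod>a\<leftarrow>as. pochhammer a n) \<le> 1"
    using pochhammer_list_upper_bound[of as] assms(1) by auto
  obtain M where M: "\<forall>w p n. padic_nonarch_abs w p \<longrightarrow> w (of_nat p) ^ (M * n) \<le> w (\<Prod>b\<leftarrow>bs. pochhammer b n)"
    using pochhammer_list_lower_bound[of bs] assms by auto
  have "w (of_nat p) ^ ((N + M) * n) * w (fps_nth (hypergeometric_series as bs) n) \<le> 1"
    if "padic_nonarch_abs w p" for w p n
  proof -
    interpret padic_nonarch_abs w p by fact
    define A where "A = w (\<Prod>a\<leftarrow>as. pochhammer a n)"
    define B where "B = w (\<Prod>b\<leftarrow>bs. pochhammer b n)"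
    have "B > 0" using M[rule_format, OF that, of n] p_pos unfolding B_def by (smt (verit) zero_less_power)
    have "w (of_nat p) ^ ((N + M) * n) * (A / B) = (w (of_nat p) ^ (N * n) * A) * (w (of_nat p) ^ (M * n) / B)"
      by (simp add: distrib_right power_add)
    also have "\<dots> \<le> 1 * 1"
      using N[rule_format, OF that, of n] M[rule_format, OF that, of n] \<open>B > 0\<close> unfolding A_def[symmetric] B_def[symmetric]
      by (intro mult_mono) (auto simp: A_def)
    finally show ?thesis by (simp add: hypergeometric_series_def divide A_def B_def)
  qed
  thus ?thesis using that by blast
qed

text \<open>Expanding (x + y)^n binomially gives \<open>w (x + y) ^ n <= (n + 1) * M ^ n\<close>, as
  \<open>w\<close> is at most 1 on binomial coefficients; the factor n + 1 disappears on taking n-th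
  roots. This serves absolute values pulled back from the closure of Q_p and its completion, for
  which only the triangle inequality is at hand.\<close>

lemma nonarch_absI_bounded:
  fixes w :: "'a::field_char_0 \<Rightarrow> real"
  assumes nonneg: "\<And>x. w x \<ge> 0" and zero: "\<And>x. w x = 0 \<longleftrightarrow> x = 0"
    and mult: "\<And>x y. w (x * y) = w x * w y" and tri: "\<And>x y. w (x + y) \<le> w x + w y"
    and nat: "\<And>n. w (of_nat n) \<le> 1"
  shows "nonarch_abs w"
proof
  fix x y
  have one: "w 1 = 1" using mult[of 1 1] zero[of 1] by simp
  have power: "w (z ^ n) = w z ^ n" for z n by (induction n) (auto simp: one mult)
  have sum: "w (\<Sum>i\<in>A. f i) \<le> (\<Sum>i\<in>A. w (f i))" if "finite A" for A :: "nat set" and f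
    using that
  proof (induction A)
    case (insert a A)
    then show ?case using tri[of "f a" "sum f A"] by simp
  qed (simp add: zero[THEN iffD2])
  define M where "M = max (w x) (w y)"
  have M: "M \<ge> 0" using nonneg[of x] by (simp add: M_def)
  have le: "w (x + y) ^ n \<le> real (Suc n) * M ^ n" for n
  proof -
    have "w (x + y) ^ n = w (\<Sum>k\<le>n. of_nat (n choose k) * x ^ k * y ^ (n - k))"
      by (simp only: power[symmetric] binomial_ring)
    also have "\<dots> \<le> (\<Sum>k\<le>n. w (of_nat (n choose k) * x ^ k * y ^ (n - k)))" by (rule sum) simp
    also have "\<dots> \<le> (\<Sum>k\<le>n. M ^ n)"
    proof (rule sum_mono)
      fix k assume k: "k \<in> {..n}"
      have "w (of_nat (n choose k) * x ^ k * y ^ (n - k)) \<le> 1 * M ^ k * M ^ (n - k)"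
        unfolding mult power using nat nonneg M by (intro mult_mono power_mono) (auto simp: M_def)
      also have "\<dots> = M ^ n" using k by (simp add: power_add[symmetric])
      finally show "w (of_nat (n choose k) * x ^ k * y ^ (n - k)) \<le> M ^ n" .
    qed
    finally show ?thesis by simp
  qed
  show "w (x + y) \<le> max (w x) (w y)"
  proof (rule ccontr)
    assume "\<not> w (x + y) \<le> max (w x) (w y)"
    hence gt: "w (x + y) > M" unfolding M_def by (rule not_le_imp_less)
    show False
    proof (cases "M = 0")
      case True
      then show False using le[of 1] gt by simp
    next
      case False
      define r where "r = w (x + y) / M"
      have r: "r > 1" using gt M False by (simp add: r_def)
      \<comment> \<open>With \<open>r > 1\<close> this is absurd: (n + 1) / r^n tends to 0 but would
        have to stay at least 1.\<close>
      have rle: "r ^ n \<le> real (Suc n)" for n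
        using le[of n] M False by (simp add: r_def power_divide divide_le_eq)
      have "(\<lambda>n. real n / r ^ n) \<longlonglongrightarrow> 0"
      proof -
        have "(\<lambda>n. real n * inverse r ^ n) \<longlonglongrightarrow> 0"
          using r by (intro powser_times_n_limit_0) (auto simp: field_simps)
        thus ?thesis by (simp add: power_inverse field_class.field_divide_inverse)
      qed
      moreover have "(\<lambda>n. inverse (r ^ n)) \<longlonglongrightarrow> 0" using LIMSEQ_inverse_realpow_zero[OF r] .
      ultimately have "(\<lambda>n. real n / r ^ n + inverse (r ^ n)) \<longlonglongrightarrow> 0 + 0" by (rule tendsto_add)
      moreover have "real n / r ^ n + inverse (r ^ n) \<ge> 1" for n
        using rle[of n] r by (simp add: field_simps)
      ultimately have "1 \<le> (0::real)" by (intro tendsto_lowerbound[of _ 0 sequentially]) auto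
      thus False by simp
    qed
  qed
qed (use assms in auto)

section \<open>Prime ideals of a number field\<close>

lemma ring_of_integers_simps [simp]:
  "x \<in> carrier ring_of_integers \<longleftrightarrow> algebraic_int x"
  "x \<otimes>\<^bsub>ring_of_integers\<^esub> y = x * y" "x \<oplus>\<^bsub>ring_of_integers\<^esub> y = x + y"
  "\<one>\<^bsub>ring_of_integers\<^esub> = (1::'k::field_char_0)" "\<zero>\<^bsub>ring_of_integers\<^esub> = (0::'k)"
  by (simp_all add: ring_of_integers_def ring_of_type_algebra_def)

lemma cring_ring_of_integers: "cring (ring_of_integers :: 'k::field_char_0 ring)"
proof (rule cringI)
  show "abelian_group (ring_of_integers :: 'k ring)"
  proof (rule abelian_groupI)
    fix x :: 'k assume "x \<in> carrier ring_of_integers"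
    thus "\<exists>y\<in>carrier ring_of_integers. y \<oplus>\<^bsub>ring_of_integers\<^esub> x = \<zero>\<^bsub>ring_of_integers\<^esub>"
      by (intro bexI[of _ "- x"]) auto
  qed (auto simp: algebra_simps intro: algebraic_int_add)
  show "comm_monoid (ring_of_integers :: 'k ring)"
    by (rule comm_monoidI) (auto simp: algebra_simps intro: algebraic_int_mult)
qed (auto simp: algebra_simps)

lemma ideal_ring_of_integers_iff:
  fixes I :: "'k::field_char_0 set"
  shows "ideal I ring_of_integers \<longleftrightarrow> I \<subseteq> {x. algebraic_int x} \<and> 0 \<in> I \<and>
    (\<forall>a\<in>I. \<forall>b\<in>I. a + b \<in> I) \<and> (\<forall>a\<in>I. \<forall>x. algebraic_int x \<longrightarrow> x * a \<in> I)"
    (is "_ \<longleftrightarrow> ?R")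
proof
  assume "ideal I ring_of_integers"
  then interpret ideal I "ring_of_integers :: 'k ring" .
  show ?R
    using Icarr additive_subgroup.zero_closed[OF is_additive_subgroup]
      additive_subgroup.a_closed[OF is_additive_subgroup] I_l_closed by simp blast
next
  assume R: ?R
  interpret cring "ring_of_integers :: 'k ring" by (rule cring_ring_of_integers)
  show "ideal I ring_of_integers"
  proof (rule idealI)
    show "subgroup I (add_monoid (ring_of_integers :: 'k ring))"
    proof (rule add.subgroupI)
      fix a assume a: "a \<in> I"
      have "\<ominus>\<^bsub>ring_of_integers\<^esub> a = - a"
        using a R by (intro minus_equality) auto
      also have "\<dots> = (- 1) * a" by simp
      also have "\<dots> \<in> I" using a R algebraic_int_minus[OF algebraic_int_1] by blast
      finally show "\<ominus>\<^bsub>ring_of_integers\<^esub> a \<in> I" .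
    qed (use R in auto)
  qed (use R ring_axioms in \<open>auto simp: mult.commute\<close>)
qed

lemma primeideal_ring_of_integers_iff:
  fixes P :: "'k::field_char_0 set"
  shows "primeideal P ring_of_integers \<longleftrightarrow> ideal P ring_of_integers \<and> 1 \<notin> P \<and>
    (\<forall>a b. algebraic_int a \<longrightarrow> algebraic_int b \<longrightarrow> a * b \<in> P \<longrightarrow> a \<in> P \<or> b \<in> P)"
    (is "_ \<longleftrightarrow> ?R")
proof
  assume "primeideal P ring_of_integers"
  then interpret primeideal P "ring_of_integers :: 'k ring" .
  have "1 \<notin> P"
    using I_notcarr one_imp_carrier by auto
  thus ?R using is_ideal I_prime by simp
next
  assume ?R
  thus "primeideal P ring_of_integers"
    using cring_ring_of_integers by (intro primeidealI) auto
qed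

text \<open>The bound \<open>d\<close> on the degree, stated over the integers, is the only form in which finiteness is used.\<close>

locale number_field =
  fixes d :: nat
  assumes dependent: "\<exists>c. (\<exists>i\<le>d. c i \<noteq> 0) \<and> (\<Sum>i\<le>d. of_int (c i) * (f i :: 'k::field_char_0)) = 0"

text \<open>Any \<open>card B + 1\<close> elements are linearly dependent over the rationals, and a
  common denominator makes the coefficients integers.\<close>

lemma number_fieldI:
  assumes "\<exists>B. finite_dimensional_vector_space (\<lambda>(q::rat) (x::'k::field_char_0). of_rat q * x) B"
  shows "\<exists>d. number_field TYPE('k) d"
proof -
  obtain B where "finite_dimensional_vector_space (\<lambda>(q::rat) (x::'k). of_rat q * x) B"
    using assms by blast
  then interpret V: finite_dimensional_vector_space "\<lambda>(q::rat) (x::'k). of_rat q * x" B .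
  have "\<exists>c::nat \<Rightarrow> rat. (\<exists>i\<le>card B. c i \<noteq> 0) \<and> (\<Sum>i\<le>card B. of_rat (c i) * f i) = 0" for f :: "nat \<Rightarrow> 'k"
  proof (cases "inj_on f {..card B}")
    case True
    hence "card (f ` {..card B}) = Suc (card B)" by (simp add: card_image)
    hence "V.dependent (f ` {..card B})"
      using V.independent_span_bound[OF V.finite_Basis, of "f ` {..card B}"] V.span_Basis
      by auto
    then obtain u v where u: "v \<in> f ` {..card B}" "u v \<noteq> 0"
      "(\<Sum>v\<in>f ` {..card B}. of_rat (u v) * v) = 0"
      using V.dependent_finite[of "f ` {..card B}"] by auto
    show ?thesis
      using u True by (intro exI[of _ "u \<circ> f"]) (auto simp: sum.reindex)
  next
    case False
    then obtain i j where ij: "i \<le> card B" "j \<le> card B" "i \<noteq> j" "f i = f j"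
      by (auto simp: inj_on_def)
    \<comment> \<open>Dependence in the vector space speaks of sets; a repeated value gives a
      relation between indices at once.\<close>
    define c where "c = (\<lambda>k. if k = i then 1 else if k = j then - 1 else (0::rat))"
    have "(\<Sum>k\<le>card B. of_rat (c k) * f k) = (\<Sum>k\<in>{i,j}. of_rat (c k) * f k)"
      using ij by (intro sum.mono_neutral_right) (auto simp: c_def)
    also have "\<dots> = 0" using ij by (simp add: c_def)
    finally show ?thesis using ij(1) by (intro exI[of _ c]) (auto simp: c_def)
  qed
  note dep = this
  have "\<exists>c. (\<exists>i\<le>card B. c i \<noteq> 0) \<and> (\<Sum>i\<le>card B. of_int (c i) * f i) = 0" for f :: "nat \<Rightarrow> 'k"
  proof -
    obtain c i0 where c: "i0 \<le> card B" "c i0 \<noteq> 0" "(\<Sum>i\<le>card B. of_rat (c i) * f i) = 0"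
      using dep by blast
    define D where "D = (\<Prod>i\<le>card B. snd (quotient_of (c i)))"
    have D: "D \<noteq> 0" unfolding D_def by (simp add: less_imp_neq[OF quotient_of_denom_pos', symmetric])
    have "\<exists>m. of_int D * c i = of_int m" if "i \<le> card B" for i
    proof -
      have "snd (quotient_of (c i)) dvd D" unfolding D_def using that by (intro dvd_prodI) auto
      then obtain e where e: "D = snd (quotient_of (c i)) * e" by blast
      have "c i = of_int (fst (quotient_of (c i))) / of_int (snd (quotient_of (c i)))"
        using quotient_of_div[of "c i"] by (metis prod.collapse)
      hence "of_int D * c i = of_int (e * fst (quotient_of (c i)))"
        using e D by (simp add: field_simps)
      thus ?thesis by blast
    qed
    then obtain m where m: "\<And>i. i \<le> card B \<Longrightarrow> of_int D * c i = of_int (m i)" by metis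
    have "(\<Sum>i\<le>card B. of_int (m i) * f i) = (\<Sum>i\<le>card B. of_rat (of_int D * c i) * f i)"
      using m by (intro sum.cong) auto
    also have "\<dots> = of_int D * (\<Sum>i\<le>card B. of_rat (c i) * f i)"
      by (simp add: of_rat_mult sum_distrib_left mult.assoc)
    also have "\<dots> = 0" using c(3) by simp
    finally show ?thesis using m[OF c(1)] c D by (intro exI[of _ m] conjI exI[of _ i0]) auto
  qed
  thus ?thesis by (intro exI[of _ "card B"]) (unfold_locales, blast)
qed

section \<open>Residues modulo a prime number\<close>

context number_field
begin

lemma all_algebraic: "algebraic (x::'k)"
proof -
  obtain c i where c: "i \<le> d" "c i \<noteq> 0" "(\<Sum>i\<le>d. of_int (c i) * x ^ i) = 0"
    using dependent[of "\<lambda>i. x ^ i"] by blast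
  define p :: "'k poly" where "p = (\<Sum>i\<le>d. monom (of_int (c i)) i)"
  have p: "coeff p i = (if i \<le> d then of_int (c i) else 0)" for i
    by (simp add: p_def coeff_sum)
  have "p \<noteq> 0" using p[of i] c by auto
  moreover have "poly p x = 0" using c(3) by (simp add: p_def poly_sum poly_monom)
  ultimately show ?thesis by (intro algebraicI[of p]) (auto simp: p)
qed

text \<open>As long as \<open>p\<close> divides all coefficients, divide it out; the sum of their
  absolute values decreases, so this stops at a relation that is nontrivial modulo
  \<open>p\<close>.\<close>

lemma dependent_mod_prime:
  assumes p: "Factorial_Ring.prime (p::nat)"
  shows "\<exists>c. (\<exists>i\<le>d. \<not> int p dvd c i) \<and> (\<Sum>i\<le>d. of_int (c i) * (f i :: 'k)) = 0"
proof -
  have "\<exists>c. (\<exists>i\<le>d. \<not> int p dvd c i) \<and> (\<Sum>i\<le>d. of_int (c i) * f i) = 0"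
    if "(\<Sum>i\<le>d. \<bar>c i\<bar>) = int n" "\<exists>i\<le>d. c i \<noteq> 0" "(\<Sum>i\<le>d. of_int (c i) * f i) = 0" for c n
    using that
  proof (induction n arbitrary: c rule: less_induct)
    case (less n)
    show ?case
    proof (cases "\<exists>i\<le>d. \<not> int p dvd c i")
      case True
      then show ?thesis using less.prems by blast
    next
      case False
      define e where "e = (\<lambda>i. c i div int p)"
      have e: "c i = int p * e i" if "i \<le> d" for i using False that by (auto simp: e_def)
      have ne: "\<exists>i\<le>d. e i \<noteq> 0" using less.prems(2) e by auto
      have sum: "(\<Sum>i\<le>d. \<bar>c i\<bar>) = int p * (\<Sum>i\<le>d. \<bar>e i\<bar>)"
        unfolding sum_distrib_left using e by (intro sum.cong) (auto simp: abs_mult)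
      obtain j where j: "j \<le> d" "e j \<noteq> 0" using ne by blast
      have pos: "(\<Sum>i\<le>d. \<bar>e i\<bar>) > 0"
        using j by (intro sum_pos2[of "{..d}" j]) auto
      define m where "m = nat (\<Sum>i\<le>d. \<bar>e i\<bar>)"
      have m: "(\<Sum>i\<le>d. \<bar>e i\<bar>) = int m" using pos by (simp add: m_def)
      have "int n = int p * int m" using sum m less.prems(1) by simp
      hence "n = p * m" by (metis of_nat_eq_iff of_nat_mult)
      moreover have "m > 0" using pos m by simp
      ultimately have "m < n" using prime_gt_1_nat[OF p] by simp
      have "of_nat p * (\<Sum>i\<le>d. of_int (e i) * f i) = (\<Sum>i\<le>d. of_int (c i) * f i)"
        unfolding sum_distrib_left using e by (intro sum.cong) (auto simp: mult.assoc)
      hence "(\<Sum>i\<le>d. of_int (e i) * f i) = 0" using less.prems(3) prime_gt_0_nat[OF p] by simp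
      thus ?thesis using less.IH[OF \<open>m < n\<close> m ne] by blast
    qed
  qed
  moreover obtain c where "\<exists>i\<le>d. c i \<noteq> 0" "(\<Sum>i\<le>d. of_int (c i) * f i) = 0" using dependent[of f] by blast
  moreover have "(\<Sum>i\<le>d. \<bar>c i\<bar>) = int (nat (\<Sum>i\<le>d. \<bar>c i\<bar>))"
    by (simp add: sum_nonneg)
  ultimately show ?thesis by blast
qed

text \<open>Elements of the ring of integers that are independent modulo \<open>p\<close> are independent over the
  rationals, so the residue ring modulo \<open>p\<close> is finite.\<close>

lemma finite_residues:
  assumes p: "Factorial_Ring.prime (p::nat)"
  shows "\<exists>T :: 'k set. finite T \<and> (\<forall>t\<in>T. algebraic_int t) \<and>
    (\<forall>y. algebraic_int y \<longrightarrow> (\<exists>t\<in>T. algebraic_int ((y - t) / of_nat p)))"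
proof -
  \<comment> \<open>Independence over the field with \<open>p\<close> elements in the ring of
    integers modulo \<open>p\<close>, expressed through divisibility.\<close>
  define indep where "indep = (\<lambda>S::'k set. finite S \<and> (\<forall>s\<in>S. algebraic_int s) \<and>
    (\<forall>c::'k \<Rightarrow> int. algebraic_int ((\<Sum>s\<in>S. of_int (c s) * s) / of_nat p) \<longrightarrow> (\<forall>s\<in>S. int p dvd c s)))"
  have bound: "card S \<le> d" if S: "indep S" for S
  proof (rule ccontr)
    assume "\<not> card S \<le> d"
    hence "Suc d \<le> card S" by simp
    then obtain S' where S': "S' \<subseteq> S" "card S' = Suc d"
      by (rule obtain_subset_with_card_n)
    hence "finite S'" by (metis card.infinite nat.distinct(1))
    then obtain h where h: "bij_betw h {..d} S'"
      using S'(2) by (metis card_atMost finite_atMost finite_same_card_bij)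
    obtain c i where c: "i \<le> d" "\<not> int p dvd c i" "(\<Sum>i\<le>d. of_int (c i) * h i) = 0"
      using dependent_mod_prime[OF p, of h] by blast
    define e where "e = (\<lambda>s. if s \<in> S' then c (inv_into {..d} h s) else 0)"
    have "(\<Sum>s\<in>S. of_int (e s) * s) = (\<Sum>s\<in>S'. of_int (e s) * s)"
      using S' S by (intro sum.mono_neutral_right) (auto simp: indep_def e_def)
    also have "\<dots> = (\<Sum>i\<le>d. of_int (e (h i)) * h i)"
      using h by (intro sum.reindex_bij_betw[symmetric])
    also have "\<dots> = (\<Sum>i\<le>d. of_int (c i) * h i)"
      using h by (intro sum.cong) (auto simp: e_def bij_betw_def)
    finally have "(\<Sum>s\<in>S. of_int (e s) * s) = 0" using c(3) by simp
    hence "\<forall>s\<in>S. int p dvd e s" using S unfolding indep_def by simp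
    moreover have "h i \<in> S'" using h c(1) by (auto simp: bij_betw_def)
    moreover have "e (h i) = c i" using h c(1) \<open>h i \<in> S'\<close> by (auto simp: e_def bij_betw_def)
    ultimately show False using c(2) S'(1) by (metis subsetD)
  qed
  have "indep {}" by (simp add: indep_def)
  hence "\<exists>S. indep S \<and> (\<forall>S'. indep S' \<longrightarrow> card S' \<le> card S)"
    by (rule ex_has_greatest_nat[of indep _ card "Suc d"]) (auto simp: less_Suc_eq_le intro: bound)
  then obtain S where S: "indep S" and max: "\<forall>S'. indep S' \<longrightarrow> card S' \<le> card S"
    by blast
  have fin: "finite S" and SO: "\<And>s. s \<in> S \<Longrightarrow> algebraic_int s" using S by (auto simp: indep_def)
  \<comment> \<open>The combinations of \<open>S\<close> with coefficients from 0 to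
    \<open>p - 1\<close>; the coefficient functions are extensional, so there are finitely
    many.\<close>
  define T where "T = (\<lambda>e. \<Sum>s\<in>S. of_int (e s) * s) ` (S \<rightarrow>\<^sub>E {0..<int p})"
  have "\<exists>c. algebraic_int ((y - (\<Sum>s\<in>S. of_int (c s) * s)) / of_nat p)" if y: "algebraic_int y" for y
  proof (cases "y \<in> S")
    case True
    have "(\<Sum>s\<in>S. of_int (if s = y then 1 else 0) * s) = (\<Sum>s\<in>S. if s = y then s else 0)"
      by (intro sum.cong) auto
    also have "\<dots> = y" using fin True by simp
    finally show ?thesis
      by (intro exI[of _ "\<lambda>s. if s = y then 1 else 0"]) simp
  next
    case False
    have "card (insert y S) = Suc (card S)" using fin False by simp
    hence "\<not> indep (insert y S)" using max by force
    then obtain c where c: "algebraic_int ((\<Sum>s\<in>insert y S. of_int (c s) * s) / of_nat p)"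
      "\<not> (\<forall>s\<in>insert y S. int p dvd c s)"
      unfolding indep_def using fin SO y by auto
    define Z where "Z = (\<Sum>s\<in>S. of_int (c s) * s)"
    have c1: "algebraic_int ((of_int (c y) * y + Z) / of_nat p)"
      using c(1) fin False by (simp add: Z_def)
    \<comment> \<open>If \<open>p\<close> divided \<open>c y\<close>, the relation would reduce to
      one among \<open>S\<close> alone. So \<open>c y\<close> has an inverse modulo
      \<open>p\<close>, the \<open>v\<close> below, and the relation can be solved for
      \<open>y\<close>.\<close>
    have "\<not> int p dvd c y"
    proof
      assume dv: "int p dvd c y"
      then obtain e where e: "c y = int p * e" by blast
      have "(of_int (c y) * y + Z) / of_nat p - of_int e * y = Z / of_nat p"
        using prime_gt_0_nat[OF p] by (simp add: e field_simps)
      hence "algebraic_int (Z / of_nat p)"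
        using algebraic_int_diff[OF c1, of "of_int e * y"] y by (simp add: algebraic_int_mult)
      hence "\<forall>s\<in>S. int p dvd c s" using S unfolding indep_def Z_def by blast
      thus False using dv c(2) by blast
    qed
    hence "coprime (int p) (c y)" using p by (simp add: prime_imp_coprime)
    then obtain u v where uv: "u * int p + v * c y = 1" using bezout_int[of "int p" "c y"] by auto
    have "of_int v * ((of_int (c y) * y + Z) / of_nat p) + of_int u * y
        = ((of_int (u * int p + v * c y)) * y + of_int v * Z) / of_nat p"
      using prime_gt_0_nat[OF p] by (simp add: field_simps)
    also have "\<dots> = (y - (\<Sum>s\<in>S. of_int (- (v * c s)) * s)) / of_nat p"
    proof -
      have "(\<Sum>s\<in>S. of_int (- (v * c s)) * s) = - (of_int v * Z)"
        unfolding Z_def sum_distrib_left sum_negf[symmetric] by (intro sum.cong refl) simp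
      thus ?thesis unfolding uv by simp
    qed
    finally have "of_int v * ((of_int (c y) * y + Z) / of_nat p) + of_int u * y
        = (y - (\<Sum>s\<in>S. of_int (- (v * c s)) * s)) / of_nat p" .
    moreover have "algebraic_int (of_int v * ((of_int (c y) * y + Z) / of_nat p) + of_int u * y)"
      using c1 y by (intro algebraic_int_add algebraic_int_mult algebraic_int_of_int)
    ultimately have "algebraic_int ((y - (\<Sum>s\<in>S. of_int (- (v * c s)) * s)) / of_nat p)"
      by (simp only:)
    thus ?thesis by (rule exI[of _ "\<lambda>s. - (v * c s)"])
  qed
  note repr = this
  have "\<exists>t\<in>T. algebraic_int ((y - t) / of_nat p)" if y: "algebraic_int y" for y
  proof -
    obtain c where c: "algebraic_int ((y - (\<Sum>s\<in>S. of_int (c s) * s)) / of_nat p)"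
      using repr[OF y] by blast
    define e where "e = restrict (\<lambda>s. c s mod int p) S"
    have "(\<Sum>s\<in>S. of_int (c s) * s) - (\<Sum>s\<in>S. of_int (e s) * s) = of_nat p * (\<Sum>s\<in>S. of_int (c s div int p) * s)"
      unfolding sum_subtractf[symmetric] sum_distrib_left
    proof (rule sum.cong)
      fix s assume "s \<in> S"
      have "of_int (c s) = (of_int (int p * (c s div int p) + c s mod int p) :: 'k)" by simp
      hence "of_int (c s) = (of_nat p * of_int (c s div int p) + of_int (c s mod int p) :: 'k)"
        by (simp only: of_int_add of_int_mult of_int_of_nat_eq)
      thus "of_int (c s) * s - of_int (e s) * s = of_nat p * (of_int (c s div int p) * s)"
        using \<open>s \<in> S\<close> by (simp add: e_def algebra_simps)
    qed simp
    hence "(y - (\<Sum>s\<in>S. of_int (e s) * s)) / of_nat p =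
        (y - (\<Sum>s\<in>S. of_int (c s) * s)) / of_nat p + (\<Sum>s\<in>S. of_int (c s div int p) * s)"
      using prime_gt_0_nat[OF p] by (simp add: field_simps)
    moreover have "algebraic_int (\<Sum>s\<in>S. of_int (c s div int p) * s)"
      using SO by (intro algebraic_int_sum algebraic_int_mult algebraic_int_of_int)
    ultimately have "algebraic_int ((y - (\<Sum>s\<in>S. of_int (e s) * s)) / of_nat p)"
      using algebraic_int_add[OF c] by simp
    moreover have "e \<in> S \<rightarrow>\<^sub>E {0..<int p}" using prime_gt_0_nat[OF p] by (auto simp: e_def)
    ultimately show ?thesis unfolding T_def by blast
  qed
  moreover have "finite T" unfolding T_def using fin by (intro finite_imageI finite_PiE) auto
  moreover have "algebraic_int t" if "t \<in> T" for t
    using that SO unfolding T_def by (auto intro!: algebraic_int_sum algebraic_int_mult)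
  ultimately have "finite T \<and> (\<forall>t\<in>T. algebraic_int t) \<and>
      (\<forall>y. algebraic_int y \<longrightarrow> (\<exists>t\<in>T. algebraic_int ((y - t) / of_nat p)))"
    by (intro conjI ballI allI impI)
  thus ?thesis by (rule exI[of _ T])
qed

text \<open>Infinitely many indices, finitely many classes modulo \<open>p\<close>. Applied to
  powers of a single element, it stands in for the structure of finite rings and for the determinant
  argument that a multiplier of an ideal is integral.\<close>

lemma residue_pigeonhole:
  fixes y :: "nat \<Rightarrow> 'k"
  assumes "Factorial_Ring.prime (p::nat)" "\<And>n. algebraic_int (y n)"
  obtains m n where "m < n" "algebraic_int ((y n - y m) / of_nat p)"
proof -
  obtain T :: "'k set" where T: "finite T" "\<And>t. t \<in> T \<Longrightarrow> algebraic_int t"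
    "\<And>y. algebraic_int y \<Longrightarrow> \<exists>t\<in>T. algebraic_int ((y - t) / of_nat p)"
    using finite_residues[OF assms(1)] by meson
  obtain t where t: "\<And>n. t n \<in> T" "\<And>n. algebraic_int ((y n - t n) / of_nat p)"
    using T(3)[OF assms(2)] by metis
  have "range t \<subseteq> T" using t by auto
  hence "\<not> inj t" using T(1) by (meson finite_subset infinite_UNIV_nat finite_imageD)
  then obtain m n where mn: "m < n" "t m = t n" by (metis injI linorder_neqE_nat)
  have "algebraic_int ((y n - t n) / of_nat p - (y m - t m) / of_nat p)"
    using t by (intro algebraic_int_diff)
  moreover have "(y n - t n) / of_nat p - (y m - t m) / of_nat p = (y n - y m) / of_nat p"
    using mn by (simp add: diff_divide_distrib)
  ultimately show ?thesis using that mn(1) by metis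
qed

text \<open>An ideal that contains \<open>p\<close> is a union of classes modulo \<open>p\<close>,
  hence determined by the representatives in \<open>T\<close> that it contains. This finiteness
  supplies maximal ideals of a given kind without chain conditions.\<close>

lemma finite_ideals_containing_prime:
  assumes p: "Factorial_Ring.prime (p::nat)"
  shows "finite {I :: 'k set. ideal I ring_of_integers \<and> of_nat p \<in> I}"
proof -
  obtain T :: "'k set" where T: "finite T" "\<And>t. t \<in> T \<Longrightarrow> algebraic_int t"
    "\<And>y. algebraic_int y \<Longrightarrow> \<exists>t\<in>T. algebraic_int ((y - t) / of_nat p)"
    using finite_residues[OF p] by meson
  have sub: "I \<subseteq> J" if I: "ideal I ring_of_integers" "of_nat p \<in> I"
    and J: "ideal J ring_of_integers" "of_nat p \<in> J" and eq: "I \<inter> T = J \<inter> T" for I J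
  proof
    fix y assume y: "y \<in> I"
    hence "algebraic_int y" using I unfolding ideal_ring_of_integers_iff by blast
    then obtain t where t: "t \<in> T" "algebraic_int ((y - t) / of_nat p)" using T(3) by blast
    define z where "z = (y - t) / of_nat p"
    have yt: "y = t + z * of_nat p" "t = y + (- z) * of_nat p"
      using prime_gt_0_nat[OF p] by (auto simp: z_def field_simps)
    have "algebraic_int z" "algebraic_int (- z)" using t(2) by (auto simp: z_def)
    hence "t \<in> I" unfolding yt(2) using I y unfolding ideal_ring_of_integers_iff by blast
    hence "t \<in> J" using eq t(1) by blast
    thus "y \<in> J" unfolding yt(1) using J \<open>algebraic_int z\<close> unfolding ideal_ring_of_integers_iff by blast
  qed
  have "inj_on (\<lambda>I. I \<inter> T) {I :: 'k set. ideal I ring_of_integers \<and> of_nat p \<in> I}"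
  proof (rule inj_onI)
    fix I J :: "'k set"
    assume "I \<in> {I. ideal I ring_of_integers \<and> of_nat p \<in> I}" "J \<in> {I. ideal I ring_of_integers \<and> of_nat p \<in> I}"
      "I \<inter> T = J \<inter> T"
    thus "I = J" using sub[of I J] sub[of J I] by auto
  qed
  moreover have "finite ((\<lambda>I. I \<inter> T) ` {I :: 'k set. ideal I ring_of_integers \<and> of_nat p \<in> I})"
    using T(1) by (auto intro: finite_subset[of _ "Pow T"])
  ultimately show ?thesis by (rule finite_imageD[rotated])
qed

end

section \<open>The valuation attached to a nonzero prime ideal\<close>

locale nf_prime = number_field d for d +
  fixes P :: "'k::field_char_0 set"
  assumes primeideal: "primeideal P ring_of_integers" and nonzero: "P \<noteq> {0}"

context nf_prime
begin

lemma ideal: "ideal P ring_of_integers"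
  using primeideal unfolding primeideal_ring_of_integers_iff by blast

lemma
  shows P_int: "a \<in> P \<Longrightarrow> algebraic_int a"
    and P_0: "0 \<in> P" and P_1: "1 \<notin> P"
    and P_add: "a \<in> P \<Longrightarrow> b \<in> P \<Longrightarrow> a + b \<in> P"
    and P_mult: "algebraic_int x \<Longrightarrow> a \<in> P \<Longrightarrow> x * a \<in> P"
    and P_prime: "algebraic_int a \<Longrightarrow> algebraic_int b \<Longrightarrow> a * b \<in> P \<Longrightarrow> a \<in> P \<or> b \<in> P"
  using primeideal unfolding primeideal_ring_of_integers_iff ideal_ring_of_integers_iff by blast+

lemma P_mult': "algebraic_int x \<Longrightarrow> a \<in> P \<Longrightarrow> a * x \<in> P"
  using P_mult[of x a] by (simp add: mult.commute)

text \<open>The denominators of the localization at \<open>P\<close>. Identities in the local ring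
  are stated in the ring of integers after multiplication by members of \<open>U\<close>.\<close>

definition U where "U = {x::'k. algebraic_int x \<and> x \<notin> P}"

lemma U_int: "x \<in> U \<Longrightarrow> algebraic_int x" and U_notin: "x \<in> U \<Longrightarrow> x \<notin> P"
  by (auto simp: U_def)

lemma U_mult: "x \<in> U \<Longrightarrow> y \<in> U \<Longrightarrow> x * y \<in> U"
  using P_prime by (auto simp: U_def intro: algebraic_int_mult)

lemma U_1: "1 \<in> U"
  using P_1 by (simp add: U_def)

lemma U_power: "x \<in> U \<Longrightarrow> x ^ n \<in> U"
  by (induction n) (auto simp: U_1 U_mult)

lemma U_nonzero: "x \<in> U \<Longrightarrow> x \<noteq> 0"
  using P_0 by (auto simp: U_def)

lemma of_nat_in_imp_prime_in:
  assumes "of_nat m \<in> P" "m > 0"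
  shows "\<exists>p. Factorial_Ring.prime p \<and> p dvd m \<and> of_nat p \<in> P"
  using assms
proof (induction m rule: less_induct)
  case (less m)
  have "m \<noteq> 1" using less.prems P_1 by auto
  then obtain p where p: "Factorial_Ring.prime p" "p dvd m" using prime_factor_nat by blast
  then obtain k where k: "m = p * k" by blast
  have "of_nat p \<in> P \<or> of_nat k \<in> P"
    using less.prems(1) k by (intro P_prime) auto
  thus ?case
  proof
    assume "of_nat k \<in> P"
    moreover have "k < m" "k > 0" using less.prems(2) k prime_gt_1_nat[OF p(1)] by auto
    ultimately obtain q where "Factorial_Ring.prime q" "q dvd k" "of_nat q \<in> P" using less.IH by blast
    thus ?thesis using k by auto
  qed (use p in blast)
qed

lemma ex_prime: "\<exists>p. Factorial_Ring.prime p \<and> of_nat p \<in> P"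
proof -
  obtain a where a: "a \<in> P" "a \<noteq> 0" using nonzero P_0 by blast
  obtain m b where m: "m > 0" "algebraic_int b" "a * b = of_int m"
    using algebraic_int_dvd_int[OF P_int[OF a(1)] a(2)] by blast
  have "of_int m \<in> P" using P_mult'[OF m(2) a(1)] m(3) by simp
  hence "of_nat (nat m) \<in> P" using m(1) by (simp add: of_nat_nat)
  thus ?thesis using of_nat_in_imp_prime_in[of "nat m"] m(1) by auto
qed

definition p where "p = (SOME p. Factorial_Ring.prime p \<and> of_nat p \<in> P)"

lemma prime_p: "Factorial_Ring.prime p" and p_in: "of_nat p \<in> P"
  using someI_ex[OF ex_prime] unfolding p_def by blast+

lemma p_nz [simp]: "of_nat p \<noteq> (0::'k)" "p \<noteq> 0"
  using prime_gt_0_nat[OF prime_p] by auto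

lemma not_dvd_in_U: "\<not> p dvd m \<Longrightarrow> of_nat m \<in> U"
proof -
  assume "\<not> p dvd m"
  hence "coprime (int p) (int m)" using prime_p by (simp add: prime_imp_coprime)
  then obtain u v where uv: "u * int p + v * int m = 1" using bezout_int[of "int p" "int m"] by auto
  have "of_nat m \<notin> P"
  proof
    assume "of_nat m \<in> P"
    hence "of_int u * of_nat p + of_int v * of_nat m \<in> P" using p_in by (intro P_add P_mult) auto
    moreover have "of_int u * of_nat p + of_int v * of_nat m = (1::'k)"
      using arg_cong[OF uv, of "of_int :: int \<Rightarrow> 'k"] by simp
    ultimately show False using P_1 by simp
  qed
  thus ?thesis by (simp add: U_def)
qed

text \<open>By pigeonhole \<open>a ^ n - a ^ m\<close> lies in \<open>P\<close> for some
  \<open>m < n\<close>; cancelling \<open>a ^ m\<close> by primality leaves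
  \<open>a ^ (n - m - 1)\<close> as an inverse of \<open>a\<close> modulo \<open>P\<close>. So
  nonzero primes are maximal.\<close>

lemma P_maximal:
  assumes "a \<in> U"
  obtains b where "algebraic_int b" "1 - a * b \<in> P"
proof -
  obtain m n where mn: "m < n" "algebraic_int ((a ^ n - a ^ m) / of_nat p)"
    using residue_pigeonhole[OF prime_p, of "\<lambda>n. a ^ n"] algebraic_int_power U_int[OF assms] by blast
  have "a ^ n - a ^ m \<in> P" using P_mult'[OF mn(2) p_in] by simp
  also have "a ^ n - a ^ m = a ^ m * (a ^ (n - m) - 1)"
    using mn(1) by (simp add: algebra_simps flip: power_add)
  finally have "a ^ (n - m) - 1 \<in> P"
    using P_prime[of "a ^ m"] U_power[OF assms, of m] U_int[OF U_power[OF assms]]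
    by (auto simp: U_def intro: algebraic_int_diff)
  hence "(- 1) * (a ^ (n - m) - 1) \<in> P" by (intro P_mult) auto
  moreover have "n - m = Suc (n - m - 1)" using mn(1) by simp
  hence "a ^ (n - m) = a * a ^ (n - m - 1)" by (metis power_Suc)
  ultimately have "1 - a * a ^ (n - m - 1) \<in> P" by simp
  thus ?thesis using that U_int[OF U_power[OF assms]] by blast
qed

end

context nf_prime
begin

text \<open>An element \<open>\<gamma>\<close> with \<open>\<gamma> P \<subseteq> O\<close> and \<open>\<gamma> \<notin> O\<close>: among the ideals \<open>(p : x)\<close> inside \<open>P\<close> a maximal one is
  prime, hence equal to \<open>P\<close>.\<close>

lemma ex_inverse_element:
  "\<exists>g. \<not> algebraic_int g \<and> (\<forall>y\<in>P. algebraic_int (g * y))"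
proof -
  define J where "J = (\<lambda>x. {y::'k. algebraic_int y \<and> algebraic_int (x * y / of_nat p)})"
  have ideal_J: "ideal (J x) ring_of_integers" if "algebraic_int x" for x
    unfolding ideal_ring_of_integers_iff
  proof (intro conjI ballI allI impI)
    fix a b assume ab: "a \<in> J x" "b \<in> J x"
    have "x * (a + b) / of_nat p = x * a / of_nat p + x * b / of_nat p"
      by (simp add: add_divide_distrib distrib_left)
    thus "a + b \<in> J x" using ab unfolding J_def by (simp add: algebraic_int_add)
  next
    fix a y :: 'k assume a: "a \<in> J x" and y: "algebraic_int y"
    have "x * (y * a) / of_nat p = y * (x * a / of_nat p)" by simp
    thus "y * a \<in> J x" using a y unfolding J_def by (simp only: mem_Collect_eq) (blast intro: algebraic_int_mult)
  qed (auto simp: J_def)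
  have p_J: "of_nat p \<in> J x" if "algebraic_int x" for x
    using that by (simp add: J_def)
  define S where "S = {J x | x. algebraic_int x \<and> J x \<subseteq> P}"
  have "finite S"
    using ideal_J p_J by (intro finite_subset[OF _ finite_ideals_containing_prime[OF prime_p]]) (auto simp: S_def)
  \<comment> \<open>\<open>J 1\<close> consists of the multiples of \<open>p\<close>, so the family
    \<open>S\<close> is not empty.\<close>
  moreover have "J 1 \<in> S"
  proof -
    have "J 1 \<subseteq> P"
    proof
      fix y assume "y \<in> J 1"
      hence "algebraic_int (y / of_nat p)" by (simp add: J_def)
      from P_mult[OF this p_in] show "y \<in> P" by simp
    qed
    thus ?thesis unfolding S_def using algebraic_int_1 by blast
  qed
  ultimately obtain I where I: "I \<in> S" "\<And>I'. I' \<in> S \<Longrightarrow> I \<subseteq> I' \<Longrightarrow> I = I'"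
    using finite_has_maximal[of S] by blast
  then obtain x where x: "algebraic_int x" "I = J x" "J x \<subseteq> P" unfolding S_def by blast
  \<comment> \<open>Replacing \<open>x\<close> by \<open>x * s\<close> with \<open>s\<close> outside
    \<open>P\<close> keeps \<open>J\<close> inside \<open>P\<close> by primality, so maximality
    forbids any growth.\<close>
  have step: "J (x * s) = J x" if s: "s \<in> U" for s
  proof -
    have sub: "J x \<subseteq> J (x * s)"
    proof
      fix y assume y: "y \<in> J x"
      have "x * s * y / of_nat p = s * (x * y / of_nat p)" by simp
      thus "y \<in> J (x * s)" using y U_int[OF s] unfolding J_def
        by (simp only: mem_Collect_eq) (blast intro: algebraic_int_mult)
    qed
    have "J (x * s) \<subseteq> P"
    proof
      fix t assume t: "t \<in> J (x * s)"
      have "x * s * t / of_nat p = x * (s * t) / of_nat p" by (simp add: mult.assoc)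
      hence "s * t \<in> J x" using t U_int[OF s] unfolding J_def
        by (simp only: mem_Collect_eq) (blast intro: algebraic_int_mult)
      hence "s * t \<in> P" using x by blast
      thus "t \<in> P" using P_prime[of s t] s t unfolding U_def J_def by blast
    qed
    hence "J (x * s) \<in> S" unfolding S_def using x U_int[OF s] algebraic_int_mult by blast
    thus ?thesis using I(2)[of "J (x * s)"] sub x(2) by blast
  qed
  \<comment> \<open>Either \<open>J (x * u)\<close> stays inside \<open>P\<close>, equals
    \<open>J x\<close> by maximality and contains \<open>v\<close>; or it has a member
    \<open>s\<close> outside \<open>P\<close>, and then \<open>u\<close> lies in
    \<open>J (x * s) = J x\<close>, which is excluded.\<close>
  have prime_J: "v \<in> J x" if uv: "algebraic_int u" "algebraic_int v" "u * v \<in> J x" "u \<notin> J x" for u v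
  proof -
    have "J (x * u) \<in> S \<or> \<not> J (x * u) \<subseteq> P" unfolding S_def using x uv algebraic_int_mult by blast
    thus ?thesis
    proof
      assume xu: "J (x * u) \<in> S"
      have "J x \<subseteq> J (x * u)"
      proof
        fix y assume y: "y \<in> J x"
        have "x * u * y / of_nat p = u * (x * y / of_nat p)" by simp
        thus "y \<in> J (x * u)" using y uv(1) unfolding J_def
          by (simp only: mem_Collect_eq) (blast intro: algebraic_int_mult)
      qed
      hence "J x = J (x * u)" using I(2)[OF xu] x(2) by blast
      moreover have "v \<in> J (x * u)" using uv unfolding J_def by (simp add: mult.assoc)
      ultimately show ?thesis by simp
    next
      assume "\<not> J (x * u) \<subseteq> P"
      then obtain s where s: "s \<in> J (x * u)" "s \<notin> P" by blast
      have "algebraic_int s" using s unfolding J_def by blast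
      hence sU: "s \<in> U" using s by (simp add: U_def)
      have "u \<in> J (x * s)" using s uv(1) unfolding J_def by (simp add: mult_ac)
      thus ?thesis using step[OF sU] uv(4) by simp
    qed
  qed
  \<comment> \<open>\<open>J x\<close> is a nonzero prime ideal, hence maximal by
    \<open>P_maximal\<close> applied to it, and cannot be properly contained in
    \<open>P\<close>.\<close>
  have "P \<subseteq> J x"
  proof
    fix y assume y: "y \<in> P"
    show "y \<in> J x"
    proof (rule ccontr)
      assume ny: "y \<notin> J x"
      have "1 \<notin> J x" using x P_1 by blast
      hence "primeideal (J x) ring_of_integers"
        unfolding primeideal_ring_of_integers_iff using ideal_J[OF x(1)] prime_J by blast
      moreover have "J x \<noteq> {0}" using p_J[OF x(1)] by auto
      ultimately have "nf_prime d (J x)"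
        by (intro nf_prime.intro number_field_axioms nf_prime_axioms.intro)
      then interpret Jx: nf_prime d "J x" .
      have "y \<in> Jx.U" unfolding Jx.U_def using ny P_int[OF y] by blast
      then obtain b where b: "algebraic_int b" "1 - y * b \<in> J x" by (rule Jx.P_maximal)
      hence "1 - y * b + y * b \<in> P" using x P_mult'[OF b(1) y] by (intro P_add) auto
      thus False using P_1 by simp
    qed
  qed
  \<comment> \<open>The element sought is x / p: if it were integral, 1 would lie in
    \<open>J x\<close> and hence in \<open>P\<close>.\<close>
  hence "algebraic_int (x / of_nat p * y)" if "y \<in> P" for y
    using that unfolding J_def by auto
  moreover have "\<not> algebraic_int (x / of_nat p)"
    using x P_1 unfolding J_def by auto
  ultimately show ?thesis by blast
qed

text \<open>If \<open>g * t\<close> were in \<open>P\<close> for all \<open>t\<close> in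
  \<open>P\<close>, every \<open>g ^ n * p\<close> would be; pigeonhole makes some
  \<open>g ^ n - g ^ m\<close> integral, and then \<open>g\<close> itself. So some
  \<open>u = g * t\<close> is outside \<open>P\<close>, and \<open>y * u = t * (g * y)\<close> shows
  that \<open>t\<close> generates \<open>P\<close> locally.\<close>

lemma ex_uniformizer:
  "\<exists>t\<in>P. \<exists>u\<in>U. \<forall>y\<in>P. \<exists>z. algebraic_int z \<and> y * u = t * z"
proof -
  obtain g where g: "\<not> algebraic_int g" "\<And>y. y \<in> P \<Longrightarrow> algebraic_int (g * y)"
    using ex_inverse_element by blast
  have "\<exists>t\<in>P. g * t \<notin> P"
  proof (rule ccontr)
    assume "\<not> (\<exists>t\<in>P. g * t \<notin> P)"
    hence "g ^ n * of_nat p \<in> P" for n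
      by (induction n) (auto simp: p_in mult.assoc)
    then obtain m n where mn: "m < n" "algebraic_int ((g ^ n * of_nat p - g ^ m * of_nat p) / of_nat p)"
      using residue_pigeonhole[OF prime_p, of "\<lambda>n. g ^ n * of_nat p"] P_int by blast
    have "(g ^ n * of_nat p - g ^ m * of_nat p) / of_nat p = g ^ n - g ^ m"
      by (simp flip: left_diff_distrib)
    thus False using mn algebraic_int_if_power_diff[of g n m] g(1) by simp
  qed
  then obtain t where t: "t \<in> P" "g * t \<notin> P" by blast
  have "g * t \<in> U" using t g(2) by (simp add: U_def)
  moreover have "\<exists>z. algebraic_int z \<and> y * (g * t) = t * z" if "y \<in> P" for y
    using g(2)[OF that] by (intro exI[of _ "g * y"]) simp
  ultimately show ?thesis using t(1) by blast
qed

definition t where "t = (SOME t. t \<in> P \<and> (\<exists>u\<in>U. \<forall>y\<in>P. \<exists>z. algebraic_int z \<and> y * u = t * z))"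

lemma t_in: "t \<in> P" and ex_t_mult: "\<exists>u\<in>U. \<forall>y\<in>P. \<exists>z. algebraic_int z \<and> y * u = t * z"
proof -
  have "\<exists>t. t \<in> P \<and> (\<exists>u\<in>U. \<forall>y\<in>P. \<exists>z. algebraic_int z \<and> y * u = t * z)"
    using ex_uniformizer by blast
  from someI_ex[OF this]
  show "t \<in> P" "\<exists>u\<in>U. \<forall>y\<in>P. \<exists>z. algebraic_int z \<and> y * u = t * z"
    unfolding t_def by blast+
qed

lemma t_int: "algebraic_int t"
  using t_in P_int by blast

lemma t_nz: "t \<noteq> 0"
proof
  assume "t = 0"
  moreover obtain u where "u \<in> U" "\<forall>y\<in>P. \<exists>z. algebraic_int z \<and> y * u = t * z" using ex_t_mult by blast
  ultimately show False using p_in U_nonzero by force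
qed

text \<open>Bounds how often \<open>t\<close> can be divided out of \<open>a\<close>. By pigeonhole
  \<open>t ^ m * (1 - t ^ (n - m))\<close> is a multiple of \<open>p\<close> with second factor
  outside \<open>P\<close>, so locally \<open>p\<close> divides a power of \<open>t\<close>. And
  \<open>a\<close> divides an integer \<open>p ^ e * l\<close> with \<open>l\<close> prime to
  \<open>p\<close>, hence in \<open>U\<close>.\<close>

lemma power_t_dvd:
  assumes "algebraic_int a" "a \<noteq> 0"
  shows "\<exists>m. \<exists>s\<in>U. \<exists>z. algebraic_int z \<and> t ^ m * s = a * z"
proof -
  obtain m n where mn: "m < n" "algebraic_int ((t ^ n - t ^ m) / of_nat p)"
    using residue_pigeonhole[OF prime_p, of "\<lambda>n. t ^ n"] algebraic_int_power t_int by blast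
  define s z where "s = 1 - t ^ (n - m)" and "z = - ((t ^ n - t ^ m) / of_nat p)"
  have "n - m = Suc (n - m - 1)" using mn(1) by simp
  hence "t ^ (n - m) = t ^ (n - m - 1) * t" by (metis power_Suc2)
  hence tP: "t ^ (n - m) \<in> P" using t_in t_int by (simp add: P_mult algebraic_int_power)
  have "s \<notin> P" using P_add[OF tP, of s] P_1 by (auto simp: s_def)
  hence s: "s \<in> U" using t_int by (auto simp: U_def s_def intro: algebraic_int_intros)
  have z: "algebraic_int z" using mn(2) unfolding z_def by (rule algebraic_int_minus)
  have "t ^ n = t ^ m * t ^ (n - m)" using mn(1) by (simp flip: power_add)
  moreover have "of_nat p * z = t ^ m - t ^ n" by (simp add: z_def)
  ultimately have eq: "t ^ m * s = of_nat p * z" by (simp add: s_def right_diff_distrib)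
  obtain k b where k: "k > 0" "algebraic_int b" "a * b = of_int k"
    using algebraic_int_dvd_int[OF assms] by blast
  define N where "N = nat k"
  have N: "N \<noteq> 0" "a * b = of_nat N" using k by (auto simp: N_def of_nat_nat)
  obtain l where l: "N = p ^ multiplicity p N * l" "\<not> p dvd l"
    using multiplicity_decompose'[of N p] N(1) prime_p by (metis not_prime_unit)
  define e where "e = multiplicity p N"
  have "t ^ (m * e) * (s ^ e * of_nat l) = (t ^ m * s) ^ e * of_nat l"
    by (simp add: power_mult_distrib power_mult)
  also have "\<dots> = of_nat (p ^ e * l) * z ^ e" by (simp add: eq power_mult_distrib)
  also have "p ^ e * l = N" using l(1) by (simp add: e_def)
  also have "of_nat N * z ^ e = a * (b * z ^ e)" by (simp add: N(2)[symmetric])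
  finally have "t ^ (m * e) * (s ^ e * of_nat l) = a * (b * z ^ e)" .
  moreover have "s ^ e * of_nat l \<in> U" using U_mult[OF U_power[OF s] not_dvd_in_U[OF l(2)]] .
  moreover have "algebraic_int (b * z ^ e)" using k(2) z by (intro algebraic_int_intros)
  ultimately show ?thesis by blast
qed

lemma U_not_dvd_t:
  assumes "x \<in> U" "x = t ^ n * z" "algebraic_int z"
  shows "n = 0"
proof (rule ccontr)
  assume "n \<noteq> 0"
  then obtain m where "n = Suc m" by (cases n) auto
  hence "x = (t ^ m * z) * t" using assms by simp
  moreover have "algebraic_int (t ^ m * z)" using t_int assms by (intro algebraic_int_intros)
  ultimately have "x \<in> P" using P_mult t_in by blast
  thus False using assms U_notin by blast
qed

text \<open>\<open>rep a k\<close> says that \<open>a\<close> is \<open>t\<close> to the power \<open>k\<close> times a unit of the localization at \<open>P\<close>.\<close>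

definition rep where "rep a k \<longleftrightarrow> (\<exists>s\<in>U. \<exists>z\<in>U. a * s = t ^ k * z)"

text \<open>\<open>k\<close> is the greatest number of factors \<open>t\<close> that can be
  extracted locally; it exists by \<open>power_t_dvd\<close>. The cofactor is then outside
  \<open>P\<close>, since an element of \<open>P\<close> would release one more
  \<open>t\<close>.\<close>

lemma ex_rep:
  assumes a: "algebraic_int a" "a \<noteq> 0"
  shows "\<exists>k. rep a k"
proof -
  define Q where "Q = (\<lambda>n. \<exists>s\<in>U. \<exists>z. algebraic_int z \<and> a * s = t ^ n * z)"
  obtain M s' z' where M: "s' \<in> U" "algebraic_int z'" "t ^ M * s' = a * z'"
    using power_t_dvd[OF a] by blast
  have bound: "n \<le> M" if Qn: "Q n" for n
  proof (rule ccontr)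
    assume "\<not> n \<le> M"
    hence n: "n > M" by simp
    obtain s z where s: "s \<in> U" "algebraic_int z" "a * s = t ^ n * z" using Qn unfolding Q_def by blast
    have "t ^ M * (s' * s) = a * s * z'" using M(3) by (simp add: mult.assoc[symmetric])
    also have "\<dots> = t ^ M * (t ^ (n - M) * (z * z'))"
      using n by (simp add: s(3) mult.assoc power_add[symmetric] flip: mult.assoc[of "t ^ M"])
    finally have "s' * s = t ^ (n - M) * (z * z')" using t_nz by simp
    hence "n - M = 0" using U_not_dvd_t[of "s' * s"] U_mult[OF M(1) s(1)] algebraic_int_mult[OF s(2) M(2)] by blast
    thus False using n by simp
  qed
  have Q0: "Q 0" unfolding Q_def using a(1) U_1 by (intro bexI[of _ 1] exI[of _ a]) auto
  define k where "k = (GREATEST n. Q n)"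
  have "Q k" unfolding k_def by (rule GreatestI_nat[of Q 0 M]) (use Q0 bound in auto)
  then obtain s z where s: "s \<in> U" "algebraic_int z" "a * s = t ^ k * z" unfolding Q_def by blast
  have "z \<notin> P"
  proof
    assume "z \<in> P"
    then obtain u y where u: "u \<in> U" "algebraic_int y" "z * u = t * y" using ex_t_mult by blast
    have "a * (s * u) = t ^ k * (z * u)" using s(3) by (simp add: mult.assoc[symmetric])
    also have "\<dots> = t ^ Suc k * y" by (simp add: u(3))
    finally have "Q (Suc k)" unfolding Q_def using U_mult[OF s(1) u(1)] u(2) by blast
    hence "Suc k \<le> k" unfolding k_def by (rule Greatest_le_nat) (use bound in auto)
    thus False by simp
  qed
  thus ?thesis using s unfolding rep_def U_def by blast
qed

definition Ppow where "Ppow n = P [^]\<^bsub>ideals_set ring_of_integers\<^esub> (n::nat)"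

lemma ideal_Ppow: "ideal (Ppow n) ring_of_integers"
proof -
  interpret cring "ring_of_integers :: 'k ring" by (rule cring_ring_of_integers)
  interpret I: comm_monoid "ideals_set (ring_of_integers :: 'k ring)" by (rule ideals_set_is_comm_monoid)
  have "P \<in> carrier (ideals_set ring_of_integers)" using ideal by (simp add: ideals_set_def)
  hence "Ppow n \<in> carrier (ideals_set ring_of_integers)" unfolding Ppow_def by (rule I.nat_pow_closed)
  thus ?thesis by (simp add: ideals_set_def)
qed

lemma Ppow_0: "Ppow 0 = {x. algebraic_int x}"
  by (simp add: Ppow_def ideals_set_def set_eq_iff)

lemma Ppow_Suc: "Ppow (Suc n) = ideal_prod ring_of_integers (Ppow n) P"
  by (simp add: Ppow_def ideals_set_def)

text \<open>Induction over the construction of an ideal product: a product of generators collects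
  one more \<open>t\<close>, a sum is brought to the common denominator
  \<open>s * u\<close>.\<close>

lemma Ppow_imp_dvd:
  "a \<in> Ppow n \<Longrightarrow> \<exists>s\<in>U. \<exists>z. algebraic_int z \<and> a * s = t ^ n * z"
proof (induction n arbitrary: a)
  case 0
  then show ?case using U_1 by (intro bexI[of _ 1] exI[of _ a]) (auto simp: Ppow_0)
next
  case (Suc n)
  from Suc.prems show ?case unfolding Ppow_Suc
  proof (induction rule: ideal_prod.induct)
    case (prod i j)
    obtain s z where s: "s \<in> U" "algebraic_int z" "i * s = t ^ n * z" using Suc.IH prod by blast
    obtain u y where u: "u \<in> U" "algebraic_int y" "j * u = t * y" using ex_t_mult prod by blast
    have "i * j * (s * u) = (i * s) * (j * u)" by (simp add: mult_ac)
    also have "\<dots> = t ^ Suc n * (z * y)" by (simp add: s u mult_ac)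
    finally show ?case using U_mult[OF s(1) u(1)] algebraic_int_mult[OF s(2) u(2)] by auto
  next
    case (sum a b)
    obtain s z where s: "s \<in> U" "algebraic_int z" "a * s = t ^ Suc n * z" using sum by blast
    obtain u y where u: "u \<in> U" "algebraic_int y" "b * u = t ^ Suc n * y" using sum by blast
    have "(a + b) * (s * u) = (a * s) * u + (b * u) * s" by (simp add: algebra_simps)
    also have "\<dots> = t ^ Suc n * (z * u + y * s)" unfolding s(3) u(3) by (simp add: algebra_simps)
    finally have "(a + b) * (s * u) = t ^ Suc n * (z * u + y * s)" .
    moreover have "algebraic_int (z * u + y * s)"
      using s u U_int by (intro algebraic_int_add algebraic_int_mult) auto
    ultimately show ?case using U_mult[OF s(1) u(1)] by auto
  qed
qed

lemma power_in_Ppow: "x \<in> P \<Longrightarrow> x ^ n \<in> Ppow n"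
proof (induction n)
  case (Suc n)
  then show ?case using ideal_prod.prod[of "x ^ n" "Ppow n" x P ring_of_integers]
    by (simp add: Ppow_Suc mult.commute)
qed (simp add: Ppow_0)

text \<open>Membership bounds \<open>n\<close> by comparing powers of \<open>t\<close> locally. The
  converse has to return from the local ring to the ring of integers: a denominator outside
  \<open>P\<close> is invertible not just modulo \<open>P\<close> but modulo every power of
  \<open>P\<close>.\<close>

lemma rep_imp_in_Ppow_iff:
  assumes a: "algebraic_int a" and r: "rep a k"
  shows "a \<in> Ppow n \<longleftrightarrow> n \<le> k"
proof
  assume "a \<in> Ppow n"
  then obtain s z where s: "s \<in> U" "algebraic_int z" "a * s = t ^ n * z" using Ppow_imp_dvd by blast
  obtain u y where u: "u \<in> U" "y \<in> U" "a * u = t ^ k * y" using r unfolding rep_def by blast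
  show "n \<le> k"
  proof (rule ccontr)
    assume n: "\<not> n \<le> k"
    have "t ^ k * (y * s) = (a * s) * u" using u(3) by (simp add: mult_ac)
    also have "\<dots> = t ^ k * (t ^ (n - k) * (z * u))"
      using n by (simp add: s(3) mult.assoc power_add[symmetric] flip: mult.assoc[of "t ^ k"])
    finally have "y * s = t ^ (n - k) * (z * u)" using t_nz by simp
    moreover have "algebraic_int (z * u)" using s(2) U_int[OF u(1)] by (rule algebraic_int_mult)
    ultimately have "n - k = 0" using U_not_dvd_t[OF U_mult[OF u(2) s(1)]] by blast
    thus False using n by simp
  qed
next
  assume n: "n \<le> k"
  obtain u y where u: "u \<in> U" "y \<in> U" "a * u = t ^ k * y" using r unfolding rep_def by blast
  have closed: "x * b \<in> Ppow n" if "algebraic_int x" "b \<in> Ppow n" for x b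
    using ideal_Ppow[of n] that unfolding ideal_ring_of_integers_iff by blast
  have add: "b + c \<in> Ppow n" if "b \<in> Ppow n" "c \<in> Ppow n" for b c
    using ideal_Ppow[of n] that unfolding ideal_ring_of_integers_iff by blast
  obtain b where b: "algebraic_int b" "1 - u * b \<in> P" using u(1) by (rule P_maximal)
  define q where "q = 1 - u * b"
  have q: "q \<in> P" using b(2) by (simp add: q_def)
  \<comment> \<open>Geometric series: \<open>1 - q ^ n = u * b * S\<close>, so \<open>b * S\<close>
    inverts \<open>u\<close> modulo the n-th power of \<open>P\<close>.\<close>
  define S where "S = (\<Sum>i<n. q ^ i)"
  have S: "algebraic_int S" unfolding S_def using P_int[OF q] by (intro algebraic_int_sum algebraic_int_power)
  have "1 - q ^ n = u * b * S" unfolding S_def one_diff_power_eq by (simp add: q_def)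
  hence "q ^ n + u * b * S = 1" by (metis add.commute diff_add_cancel)
  hence "a = a * q ^ n + a * (u * b * S)" by (metis distrib_left mult.right_neutral)
  also have "a * (u * b * S) = (t ^ (k - n) * y * b * S) * t ^ n"
    using u(3) n by (simp add: mult_ac) (simp add: power_add[symmetric] flip: mult.assoc)
  finally have "a = a * q ^ n + (t ^ (k - n) * y * b * S) * t ^ n" .
  moreover have "a * q ^ n \<in> Ppow n" using closed[OF a power_in_Ppow[OF q]] .
  moreover have "(t ^ (k - n) * y * b * S) * t ^ n \<in> Ppow n"
    using t_int U_int[OF u(2)] b(1) S by (intro closed power_in_Ppow t_in algebraic_int_mult algebraic_int_power)
  ultimately show "a \<in> Ppow n" using add by metis
qed

lemma integer_order_eq: 
  assumes "algebraic_int a" "rep a k"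
  shows "integer_order P a = k"
proof -
  have "(GREATEST n. n \<le> k) = k" by (rule Greatest_equality) auto
  thus ?thesis
    using rep_imp_in_Ppow_iff[OF assms] unfolding integer_order_def Ppow_def by simp
qed

lemma rep_integer_order:
  assumes "algebraic_int a" "a \<noteq> 0"
  shows "rep a (integer_order P a)"
  using ex_rep[OF assms] integer_order_eq[OF assms(1)] by auto

lemma in_Ppow_iff:
  assumes "algebraic_int a" "a \<noteq> 0"
  shows "a \<in> Ppow n \<longleftrightarrow> n \<le> integer_order P a"
  using rep_imp_in_Ppow_iff[OF assms(1) rep_integer_order[OF assms]] .

lemma integer_order_mult:
  assumes "algebraic_int a" "a \<noteq> 0" "algebraic_int b" "b \<noteq> 0"
  shows "integer_order P (a * b) = integer_order P a + integer_order P b"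
proof (rule integer_order_eq)
  obtain s z where s: "s \<in> U" "z \<in> U" "a * s = t ^ integer_order P a * z"
    using rep_integer_order[OF assms(1,2)] unfolding rep_def by blast
  obtain u y where u: "u \<in> U" "y \<in> U" "b * u = t ^ integer_order P b * y"
    using rep_integer_order[OF assms(3,4)] unfolding rep_def by blast
  have "a * b * (s * u) = (a * s) * (b * u)" by (simp add: mult_ac)
  also have "\<dots> = t ^ (integer_order P a + integer_order P b) * (z * y)"
    unfolding s(3) u(3) by (simp add: power_add mult_ac)
  finally show "rep (a * b) (integer_order P a + integer_order P b)"
    unfolding rep_def using U_mult s u by blast
qed (use assms in \<open>auto intro: algebraic_int_mult\<close>)

lemma integer_order_add:
  assumes "algebraic_int a" "a \<noteq> 0" "algebraic_int b" "b \<noteq> 0" "a + b \<noteq> 0"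
  shows "min (integer_order P a) (integer_order P b) \<le> integer_order P (a + b)"
proof -
  define n where "n = min (integer_order P a) (integer_order P b)"
  have "a \<in> Ppow n" "b \<in> Ppow n" using assms in_Ppow_iff by (auto simp: n_def)
  hence "a + b \<in> Ppow n" using ideal_Ppow[of n] unfolding ideal_ring_of_integers_iff by blast
  thus ?thesis using in_Ppow_iff[of "a + b" n] assms by (simp add: n_def algebraic_int_add)
qed

lemma integer_order_U: "a \<in> U \<Longrightarrow> integer_order P a = 0"
  using U_1 by (intro integer_order_eq U_int) (auto simp: rep_def intro: bexI[of _ 1])

lemma integer_order_P:
  assumes "a \<in> P" "a \<noteq> 0"
  shows "integer_order P a > 0"
proof (rule Nat.gr0I)
  assume 0: "integer_order P a = 0"
  obtain s z where s: "s \<in> U" "z \<in> U" "a * s = t ^ 0 * z"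
    using rep_integer_order[OF P_int[OF assms(1)] assms(2)] unfolding 0 rep_def by blast
  hence "z \<in> P" using P_mult'[OF U_int[OF s(1)] assms(1)] by simp
  thus False using s U_notin by blast
qed

text \<open>Cross-multiplying two fractions for the same element and using additivity of
  \<open>integer_order\<close> shows that the difference does not depend on the fraction, so the
  description is unique.\<close>

lemma prime_order_eq:
  assumes "algebraic_int a" "a \<noteq> 0" "algebraic_int b" "b \<noteq> 0"
  shows "prime_order P (a / b) = int (integer_order P a) - int (integer_order P b)"
  unfolding prime_order_def
proof (rule the_equality)
  show "\<exists>c d. algebraic_int c \<and> algebraic_int d \<and> c \<noteq> 0 \<and> d \<noteq> 0 \<and> a / b = c / d \<and>
      int (integer_order P a) - int (integer_order P b) = int (integer_order P c) - int (integer_order P d)"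
    using assms by blast
  fix k assume "\<exists>c d. algebraic_int c \<and> algebraic_int d \<and> c \<noteq> 0 \<and> d \<noteq> 0 \<and> a / b = c / d \<and>
      k = int (integer_order P c) - int (integer_order P d)"
  then obtain c d where cd: "algebraic_int c" "algebraic_int d" "c \<noteq> 0" "d \<noteq> 0" "a / b = c / d"
    "k = int (integer_order P c) - int (integer_order P d)" by blast
  have "a * d = c * b" using cd assms by (simp add: frac_eq_eq)
  hence "integer_order P a + integer_order P d = integer_order P c + integer_order P b"
    using integer_order_mult[OF assms(1,2) cd(2,4)] integer_order_mult[OF cd(1,3) assms(3,4)] by simp
  thus "k = int (integer_order P a) - int (integer_order P b)" using cd(6) by simp
qed

lemma ex_fraction:
  obtains a b :: 'k where "algebraic_int a" "algebraic_int b" "b \<noteq> 0" "x = a / b"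
proof -
  obtain m :: int where "m > 0" "algebraic_int (of_int m * x)"
    using all_algebraic[of x] by (rule algebraic_imp_int_mult)
  thus ?thesis using that[of "of_int m * x" "of_int m"] by simp
qed

lemma nonarch_prime_abs: "nonarch_abs (prime_abs P :: 'k \<Rightarrow> real)"
proof
  fix x y :: 'k
  show "0 \<le> prime_abs P x" by (simp add: prime_abs_def)
  show "prime_abs P x = 0 \<longleftrightarrow> x = 0" by (simp add: prime_abs_def)
  obtain a b where x: "algebraic_int a" "algebraic_int b" "b \<noteq> 0" "x = a / b" by (rule ex_fraction)
  obtain c d where y: "algebraic_int c" "algebraic_int d" "d \<noteq> 0" "y = c / d" by (rule ex_fraction)
  show "prime_abs P (x * y) = prime_abs P x * prime_abs P y"
  proof (cases "x = 0 \<or> y = 0")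
    case False
    hence nz: "a \<noteq> 0" "c \<noteq> 0" using x y by auto
    have "prime_order P ((a * c) / (b * d)) = prime_order P (a / b) + prime_order P (c / d)"
      using x y nz by (simp add: prime_order_eq integer_order_mult algebraic_int_mult)
    moreover have "x * y = (a * c) / (b * d)" using x y by simp
    ultimately show ?thesis using False x(4) y(4) by (simp add: prime_abs_def exp_add[symmetric])
  qed (auto simp: prime_abs_def)
  show "prime_abs P (x + y) \<le> max (prime_abs P x) (prime_abs P y)"
  proof (cases "x = 0 \<or> y = 0 \<or> x + y = 0")
    case False
    define A B D where "A = a * d" and "B = c * b" and "D = b * d"
    have D: "algebraic_int D" "D \<noteq> 0" using x y by (auto simp: D_def algebraic_int_mult)
    have xy: "x = A / D" "y = B / D" using x y by (auto simp: A_def B_def D_def)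
    hence "x + y = (A + B) / D" by (simp add: add_divide_distrib)
    have AB: "algebraic_int A" "algebraic_int B" "A \<noteq> 0" "B \<noteq> 0" "A + B \<noteq> 0"
      using x y False xy \<open>x + y = (A + B) / D\<close> by (auto simp: A_def B_def algebraic_int_mult)
    have "prime_order P (x + y) \<ge> min (prime_order P x) (prime_order P y)"
      unfolding xy(1) xy(2) \<open>x + y = (A + B) / D\<close>[unfolded xy]
      using integer_order_add[of A B] D AB by (simp add: prime_order_eq algebraic_int_add)
    thus ?thesis using False by (auto simp: prime_abs_def min_def split: if_splits)
  qed (auto simp: prime_abs_def le_max_iff_disj)
qed

sublocale w: nonarch_abs "prime_abs P :: 'k \<Rightarrow> real"
  by (rule nonarch_prime_abs)

lemma prime_abs_integer:
  assumes "algebraic_int a" "a \<noteq> 0"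
  shows "prime_abs P a = exp (- real (integer_order P a))"
  using prime_order_eq[OF assms algebraic_int_1] integer_order_U[OF U_1] assms(2)
  by (simp add: prime_abs_def)

lemma prime_abs_less_1: "a \<in> P \<Longrightarrow> prime_abs P a < 1"
  using prime_abs_integer[of a] P_int[of a] integer_order_P[of a]
  by (cases "a = 0") (auto simp: prime_abs_def)

text \<open>With numerator and denominator written through \<open>rep\<close>, the condition becomes
  \<open>j <= i\<close>, so \<open>t ^ j\<close> cancels and a denominator outside \<open>P\<close>
  remains. Thus the unit ball lies in the localization at \<open>P\<close>.\<close>

lemma prime_abs_le_1E:
  assumes "prime_abs P x \<le> 1"
  obtains a s where "algebraic_int a" "s \<in> U" "x = a / s"
proof (cases "x = 0")
  case True
  then show ?thesis using that[of 0 1] U_1 by simp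
next
  case False
  obtain a b where x: "algebraic_int a" "algebraic_int b" "b \<noteq> 0" "x = a / b" by (rule ex_fraction)
  have a: "a \<noteq> 0" using False x by auto
  define i j where "i = integer_order P a" and "j = integer_order P b"
  have "prime_order P x \<ge> 0" using assms False by (simp add: prime_abs_def)
  hence ij: "j \<le> i" using prime_order_eq[OF x(1) a x(2,3)] x(4) by (simp add: i_def j_def)
  obtain s z where s: "s \<in> U" "z \<in> U" "a * s = t ^ i * z"
    using rep_integer_order[OF x(1) a] unfolding rep_def i_def by blast
  obtain u y where u: "u \<in> U" "y \<in> U" "b * u = t ^ j * y"
    using rep_integer_order[OF x(2,3)] unfolding rep_def j_def by blast
  have "a * (s * y) * t ^ j = (a * s) * (b * u)" using u(3) by (simp add: mult_ac)
  also have "\<dots> = b * (t ^ (i - j) * z * u) * t ^ j"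
    using ij by (simp add: s(3) mult_ac) (simp add: power_add[symmetric] flip: mult.assoc)
  finally have "a * (s * y) = b * (t ^ (i - j) * z * u)" using t_nz by simp
  hence "x * (s * y) = t ^ (i - j) * z * u" using x(3) by (simp add: x(4))
  hence "x = (t ^ (i - j) * z * u) / (s * y)"
    using U_nonzero[OF s(1)] U_nonzero[OF u(2)] by (metis mult_eq_0_iff nonzero_mult_div_cancel_right)
  moreover have "algebraic_int (t ^ (i - j) * z * u)"
    using t_int U_int s u by (intro algebraic_int_mult algebraic_int_power)
  ultimately show ?thesis using that U_mult[OF s(1) u(2)] by blast
qed

lemma padic_prime_abs:
  assumes "Factorial_Ring.prime q" "of_nat q \<in> P"
  shows "padic_nonarch_abs (prime_abs P :: 'k \<Rightarrow> real) q"
  using assms prime_abs_less_1 by unfold_locales auto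

end


section \<open>Integrality from all prime ideals\<close>

context number_field
begin

text \<open>A maximal one among the finitely many proper ideals that contain \<open>I\<close> and
  \<open>p\<close> is prime: adjoining an element outside it reaches 1.\<close>

lemma ex_prime_containing_ideal:
  assumes I: "ideal I ring_of_integers" "(1::'k) \<notin> I" "of_nat p \<in> I" and p: "Factorial_Ring.prime (p::nat)"
  shows "\<exists>P. nf_prime d P \<and> I \<subseteq> P"
proof -
  define S where "S = {J :: 'k set. ideal J ring_of_integers \<and> of_nat p \<in> J \<and> 1 \<notin> J \<and> I \<subseteq> J}"
  have "finite S"
    by (rule finite_subset[OF _ finite_ideals_containing_prime[OF p]]) (auto simp: S_def)
  moreover have "I \<in> S" using I by (simp add: S_def)
  ultimately obtain M where M: "M \<in> S" "\<And>J. J \<in> S \<Longrightarrow> M \<subseteq> J \<Longrightarrow> M = J"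
    using finite_has_maximal[of S] by blast
  have Mid: "ideal M ring_of_integers" "of_nat p \<in> M" "1 \<notin> M" "I \<subseteq> M" using M(1) by (auto simp: S_def)
  have cl: "M \<subseteq> {x. algebraic_int x}" "0 \<in> M" "\<And>a b. a \<in> M \<Longrightarrow> b \<in> M \<Longrightarrow> a + b \<in> M"
    "\<And>a x. a \<in> M \<Longrightarrow> algebraic_int x \<Longrightarrow> x * a \<in> M"
    using Mid(1) unfolding ideal_ring_of_integers_iff by blast+
  have "b \<in> M" if ab: "algebraic_int a" "algebraic_int b" "a * b \<in> M" "a \<notin> M" for a b
  proof -
    define J where "J = {m + a * z | m z. m \<in> M \<and> algebraic_int z}"
    have J_mem: "m + a * z \<in> J" if "m \<in> M" "algebraic_int z" for m z
      using that unfolding J_def by blast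
    have "M \<subseteq> J" using J_mem[of _ 0] by auto
    have "a \<in> J" using J_mem[of 0 1] cl(2) by simp
    have "ideal J ring_of_integers"
      unfolding ideal_ring_of_integers_iff
    proof (intro conjI ballI allI impI)
      show "J \<subseteq> {x. algebraic_int x}"
        using cl(1) ab(1) unfolding J_def by (auto intro!: algebraic_int_add algebraic_int_mult)
      show "0 \<in> J" using \<open>M \<subseteq> J\<close> cl(2) by blast
    next
      fix u v assume "u \<in> J" "v \<in> J"
      then obtain m z m' z' where uv: "u = m + a * z" "m \<in> M" "algebraic_int z"
        "v = m' + a * z'" "m' \<in> M" "algebraic_int z'" unfolding J_def by blast
      have "u + v = (m + m') + a * (z + z')" by (simp add: uv algebra_simps)
      thus "u + v \<in> J" using J_mem[OF cl(3)[OF uv(2,5)] algebraic_int_add[OF uv(3,6)]] by simp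
    next
      fix u x :: 'k assume "u \<in> J" and x: "algebraic_int x"
      then obtain m z where u: "u = m + a * z" "m \<in> M" "algebraic_int z" unfolding J_def by blast
      have "x * u = x * m + a * (x * z)" by (simp add: u algebra_simps)
      thus "x * u \<in> J" using J_mem[OF cl(4)[OF u(2) x] algebraic_int_mult[OF x u(3)]] by simp
    qed
    hence "J \<in> S \<or> 1 \<in> J" using Mid \<open>M \<subseteq> J\<close> unfolding S_def by blast
    hence "1 \<in> J" using M(2)[of J] \<open>M \<subseteq> J\<close> \<open>a \<in> J\<close> ab(4) by blast
    then obtain m z where mz: "1 = m + a * z" "m \<in> M" "algebraic_int z" unfolding J_def by blast
    have "b = b * (m + a * z)" by (simp flip: mz(1))
    also have "\<dots> = b * m + z * (a * b)" by (simp add: algebra_simps)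
    also have "\<dots> \<in> M" using cl ab mz by blast
    finally show ?thesis .
  qed
  hence "primeideal M ring_of_integers"
    unfolding primeideal_ring_of_integers_iff using Mid by blast
  moreover have "M \<noteq> {0}" using Mid(2) prime_gt_0_nat[OF p] by auto
  ultimately have "nf_prime d M" by (intro nf_prime.intro number_field_axioms nf_prime_axioms.intro)
  thus ?thesis using Mid(4) by blast
qed

text \<open>Take the least positive \<open>m\<close> with \<open>m * x\<close> integral. If a prime
  \<open>p\<close> divided \<open>m\<close>, then y = (m / p) x would be nonintegral with p y
  integral, so the ideal of denominators of \<open>y\<close> would lie in some prime
  \<open>P\<close>; but integrality at \<open>P\<close> yields a denominator outside
  \<open>P\<close>.\<close>

theorem algebraic_int_if_prime_abs_le_1:
  assumes "\<And>P. nf_prime d P \<Longrightarrow> prime_abs P (x::'k) \<le> 1"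
  shows "algebraic_int x"
proof -
  define R where "R = (\<lambda>m::nat. m > 0 \<and> algebraic_int (of_nat m * x))"
  obtain m0 :: int where "m0 > 0" "algebraic_int (of_int m0 * x)"
    using all_algebraic[of x] by (rule algebraic_imp_int_mult)
  hence "R (nat m0)" by (simp add: R_def of_nat_nat)
  define m where "m = (LEAST m. R m)"
  have m: "R m" "\<And>k. R k \<Longrightarrow> m \<le> k"
    unfolding m_def using \<open>R (nat m0)\<close> by (auto intro: LeastI Least_le)
  have "m = 1"
  proof (rule ccontr)
    assume "m \<noteq> 1"
    then obtain p where p: "Factorial_Ring.prime p" "p dvd m" using prime_factor_nat by blast
    then obtain k where k: "m = p * k" by blast
    have "k > 0" "k < m" using m(1) k prime_gt_1_nat[OF p(1)] by (auto simp: R_def)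
    hence "\<not> R k" using m(2)[of k] by auto
    define y where "y = of_nat k * x"
    have y: "\<not> algebraic_int y" using \<open>\<not> R k\<close> \<open>k > 0\<close> by (simp add: R_def y_def)
    define I where "I = {z. algebraic_int z \<and> algebraic_int (z * y)}"
    have "ideal I ring_of_integers"
      unfolding ideal_ring_of_integers_iff I_def
      by (auto simp: distrib_right mult.assoc intro: algebraic_int_add algebraic_int_mult)
    moreover have "1 \<notin> I" using y by (simp add: I_def)
    moreover have "of_nat p \<in> I" using m(1) by (simp add: I_def R_def y_def k mult.assoc)
    ultimately obtain P where P: "nf_prime d P" "I \<subseteq> P" using ex_prime_containing_ideal p(1) by blast
    interpret nf_prime d P by fact
    have "prime_abs P y \<le> 1 * 1"
      unfolding y_def w.mult using w.of_nat_le_1 assms[OF P(1)] by (intro mult_mono) auto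
    then obtain a s where as: "algebraic_int a" "s \<in> U" "y = a / s" by (auto elim: prime_abs_le_1E)
    have "s * y = a" using as(3) U_nonzero[OF as(2)] by simp
    hence "s \<in> I" using as U_int by (simp add: I_def)
    thus False using P(2) U_notin[OF as(2)] by blast
  qed
  thus ?thesis using m(1) by (simp add: R_def)
qed

lemma finite_primes_containing:
  assumes "m > 0"
  shows "finite {P. nf_prime d P \<and> of_nat m \<in> (P :: 'k set)}"
proof -
  have "{P. nf_prime d P \<and> of_nat m \<in> (P :: 'k set)} \<subseteq>
      (\<Union>p\<in>{p. Factorial_Ring.prime p \<and> p dvd m}. {I. ideal I ring_of_integers \<and> of_nat p \<in> I})"
  proof
    fix P :: "'k set" assume "P \<in> {P. nf_prime d P \<and> of_nat m \<in> P}"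
    then interpret nf_prime d P by blast
    have "of_nat m \<in> P" using \<open>P \<in> _\<close> by blast
    from of_nat_in_imp_prime_in[OF this assms]
    show "P \<in> (\<Union>p\<in>{p. Factorial_Ring.prime p \<and> p dvd m}. {I. ideal I ring_of_integers \<and> of_nat p \<in> I})"
      using ideal by blast
  qed
  moreover have "finite {p. Factorial_Ring.prime p \<and> p dvd m}"
    using assms by (auto intro: finite_subset[OF _ finite_divisors_nat[of m]])
  ultimately show ?thesis using finite_ideals_containing_prime by (auto intro: finite_subset)
qed

end

section \<open>Completions of valued fields\<close>

lemma null_squeeze:
  fixes f g :: "nat \<Rightarrow> real"
  assumes "g \<longlonglongrightarrow> 0" "\<And>n. 0 \<le> f n" "\<And>n. f n \<le> g n"
  shows "f \<longlonglongrightarrow> 0"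
  using assms by - (rule tendsto_sandwich[OF always_eventually always_eventually tendsto_const assms(1)], auto)

locale valued_field = field R for R (structure) +
  fixes v :: "'a \<Rightarrow> real"
  assumes absolute_value: "absolute_value R v"
begin

lemma v_nonneg: "x \<in> carrier R \<Longrightarrow> 0 \<le> v x"
  and v_eq_0_iff: "x \<in> carrier R \<Longrightarrow> v x = 0 \<longleftrightarrow> x = \<zero>"
  and v_mult: "x \<in> carrier R \<Longrightarrow> y \<in> carrier R \<Longrightarrow> v (x \<otimes> y) = v x * v y"
  and v_add: "x \<in> carrier R \<Longrightarrow> y \<in> carrier R \<Longrightarrow> v (x \<oplus> y) \<le> v x + v y"
  using absolute_value by (auto simp: absolute_value_def)

lemma v_zero [simp]: "v \<zero> = 0"
  by (simp add: v_eq_0_iff)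

lemma v_one [simp]: "v \<one> = 1"
proof -
  have "v \<one> * v \<one> = v \<one>" using v_mult[of \<one> \<one>] by simp
  moreover have "v \<one> \<noteq> 0" by (simp add: v_eq_0_iff)
  ultimately show ?thesis by simp
qed

lemma v_minus [simp]:
  assumes "x \<in> carrier R"
  shows "v (\<ominus> x) = v x"
proof -
  have "v (\<ominus> \<one>) * v (\<ominus> \<one>) = 1" using v_mult[of "\<ominus> \<one>" "\<ominus> \<one>"] by (simp add: l_minus r_minus)
  moreover have "v (\<ominus> \<one>) \<ge> 0" by (simp add: v_nonneg)
  ultimately have "v (\<ominus> \<one>) = 1" by (metis abs_of_nonneg abs_mult_self_eq abs_1 power2_eq_square power2_eq_1_iff abs_minus)
  moreover have "\<ominus> x = \<ominus> \<one> \<otimes> x" using assms by (simp add: l_minus)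
  ultimately show ?thesis using assms by (simp add: v_mult)
qed

lemma v_diff_le: "x \<in> carrier R \<Longrightarrow> y \<in> carrier R \<Longrightarrow> v (x \<ominus> y) \<le> v x + v y"
  using v_add[of x "\<ominus> y"] by (simp add: minus_eq)

lemma v_diff_commute: "x \<in> carrier R \<Longrightarrow> y \<in> carrier R \<Longrightarrow> v (x \<ominus> y) = v (y \<ominus> x)"
proof -
  assume "x \<in> carrier R" "y \<in> carrier R"
  moreover from this have "\<ominus> (x \<ominus> y) = y \<ominus> x" by algebra
  ultimately show ?thesis by (metis v_minus minus_closed)
qed

lemma v_diff_abs:
  assumes "x \<in> carrier R" "y \<in> carrier R"
  shows "\<bar>v x - v y\<bar> \<le> v (x \<ominus> y)"
proof -
  have "(x \<ominus> y) \<oplus> y = x" "(y \<ominus> x) \<oplus> x = y" using assms by algebra+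
  hence "v x \<le> v (x \<ominus> y) + v y" "v y \<le> v (y \<ominus> x) + v x"
    using v_add[of "x \<ominus> y" y] v_add[of "y \<ominus> x" x] assms by auto
  thus ?thesis using v_diff_commute[OF assms] by simp
qed

abbreviation C where "C \<equiv> cauchy_seq_ring R v"
abbreviation N where "N \<equiv> null_seqs R v"

lemma C_simps [simp]:
  "s \<otimes>\<^bsub>C\<^esub> t = (\<lambda>n. s n \<otimes> t n)" "s \<oplus>\<^bsub>C\<^esub> t = (\<lambda>n. s n \<oplus> t n)"
  "\<one>\<^bsub>C\<^esub> = (\<lambda>n. \<one>)" "\<zero>\<^bsub>C\<^esub> = (\<lambda>n. \<zero>)"
  by (simp_all add: cauchy_seq_ring_def)

lemma C_carrier: "s \<in> carrier C \<longleftrightarrow> (\<forall>n. s n \<in> carrier R) \<and>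
    (\<forall>e>0. \<exists>M. \<forall>m\<ge>M. \<forall>n\<ge>M. v (s m \<ominus> s n) < e)"
  by (simp add: cauchy_seq_ring_def)

lemma C_closed [simp]: "s \<in> carrier C \<Longrightarrow> s n \<in> carrier R"
  by (simp add: C_carrier)

lemma C_convergent:
  assumes "s \<in> carrier C"
  obtains l where "(\<lambda>n. v (s n)) \<longlonglongrightarrow> l"
proof -
  have "Cauchy (\<lambda>n. v (s n))"
  proof (rule metric_CauchyI)
    fix e :: real assume "e > 0"
    then obtain M where M: "\<forall>m\<ge>M. \<forall>n\<ge>M. v (s m \<ominus> s n) < e" using assms unfolding C_carrier by blast
    show "\<exists>M. \<forall>m\<ge>M. \<forall>n\<ge>M. dist (v (s m)) (v (s n)) < e"
    proof (intro exI allI impI)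
      fix m n assume "M \<le> m" "M \<le> n"
      thus "dist (v (s m)) (v (s n)) < e"
        using v_diff_abs[of "s m" "s n"] assms M by (fastforce simp: dist_real_def)
    qed
  qed
  thus ?thesis using that by (auto simp: Cauchy_convergent_iff convergent_def)
qed

lemma C_bounded:
  assumes "s \<in> carrier C"
  obtains B where "B > 0" "\<And>n. v (s n) \<le> B"
proof -
  obtain l where "(\<lambda>n. v (s n)) \<longlonglongrightarrow> l" using assms by (rule C_convergent)
  hence "Bseq (\<lambda>n. v (s n))" by (rule convergent_imp_Bseq[OF convergentI])
  then obtain B where "B > 0" "\<And>n. norm (v (s n)) \<le> B" by (auto simp: Bseq_def)
  thus ?thesis using that[of B] by (metis abs_le_D1 real_norm_def)
qed

lemma const_in_C [simp]: "x \<in> carrier R \<Longrightarrow> (\<lambda>_. x) \<in> carrier C"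
  by (auto simp: C_carrier minus_eq r_neg)

lemma C_add_closed:
  assumes "s \<in> carrier C" "t \<in> carrier C"
  shows "(\<lambda>n. s n \<oplus> t n) \<in> carrier C"
  unfolding C_carrier
proof (intro conjI allI impI)
  fix e :: real assume "e > 0"
  hence "e / 2 > 0" by simp
  obtain M where M: "\<forall>m\<ge>M. \<forall>n\<ge>M. v (s m \<ominus> s n) < e / 2" using assms(1) \<open>e / 2 > 0\<close> unfolding C_carrier by blast
  obtain L where L: "\<forall>m\<ge>L. \<forall>n\<ge>L. v (t m \<ominus> t n) < e / 2" using assms(2) \<open>e / 2 > 0\<close> unfolding C_carrier by blast
  show "\<exists>M. \<forall>m\<ge>M. \<forall>n\<ge>M. v (s m \<oplus> t m \<ominus> (s n \<oplus> t n)) < e"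
  proof (intro exI[of _ "max M L"] allI impI)
    fix m n assume mn: "max M L \<le> m" "max M L \<le> n"
    have "s m \<oplus> t m \<ominus> (s n \<oplus> t n) = (s m \<ominus> s n) \<oplus> (t m \<ominus> t n)"
      using C_closed[OF assms(1), of m] C_closed[OF assms(1), of n] C_closed[OF assms(2), of m] C_closed[OF assms(2), of n]
      by algebra
    hence "v (s m \<oplus> t m \<ominus> (s n \<oplus> t n)) \<le> v (s m \<ominus> s n) + v (t m \<ominus> t n)"
      using assms by (simp add: v_add)
    also have "\<dots> < e" using M[rule_format, of m n] L[rule_format, of m n] mn by simp
    finally show "v (s m \<oplus> t m \<ominus> (s n \<oplus> t n)) < e" .
  qed
qed (use assms in auto)

lemma C_mult_closed:
  assumes "s \<in> carrier C" "t \<in> carrier C"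
  shows "(\<lambda>n. s n \<otimes> t n) \<in> carrier C"
  unfolding C_carrier
proof (intro conjI allI impI)
  fix e :: real assume "e > 0"
  obtain A where A: "A > 0" "\<And>n. v (s n) \<le> A" using C_bounded[OF assms(1)] by blast
  obtain B where B: "B > 0" "\<And>n. v (t n) \<le> B" using C_bounded[OF assms(2)] by blast
  have pos: "e / (2 * A) > 0" "e / (2 * B) > 0" using \<open>e > 0\<close> A B by auto
  obtain M where M: "\<forall>m\<ge>M. \<forall>n\<ge>M. v (s m \<ominus> s n) < e / (2 * B)" using assms(1) pos unfolding C_carrier by blast
  obtain L where L: "\<forall>m\<ge>L. \<forall>n\<ge>L. v (t m \<ominus> t n) < e / (2 * A)" using assms(2) pos unfolding C_carrier by blast
  show "\<exists>M. \<forall>m\<ge>M. \<forall>n\<ge>M. v (s m \<otimes> t m \<ominus> s n \<otimes> t n) < e"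
  proof (intro exI[of _ "max M L"] allI impI)
    fix m n assume mn: "max M L \<le> m" "max M L \<le> n"
    have "s m \<otimes> t m \<ominus> s n \<otimes> t n = s m \<otimes> (t m \<ominus> t n) \<oplus> (s m \<ominus> s n) \<otimes> t n"
      using C_closed[OF assms(1), of m] C_closed[OF assms(1), of n] C_closed[OF assms(2), of m] C_closed[OF assms(2), of n]
      by algebra
    hence "v (s m \<otimes> t m \<ominus> s n \<otimes> t n) \<le> v (s m \<otimes> (t m \<ominus> t n)) + v ((s m \<ominus> s n) \<otimes> t n)"
      using assms by (simp add: v_add)
    also have "\<dots> = v (s m) * v (t m \<ominus> t n) + v (s m \<ominus> s n) * v (t n)" using assms by (simp add: v_mult)
    also have "v (s m) * v (t m \<ominus> t n) \<le> A * v (t m \<ominus> t n)"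
      using A assms by (intro mult_right_mono) (auto simp: v_nonneg)
    also have "A * v (t m \<ominus> t n) < A * (e / (2 * A))"
      using L[rule_format, of m n] mn A by (intro mult_strict_left_mono) auto
    also have "v (s m \<ominus> s n) * v (t n) \<le> e / (2 * B) * B"
      using B M[rule_format, of m n] mn assms pos by (intro mult_mono) (auto simp: v_nonneg)
    also have "A * (e / (2 * A)) + e / (2 * B) * B = e" using A B by simp
    finally show "v (s m \<otimes> t m \<ominus> s n \<otimes> t n) < e" by simp
  qed
qed (use assms in auto)

lemma cring_C: "cring C"
proof (rule cringI)
  show "abelian_group C"
  proof (rule abelian_groupI)
    fix s assume s: "s \<in> carrier C"
    have "(\<lambda>n. \<ominus> \<one> \<otimes> s n) \<in> carrier C" using s by (intro C_mult_closed) auto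
    thus "\<exists>t\<in>carrier C. t \<oplus>\<^bsub>C\<^esub> s = \<zero>\<^bsub>C\<^esub>"
      using s by (intro bexI[of _ "\<lambda>n. \<ominus> \<one> \<otimes> s n"]) (auto simp: l_minus l_neg)
  qed (auto simp: C_add_closed a_ac)
  show "comm_monoid C"
    by (rule comm_monoidI) (auto simp: C_mult_closed m_ac)
qed (auto simp: l_distr)

lemma N_mem: "s \<in> N \<longleftrightarrow> (\<forall>n. s n \<in> carrier R) \<and> (\<lambda>n. v (s n)) \<longlonglongrightarrow> 0"
  by (simp add: null_seqs_def)

lemma N_sub_C: "N \<subseteq> carrier C"
proof
  fix s assume s: "s \<in> N"
  show "s \<in> carrier C"
    unfolding C_carrier
  proof (intro conjI allI impI)
    fix e :: real assume "e > 0"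
    hence "eventually (\<lambda>n. v (s n) < e / 2) sequentially"
      using s by (intro order_tendstoD(2)[of _ 0]) (auto simp: N_mem)
    then obtain M where M: "\<And>n. n \<ge> M \<Longrightarrow> v (s n) < e / 2" by (auto simp: eventually_sequentially)
    show "\<exists>M. \<forall>m\<ge>M. \<forall>n\<ge>M. v (s m \<ominus> s n) < e"
    proof (intro exI allI impI)
      fix m n assume "M \<le> m" "M \<le> n"
      thus "v (s m \<ominus> s n) < e"
        using v_diff_le[of "s m" "s n"] M[of m] M[of n] s by (auto simp: N_mem)
    qed
  qed (use s in \<open>auto simp: N_mem\<close>)
qed

lemma ideal_N: "ideal N C"
proof -
  interpret C: cring C by (rule cring_C)
  have mult: "(\<lambda>n. x n \<otimes> a n) \<in> N" if a: "a \<in> N" and x: "x \<in> carrier C" for a x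
  proof -
    obtain B where B: "B > 0" "\<And>n. v (x n) \<le> B" using C_bounded[OF x] by blast
    have "(\<lambda>n. B * v (a n)) \<longlonglongrightarrow> B * 0" using a by (intro tendsto_intros) (auto simp: N_mem)
    hence "(\<lambda>n. v (x n \<otimes> a n)) \<longlonglongrightarrow> 0"
      using a x B by - (rule null_squeeze[of "\<lambda>n. B * v (a n)"], auto simp: N_mem v_mult v_nonneg mult_right_mono)
    thus ?thesis using a x by (simp add: N_mem)
  qed
  show ?thesis
  proof (rule idealI)
    show "subgroup N (add_monoid C)"
    proof (rule C.add.subgroupI)
      show "N \<noteq> {}" using N_mem[of "\<lambda>_. \<zero>"] by auto
    next
      fix a assume a: "a \<in> N"
      have "\<ominus>\<^bsub>C\<^esub> a = (\<lambda>n. \<ominus> \<one> \<otimes> a n)"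
        using a mult[OF a, of "\<lambda>_. \<ominus> \<one>"] N_sub_C
        by (intro C.minus_equality) (auto simp: l_minus l_neg N_mem)
      thus "\<ominus>\<^bsub>C\<^esub> a \<in> N" using mult[OF a, of "\<lambda>_. \<ominus> \<one>"] by simp
    next
      fix a b assume ab: "a \<in> N" "b \<in> N"
      have "(\<lambda>n. v (a n) + v (b n)) \<longlonglongrightarrow> 0 + 0" using ab by (intro tendsto_add) (auto simp: N_mem)
      hence "(\<lambda>n. v (a n \<oplus> b n)) \<longlonglongrightarrow> 0"
        using ab by - (rule null_squeeze[of "\<lambda>n. v (a n) + v (b n)"], auto simp: N_mem v_add v_nonneg)
      thus "a \<oplus>\<^bsub>C\<^esub> b \<in> N" using ab by (simp add: N_mem)
    qed (use N_sub_C in auto)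
  qed (use mult N_sub_C in \<open>auto simp: C.ring_axioms m_comm N_mem\<close>)
qed

end

sublocale valued_field \<subseteq> C: cring "cauchy_seq_ring R v"
  by (rule cring_C)

sublocale valued_field \<subseteq> N: ideal "null_seqs R v" "cauchy_seq_ring R v"
  by (rule ideal_N)

context valued_field
begin

lemma C_minus: 
  assumes "s \<in> carrier C" "t \<in> carrier C"
  shows "s \<ominus>\<^bsub>C\<^esub> t = (\<lambda>n. s n \<ominus> t n)"
proof -
  have "(\<lambda>n. \<ominus> t n) = (\<lambda>n. \<ominus> \<one> \<otimes> t n)" using assms by (auto simp: l_minus)
  hence c: "(\<lambda>n. \<ominus> t n) \<in> carrier C" using C_mult_closed[of "\<lambda>_. \<ominus> \<one>" t] assms by simp
  have "\<ominus>\<^bsub>C\<^esub> t = (\<lambda>n. \<ominus> t n)"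
    using assms c by (intro C.minus_equality) (auto simp: l_neg)
  thus ?thesis by (simp add: C.minus_eq minus_eq)
qed

lemma not_null_bounded_below:
  assumes "s \<in> carrier C" "s \<notin> N"
  shows "\<exists>e>0. \<exists>M. \<forall>n\<ge>M. v (s n) > e"
proof -
  obtain l where l: "(\<lambda>n. v (s n)) \<longlonglongrightarrow> l" using assms(1) by (rule C_convergent)
  have "l \<ge> 0" using l assms(1) by (intro LIMSEQ_le_const) (auto simp: v_nonneg)
  moreover have "l \<noteq> 0" using l assms by (auto simp: N_mem)
  ultimately have "l > 0" by simp
  hence "eventually (\<lambda>n. v (s n) > l / 2) sequentially" by (intro order_tendstoD(1)[OF l]) simp
  thus ?thesis using \<open>l > 0\<close> by (intro exI[of _ "l / 2"]) (auto simp: eventually_sequentially)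
qed

text \<open>A Cauchy sequence outside \<open>N\<close> is eventually bounded away from 0, so its
  termwise inverse is again Cauchy and inverts it modulo null sequences.\<close>

lemma maximalideal_N: "maximalideal N C"
proof (rule maximalidealI[OF ideal_N])
  have "(\<lambda>_. \<one>) \<notin> N" by (simp add: N_mem LIMSEQ_const_iff)
  thus "carrier C \<noteq> N" using const_in_C[OF one_closed] by blast
next
  fix J assume J: "ideal J C" "N \<subseteq> J" "J \<subseteq> carrier C"
  interpret J: ideal J C by fact
  show "J = N \<or> J = carrier C"
  proof (rule disjCI)
    assume "J \<noteq> carrier C"
    show "J = N"
    proof (rule ccontr)
      assume "J \<noteq> N"
      then obtain s where s: "s \<in> J" "s \<notin> N" using J by blast
      have sC: "s \<in> carrier C" using s J by blast
      obtain e M where "e > 0" "\<forall>n\<ge>M. v (s n) > e"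
        using not_null_bounded_below[OF sC s(2)] by blast
      hence e: "e > 0" "\<And>n. n \<ge> M \<Longrightarrow> v (s n) > e" by auto
      \<comment> \<open>The finitely many terms before \<open>M\<close> may be zero; the filler 1
        there changes the product with \<open>s\<close> only by a null sequence.\<close>
      define t where "t = (\<lambda>n. if n \<ge> M then inv (s n) else \<one>)"
      have nz: "s n \<noteq> \<zero>" if "n \<ge> M" for n using e(2)[OF that] e(1) by auto
      have inv: "inv (s n) \<in> carrier R" "s n \<otimes> inv (s n) = \<one>" "inv (s n) \<otimes> s n = \<one>" if "n \<ge> M" for n
        using nz[OF that] sC by (auto simp: field_Units)
      have vinv: "v (inv (s n)) \<le> 1 / e" if "n \<ge> M" for n
      proof -
        have "v (inv (s n)) * v (s n) = 1" using inv[OF that] sC by (simp flip: v_mult)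
        hence "v (inv (s n)) = 1 / v (s n)" using e(1) e(2)[OF that] by (simp add: field_simps)
        thus ?thesis using e(1) e(2)[OF that] by (simp add: frac_le)
      qed
      have tR: "t n \<in> carrier R" for n using inv by (auto simp: t_def)
      have tC: "t \<in> carrier C"
        unfolding C_carrier
      proof (intro conjI allI impI)
        fix d :: real assume "d > 0"
        \<comment> \<open>The factor e^2 pays for the two inverses, each at most 1 / e, in inv a -
          inv b = inv a (b - a) inv b.\<close>
        hence "d * e\<^sup>2 > 0" using e by simp
        then obtain L where L: "\<forall>m\<ge>L. \<forall>n\<ge>L. v (s m \<ominus> s n) < d * e\<^sup>2"
          using sC unfolding C_carrier by blast
        show "\<exists>M. \<forall>m\<ge>M. \<forall>n\<ge>M. v (t m \<ominus> t n) < d"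
        proof (intro exI[of _ "max M L"] allI impI)
          fix m n assume mn: "max M L \<le> m" "max M L \<le> n"
          hence M: "m \<ge> M" "n \<ge> M" by auto
          have c: "s m \<in> carrier R" "s n \<in> carrier R" using sC by auto
          have "inv (s m) \<otimes> (s n \<ominus> s m) \<otimes> inv (s n) = inv (s m) \<otimes> (s n \<otimes> inv (s n)) \<ominus> (inv (s m) \<otimes> s m) \<otimes> inv (s n)"
            using inv(1)[OF M(1)] inv(1)[OF M(2)] c by algebra
          hence "t m \<ominus> t n = inv (s m) \<otimes> (s n \<ominus> s m) \<otimes> inv (s n)"
            using inv[OF M(1)] inv[OF M(2)] M by (simp add: t_def)
          hence "v (t m \<ominus> t n) = v (inv (s m)) * v (s n \<ominus> s m) * v (inv (s n))"
            using inv[OF M(1)] inv[OF M(2)] c by (simp add: v_mult)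
          also have "\<dots> \<le> (1 / e) * v (s n \<ominus> s m) * (1 / e)"
            using vinv[OF M(1)] vinv[OF M(2)] inv[OF M(1)] inv[OF M(2)] e(1) c
            by (intro mult_mono) (auto simp: v_nonneg)
          also have "\<dots> < (1 / e) * (d * e\<^sup>2) * (1 / e)"
            using L[rule_format, of n m] mn e(1) by (intro mult_strict_right_mono mult_strict_left_mono) auto
          also have "\<dots> = d" using e(1) by (simp add: power2_eq_square)
          finally show "v (t m \<ominus> t n) < d" .
        qed
      qed (use tR in auto)
      have "(\<lambda>n. v (\<one> \<ominus> s n \<otimes> t n)) \<longlonglongrightarrow> 0"
      proof (rule tendsto_eventually)
        show "eventually (\<lambda>n. v (\<one> \<ominus> s n \<otimes> t n) = 0) sequentially"
          unfolding eventually_sequentially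
          using inv by (intro exI[of _ M]) (auto simp: t_def minus_eq r_neg)
      qed
      hence "(\<lambda>n. \<one> \<ominus> s n \<otimes> t n) \<in> N" using sC tR by (simp add: N_mem)
      hence "(\<lambda>n. \<one> \<ominus> s n \<otimes> t n) \<in> J" using J by blast
      moreover have "(\<lambda>n. s n \<otimes> t n) \<in> J" using J.I_r_closed[OF s(1) tC] by simp
      ultimately have "(\<lambda>n. \<one> \<ominus> s n \<otimes> t n) \<oplus>\<^bsub>C\<^esub> (\<lambda>n. s n \<otimes> t n) \<in> J"
        by (rule J.a_closed)
      moreover have "(\<one> \<ominus> s n \<otimes> t n) \<oplus> s n \<otimes> t n = \<one>" for n
        using sC tR by (simp add: minus_eq a_assoc l_neg)
      ultimately have "\<one>\<^bsub>C\<^esub> \<in> J" by simp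
      thus False using J.one_imp_carrier \<open>J \<noteq> carrier C\<close> by blast
    qed
  qed
qed

lemma field_completion: "field (completion R v)"
  unfolding completion_def
  by (rule maximalideal.quotient_is_field[OF maximalideal_N C.is_cring])

lemma completion_carrierE:
  assumes "S \<in> carrier (completion R v)"
  obtains s where "s \<in> carrier C" "S = N +>\<^bsub>C\<^esub> s"
  using assms unfolding completion_def FactRing_def A_RCOSETS_def' by auto

lemma completion_carrierI: "s \<in> carrier C \<Longrightarrow> N +>\<^bsub>C\<^esub> s \<in> carrier (completion R v)"
  unfolding completion_def FactRing_def A_RCOSETS_def' by auto

lemma completion_hom: "(+>\<^bsub>C\<^esub>) N \<in> ring_hom C (completion R v)"
  unfolding completion_def by (rule N.rcos_ring_hom)

lemma completion_zero: "\<zero>\<^bsub>completion R v\<^esub> = N"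
  by (simp add: completion_def FactRing_def)

lemma coset_mem_iff:
  assumes "s \<in> carrier C"
  shows "t \<in> N +>\<^bsub>C\<^esub> s \<longleftrightarrow> t \<in> carrier C \<and> (\<lambda>n. t n \<ominus> s n) \<in> N"
proof
  assume t: "t \<in> N +>\<^bsub>C\<^esub> s"
  hence tC: "t \<in> carrier C"
    using C.a_r_coset_subset_G[OF N_sub_C assms] by blast
  thus "t \<in> carrier C \<and> (\<lambda>n. t n \<ominus> s n) \<in> N"
    using N.a_rcos_module_minus[OF C.ring_axioms assms tC] t C_minus[OF tC assms] by simp
next
  assume "t \<in> carrier C \<and> (\<lambda>n. t n \<ominus> s n) \<in> N"
  thus "t \<in> N +>\<^bsub>C\<^esub> s"
    using N.a_rcos_module_minus[OF C.ring_axioms assms, of t] C_minus[of t s] assms by simp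
qed

text \<open>All members of a coset differ from \<open>s\<close> by null sequences, so their absolute
  values share one limit and the description is unique.\<close>

lemma completion_abs_eq:
  assumes s: "s \<in> carrier C" and l: "(\<lambda>n. v (s n)) \<longlonglongrightarrow> l"
  shows "completion_abs R v (N +>\<^bsub>C\<^esub> s) = l"
  unfolding completion_abs_def
proof (rule the_equality)
  have "s \<in> N +>\<^bsub>C\<^esub> s" using N.a_rcos_self[OF s] .
  thus "\<exists>s\<in>N +>\<^bsub>C\<^esub> s. (\<lambda>n. v (s n)) \<longlonglongrightarrow> l" using l by blast
  fix k assume "\<exists>t\<in>N +>\<^bsub>C\<^esub> s. (\<lambda>n. v (t n)) \<longlonglongrightarrow> k"
  then obtain t where t: "t \<in> carrier C" "(\<lambda>n. t n \<ominus> s n) \<in> N" "(\<lambda>n. v (t n)) \<longlonglongrightarrow> k"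
    using coset_mem_iff[OF s] by blast
  have "(\<lambda>n. \<bar>v (t n) - v (s n)\<bar>) \<longlonglongrightarrow> 0"
    using t s by - (rule null_squeeze[of "\<lambda>n. v (t n \<ominus> s n)"], auto simp: N_mem v_diff_abs)
  hence "(\<lambda>n. v (t n) - v (s n)) \<longlonglongrightarrow> 0" by (rule tendsto_rabs_zero_cancel)
  moreover have "(\<lambda>n. v (t n) - v (s n)) \<longlonglongrightarrow> k - l" by (intro tendsto_diff t l)
  ultimately show "k = l" using LIMSEQ_unique by fastforce
qed

lemma completion_abs_coset:
  assumes s: "s \<in> carrier C"
  shows "(\<lambda>n. v (s n)) \<longlonglongrightarrow> completion_abs R v (N +>\<^bsub>C\<^esub> s)"
  using C_convergent[OF s] completion_abs_eq[OF s] by metis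

lemma absolute_value_completion: "absolute_value (completion R v) (completion_abs R v)"
  unfolding absolute_value_def
proof (intro conjI ballI)
  fix S assume "S \<in> carrier (completion R v)"
  then obtain s where s: "s \<in> carrier C" "S = N +>\<^bsub>C\<^esub> s" by (rule completion_carrierE)
  note lim = completion_abs_coset[OF s(1), folded s(2)]
  show "0 \<le> completion_abs R v S" using lim s(1) by (intro LIMSEQ_le_const) (auto simp: v_nonneg)
  show "completion_abs R v S = 0 \<longleftrightarrow> S = \<zero>\<^bsub>completion R v\<^esub>"
  proof
    assume "completion_abs R v S = 0"
    hence "s \<in> N" using lim s(1) by (simp add: N_mem)
    thus "S = \<zero>\<^bsub>completion R v\<^esub>"
      unfolding completion_zero s(2) by (rule N.a_rcos_const)
  next
    assume "S = \<zero>\<^bsub>completion R v\<^esub>"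
    hence "s \<in> N" using N.a_rcos_self[OF s(1)] s(2) by (simp add: completion_zero)
    hence "(\<lambda>n. v (s n)) \<longlonglongrightarrow> 0" by (simp add: N_mem)
    thus "completion_abs R v S = 0" using completion_abs_eq[OF s(1)] s(2) by simp
  qed
next
  fix S T assume "S \<in> carrier (completion R v)" "T \<in> carrier (completion R v)"
  note ST = this
  obtain s where s: "s \<in> carrier C" "S = N +>\<^bsub>C\<^esub> s" using ST(1) by (rule completion_carrierE)
  obtain t where t: "t \<in> carrier C" "T = N +>\<^bsub>C\<^esub> t" using ST(2) by (rule completion_carrierE)
  note lims = completion_abs_coset[OF s(1), folded s(2)] completion_abs_coset[OF t(1), folded t(2)]
  have "S \<otimes>\<^bsub>completion R v\<^esub> T = N +>\<^bsub>C\<^esub> (\<lambda>n. s n \<otimes> t n)"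
    using ring_hom_mult[OF completion_hom s(1) t(1)] s t by simp
  moreover have "(\<lambda>n. v (s n \<otimes> t n)) \<longlonglongrightarrow> completion_abs R v S * completion_abs R v T"
    using tendsto_mult[OF lims] s(1) t(1) by (simp add: v_mult)
  ultimately show "completion_abs R v (S \<otimes>\<^bsub>completion R v\<^esub> T) = completion_abs R v S * completion_abs R v T"
    using completion_abs_eq C_mult_closed[OF s(1) t(1)] by simp
  have "S \<oplus>\<^bsub>completion R v\<^esub> T = N +>\<^bsub>C\<^esub> (\<lambda>n. s n \<oplus> t n)"
    using ring_hom_add[OF completion_hom s(1) t(1)] s t by simp
  moreover have "(\<lambda>n. v (s n \<oplus> t n)) \<longlonglongrightarrow> completion_abs R v (N +>\<^bsub>C\<^esub> (\<lambda>n. s n \<oplus> t n))"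
    by (rule completion_abs_coset[OF C_add_closed[OF s(1) t(1)]])
  ultimately show "completion_abs R v (S \<oplus>\<^bsub>completion R v\<^esub> T) \<le> completion_abs R v S + completion_abs R v T"
    using s(1) t(1) by (intro LIMSEQ_le[OF _ tendsto_add[OF lims]]) (auto simp: v_add)
qed

text \<open>Limits preserve the ultrametric inequality. It is what makes the unit ball of Q_p closed
  under addition.\<close>

lemma completion_abs_ultra:
  assumes ultra: "\<And>x y. x \<in> carrier R \<Longrightarrow> y \<in> carrier R \<Longrightarrow> v (x \<oplus> y) \<le> max (v x) (v y)"
    and "S \<in> carrier (completion R v)" "T \<in> carrier (completion R v)"
  shows "completion_abs R v (S \<oplus>\<^bsub>completion R v\<^esub> T) \<le> max (completion_abs R v S) (completion_abs R v T)"
proof -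
  obtain s where s: "s \<in> carrier C" "S = N +>\<^bsub>C\<^esub> s" using assms(2) by (rule completion_carrierE)
  obtain t where t: "t \<in> carrier C" "T = N +>\<^bsub>C\<^esub> t" using assms(3) by (rule completion_carrierE)
  note lims = completion_abs_coset[OF s(1), folded s(2)] completion_abs_coset[OF t(1), folded t(2)]
  have "S \<oplus>\<^bsub>completion R v\<^esub> T = N +>\<^bsub>C\<^esub> (\<lambda>n. s n \<oplus> t n)"
    using ring_hom_add[OF completion_hom s(1) t(1)] s t by simp
  moreover have "(\<lambda>n. v (s n \<oplus> t n)) \<longlonglongrightarrow> completion_abs R v (N +>\<^bsub>C\<^esub> (\<lambda>n. s n \<oplus> t n))"
    by (rule completion_abs_coset[OF C_add_closed[OF s(1) t(1)]])
  ultimately show ?thesis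
    using s(1) t(1) by (intro LIMSEQ_le[OF _ tendsto_max[OF lims]]) (auto simp: ultra)
qed

lemma completion_embed_hom: "completion_embed R v \<in> ring_hom R (completion R v)"
proof (rule ring_hom_memI)
  fix x y assume xy: "x \<in> carrier R" "y \<in> carrier R"
  show "completion_embed R v x \<in> carrier (completion R v)"
    using xy by (simp add: completion_embed_def completion_carrierI)
  show "completion_embed R v (x \<otimes> y) = completion_embed R v x \<otimes>\<^bsub>completion R v\<^esub> completion_embed R v y"
    using ring_hom_mult[OF completion_hom const_in_C[OF xy(1)] const_in_C[OF xy(2)]]
    by (simp add: completion_embed_def)
  show "completion_embed R v (x \<oplus> y) = completion_embed R v x \<oplus>\<^bsub>completion R v\<^esub> completion_embed R v y"
    using ring_hom_add[OF completion_hom const_in_C[OF xy(1)] const_in_C[OF xy(2)]]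
    by (simp add: completion_embed_def)
next
  show "completion_embed R v \<one> = \<one>\<^bsub>completion R v\<^esub>"
    using ring_hom_one[OF completion_hom] by (simp add: completion_embed_def)
qed

lemma completion_abs_embed: "x \<in> carrier R \<Longrightarrow> completion_abs R v (completion_embed R v x) = v x"
  unfolding completion_embed_def by (intro completion_abs_eq) auto

lemma embed_in_valuation_ring_iff:
  "x \<in> carrier R \<Longrightarrow> completion_embed R v x \<in> completion_valuation_ring R v \<longleftrightarrow> v x \<le> 1"
  using completion_abs_embed ring_hom_closed[OF completion_embed_hom]
  by (simp add: completion_valuation_ring_def)

lemma valued_field_completion: "valued_field (completion R v) (completion_abs R v)"
  by (intro valued_field.intro field_completion valued_field_axioms.intro absolute_value_completion)

end

section \<open>Extension of absolute values to algebraic extensions\<close>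

text \<open>\<open>rank_1\<close> and \<open>archimedean\<close> together express that the value
  group is archimedean, so that every value can be measured by rational multiples of the value of
  \<open>p\<close>.\<close>

locale valuation_ring = field R for R (structure) +
  fixes A :: "'a set" and p :: 'a
  assumes subring: "subring A R"
    and p_in: "p \<in> A" and p_nz: "p \<noteq> \<zero>" and inv_p: "inv p \<notin> A"
    and total: "x \<in> carrier R \<Longrightarrow> x \<noteq> \<zero> \<Longrightarrow> x \<in> A \<or> inv x \<in> A"
    and rank_1: "y \<in> A \<Longrightarrow> y \<noteq> \<zero> \<Longrightarrow> inv y \<notin> A \<Longrightarrow> \<exists>k::nat. \<exists>a\<in>A. y [^] k = p \<otimes> a"
    and archimedean: "z \<in> carrier R \<Longrightarrow> \<exists>k::nat. p [^] k \<otimes> z \<in> A"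

context field
begin

lemma nonzero_inv:
  assumes "x \<in> carrier R" "x \<noteq> \<zero>"
  shows "inv x \<in> carrier R" "x \<otimes> inv x = \<one>" "inv x \<otimes> x = \<one>" "inv x \<noteq> \<zero>" "inv (inv x) = x"
proof -
  have x: "x \<in> Units R" using assms field_Units by blast
  show c: "inv x \<in> carrier R" and r: "x \<otimes> inv x = \<one>" and "inv x \<otimes> x = \<one>" and "inv (inv x) = x"
    using x by auto
  show "inv x \<noteq> \<zero>"
    using r assms by auto
qed

lemma inv_eqI:
  assumes "x \<in> carrier R" "y \<in> carrier R" "x \<otimes> y = \<one>"
  shows "inv x = y"
  using assms by (metis comm_inv_char)

lemma nat_pow_nonzero:
  assumes "x \<in> carrier R" "x \<noteq> \<zero>"
  shows "x [^] (n::nat) \<noteq> \<zero>"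
  using assms by (induction n) (auto simp: integral_iff)

lemma inv_nat_pow:
  assumes "x \<in> carrier R" "x \<noteq> \<zero>"
  shows "x [^] (n::nat) \<otimes> inv x [^] n = \<one>"
  using nonzero_inv[OF assms] assms by (simp flip: nat_pow_distrib)

end

section \<open>The real valuation of a valuation ring of rank one\<close>

context valuation_ring
begin

lemma
  shows A_carr: "a \<in> A \<Longrightarrow> a \<in> carrier R"
    and A_one: "\<one> \<in> A" and A_zero: "\<zero> \<in> A"
    and A_add: "a \<in> A \<Longrightarrow> b \<in> A \<Longrightarrow> a \<oplus> b \<in> A"
    and A_mult: "a \<in> A \<Longrightarrow> b \<in> A \<Longrightarrow> a \<otimes> b \<in> A"
  using subringE[OF subring] by blast+

lemma p_carr [simp]: "p \<in> carrier R"
  using p_in A_carr by blast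

lemma A_pow: "a \<in> A \<Longrightarrow> a [^] (n::nat) \<in> A"
  by (induction n) (auto simp: A_one A_mult)

lemma p_mult_neq_one: "a \<in> A \<Longrightarrow> p \<otimes> a \<noteq> \<one>"
  using inv_eqI[OF p_carr A_carr] inv_p by metis

text \<open>\<open>Q x n a b\<close> says that \<open>n v(x) \<ge> (b - a) v(p)\<close> for the valuation \<open>v\<close> with ring \<open>A\<close>.\<close>

definition Q where "Q x n a b \<longleftrightarrow> (\<exists>y\<in>A. p [^] (a::nat) \<otimes> x [^] (n::nat) = p [^] (b::nat) \<otimes> y)"

text \<open>Adds the lower bounds (b - a) / n and (d - c) / m over the common denominator
  \<open>n * m\<close>.\<close>

lemma Q_mult:
  assumes "Q x n a b" "Q y m c d" "x \<in> carrier R" "y \<in> carrier R"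
  shows "Q (x \<otimes> y) (n * m) (a * m + c * n) (b * m + d * n)"
proof -
  obtain u where u: "u \<in> A" "p [^] a \<otimes> x [^] n = p [^] b \<otimes> u" using assms unfolding Q_def by blast
  obtain w where w: "w \<in> A" "p [^] c \<otimes> y [^] m = p [^] d \<otimes> w" using assms unfolding Q_def by blast
  have "p [^] (a * m + c * n) \<otimes> (x \<otimes> y) [^] (n * m) = (p [^] a) [^] m \<otimes> (p [^] c) [^] n \<otimes> ((x [^] n) [^] m \<otimes> (y [^] m) [^] n)"
    using assms by (simp add: nat_pow_pow nat_pow_mult nat_pow_distrib mult.commute)
  also have "\<dots> = (p [^] a \<otimes> x [^] n) [^] m \<otimes> (p [^] c \<otimes> y [^] m) [^] n"
    using assms by (simp add: nat_pow_distrib m_ac)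
  also have "\<dots> = (p [^] b \<otimes> u) [^] m \<otimes> (p [^] d \<otimes> w) [^] n" by (simp only: u w)
  also have "\<dots> = ((p [^] b) [^] m \<otimes> (p [^] d) [^] n) \<otimes> (u [^] m \<otimes> w [^] n)"
    using u w A_carr by (simp add: nat_pow_distrib m_ac)
  also have "(p [^] b) [^] m \<otimes> (p [^] d) [^] n = p [^] (b * m + d * n)"
    by (simp add: nat_pow_pow nat_pow_mult)
  finally show ?thesis unfolding Q_def using A_mult[OF A_pow[OF u(1)] A_pow[OF w(1)]] by blast
qed

text \<open>Totality of \<open>A\<close> applied to the quotient \<open>q\<close> of p^a x^n by
  p^b.\<close>

lemma Q_total:
  assumes x: "x \<in> carrier R" "x \<noteq> \<zero>" and "\<not> Q x n a b"
  shows "Q (inv x) n b a"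
proof -
  define J where "J = inv p [^] b"
  have J: "J \<in> carrier R" "p [^] b \<otimes> J = \<one>"
    using nonzero_inv[OF p_carr p_nz] inv_nat_pow[OF p_carr p_nz] by (auto simp: J_def)
  define I where "I = inv x [^] n"
  have I: "I \<in> carrier R" "x [^] n \<otimes> I = \<one>"
    using nonzero_inv[OF x] inv_nat_pow[OF x] by (auto simp: I_def)
  define q where "q = p [^] a \<otimes> x [^] n \<otimes> J"
  have J0: "J \<noteq> \<zero>" using J by (metis r_null nat_pow_closed p_carr zero_not_one)
  have q: "q \<in> carrier R" "q \<noteq> \<zero>"
    using x J J0 nat_pow_nonzero[OF p_carr p_nz] nat_pow_nonzero[OF x] by (auto simp: q_def integral_iff)
  have "p [^] b \<otimes> q = (p [^] a \<otimes> x [^] n) \<otimes> (p [^] b \<otimes> J)" using x J(1) by (simp add: q_def m_lcomm)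
  hence "p [^] a \<otimes> x [^] n = p [^] b \<otimes> q" using J x by simp
  hence "q \<notin> A" using assms(3) unfolding Q_def by blast
  hence iq: "inv q \<in> A" using total[OF q] by blast
  note iqc = nonzero_inv[OF q]
  have "p [^] b \<otimes> I = (p [^] b \<otimes> I) \<otimes> (q \<otimes> inv q)" using iqc I by simp
  also have "\<dots> = (p [^] b \<otimes> J) \<otimes> (x [^] n \<otimes> I) \<otimes> (p [^] a \<otimes> inv q)"
    using iqc(1) I(1) J(1) x by (simp add: q_def m_ac)
  also have "\<dots> = p [^] a \<otimes> inv q" using iqc(1) I J by simp
  finally show ?thesis unfolding Q_def I_def using iq by blast
qed

lemma Q_one:
  assumes "Q \<one> n a b"
  shows "b \<le> a"
proof (rule ccontr)
  assume "\<not> b \<le> a"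
  hence b: "b = a + Suc (b - a - 1)" by simp
  obtain y where y: "y \<in> A" "p [^] a \<otimes> \<one> [^] n = p [^] b \<otimes> y" using assms unfolding Q_def by blast
  define k where "k = b - a - 1"
  have bk: "b = a + Suc k" using b by (simp add: k_def)
  have "p [^] a \<otimes> \<one> = p [^] a \<otimes> (p \<otimes> (p [^] k \<otimes> y))"
    using y A_carr[OF y(1)] unfolding bk by (simp add: nat_pow_mult[symmetric] m_ac)
  hence "\<one> = p \<otimes> (p [^] k \<otimes> y)"
    using m_lcancel[OF nat_pow_nonzero[OF p_carr p_nz, of a] nat_pow_closed[OF p_carr] one_closed, of "p \<otimes> (p [^] k \<otimes> y)"]
      m_closed[OF p_carr m_closed[OF nat_pow_closed[OF p_carr] A_carr[OF y(1)]]] by blast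
  thus False using p_mult_neq_one[OF A_mult[OF A_pow[OF p_in] y(1)]] by metis
qed

lemma Q_exp_1:
  assumes "x \<in> carrier R" "p [^] k \<otimes> x \<in> A"
  shows "Q x 1 k 0"
proof -
  have "p [^] k \<otimes> x [^] (1::nat) = p [^] (0::nat) \<otimes> (p [^] k \<otimes> x)"
    using assms(1) by (simp only: nat_pow_eone nat_pow_0 l_one m_closed nat_pow_closed p_carr)
  thus ?thesis unfolding Q_def using assms(2) by (rule bexI)
qed

text \<open>Rational lower bounds for v(x) / v(p). Their supremum is the valuation normalized to 1
  at \<open>p\<close>.\<close>

definition S where "S x = {(real b - real a) / real n | n a b. n > 0 \<and> Q x n a b}"

definition val where "val x = Sup (S x)"

text \<open>\<open>archimedean\<close> bounds the value of \<open>inv x\<close> from below, hence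
  that of \<open>x\<close> from above.\<close>

lemma S_bdd: 
  assumes x: "x \<in> carrier R" "x \<noteq> \<zero>"
  shows "bdd_above (S x)"
proof -
  obtain k :: nat where k: "p [^] k \<otimes> inv x \<in> A" using archimedean nonzero_inv(1)[OF x] by blast
  hence Qk: "Q (inv x) 1 k 0" by (rule Q_exp_1[OF nonzero_inv(1)[OF x]])
  have "s \<le> real k" if sx: "s \<in> S x" for s
  proof -
    obtain n a b where s: "n > 0" "Q x n a b" "s = (real b - real a) / real n" using sx unfolding S_def by blast
    have "Q (x \<otimes> inv x) (n * 1) (a * 1 + k * n) (b * 1 + 0 * n)"
      using Q_mult[OF s(2) Qk x(1) nonzero_inv(1)[OF x]] .
    hence "Q \<one> n (a + k * n) b" using nonzero_inv[OF x] by simp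
    hence "b \<le> a + k * n" by (rule Q_one)
    hence "real b \<le> real a + real k * real n" by (metis of_nat_add of_nat_le_iff of_nat_mult)
    thus ?thesis using s by (simp add: divide_le_eq)
  qed
  thus ?thesis by (intro bdd_aboveI)
qed

lemma S_I: "Q x n a b \<Longrightarrow> n > 0 \<Longrightarrow> (real b - real a) / real n \<in> S x"
  unfolding S_def by blast

lemma S_nonempty:
  assumes x: "x \<in> carrier R" "x \<noteq> \<zero>"
  shows "S x \<noteq> {}"
proof -
  obtain k :: nat where k: "p [^] k \<otimes> x \<in> A" using archimedean x by blast
  hence "Q x 1 k 0" by (rule Q_exp_1[OF x(1)])
  thus ?thesis using S_I by fastforce
qed

lemma val_ge: "x \<in> carrier R \<Longrightarrow> x \<noteq> \<zero> \<Longrightarrow> Q x n a b \<Longrightarrow> n > 0 \<Longrightarrow> (real b - real a) / real n \<le> val x"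
  unfolding val_def by (intro cSup_upper S_I S_bdd)

lemma val_mult_ge:
  assumes x: "x \<in> carrier R" "x \<noteq> \<zero>" and y: "y \<in> carrier R" "y \<noteq> \<zero>"
  shows "val x + val y \<le> val (x \<otimes> y)"
proof -
  have xy: "x \<otimes> y \<in> carrier R" "x \<otimes> y \<noteq> \<zero>" using x y by (auto simp: integral_iff)
  have add: "s + t \<le> val (x \<otimes> y)" if sx: "s \<in> S x" and ty: "t \<in> S y" for s t
  proof -
    obtain n a b where s: "n > 0" "Q x n a b" "s = (real b - real a) / real n" using sx unfolding S_def by blast
    obtain m c d where t: "m > 0" "Q y m c d" "t = (real d - real c) / real m" using ty unfolding S_def by blast
    have "s + t = (real (b * m + d * n) - real (a * m + c * n)) / real (n * m)"
      using s(1) t(1) unfolding s(3) t(3) by (simp add: field_simps)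
    also have "\<dots> \<le> val (x \<otimes> y)" using Q_mult[OF s(2) t(2) x(1) y(1)] s t xy by (intro val_ge) auto
    finally show ?thesis .
  qed
  have "val x \<le> val (x \<otimes> y) - t" if "t \<in> S y" for t
    unfolding val_def[of x] using add[OF _ that] by (intro cSup_least S_nonempty[OF x]) (simp add: le_diff_eq)
  hence "val y \<le> val (x \<otimes> y) - val x"
    unfolding val_def[of y] by (intro cSup_least S_nonempty[OF y]) (simp add: le_diff_eq add.commute)
  thus ?thesis by simp
qed

lemma val_one: "val \<one> = 0"
proof (rule antisym)
  show "val \<one> \<le> 0"
    unfolding val_def
  proof (intro cSup_least S_nonempty)
    fix s assume "s \<in> S \<one>"
    then obtain n a b where s: "n > 0" "Q \<one> n a b" "s = (real b - real a) / real n" unfolding S_def by blast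
    thus "s \<le> 0" using Q_one[OF s(2)] by (simp add: divide_le_0_iff)
  qed auto
  have "Q \<one> 1 0 0" unfolding Q_def using A_one by (intro bexI[of _ \<one>]) auto
  from val_ge[OF _ _ this] show "0 \<le> val \<one>" by simp
qed

text \<open>A rational strictly between \<open>val x\<close> and \<open>- val (inv x)\<close> is no
  lower bound for \<open>x\<close>, so by \<open>Q_total\<close> its negative is one for
  \<open>inv x\<close>, a contradiction. This upgrades superadditivity of \<open>val\<close> to
  additivity.\<close>

lemma val_inv:
  assumes x: "x \<in> carrier R" "x \<noteq> \<zero>"
  shows "val (inv x) = - val x"
proof (rule antisym)
  show "val (inv x) \<le> - val x"
    using val_mult_ge[OF x nonzero_inv(1,4)[OF x]] nonzero_inv[OF x] by (simp add: val_one)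
  show "- val x \<le> val (inv x)"
  proof (rule ccontr)
    assume "\<not> - val x \<le> val (inv x)"
    hence "val x < - val (inv x)" by simp
    then obtain r where r: "r \<in> \<rat>" "val x < r" "r < - val (inv x)" using Rats_dense_in_real by blast
    then obtain i :: int and n :: nat where i: "n > 0" "r = real_of_int i / real n"
      by (metis Rats_cases' of_int_of_nat_eq zero_less_imp_eq_int of_nat_0_less_iff)
    define a b where "a = nat (- i)" and "b = nat i"
    have ab: "r = (real b - real a) / real n" using i(2) by (auto simp: a_def b_def)
    have "\<not> Q x n a b" using val_ge[OF x _ i(1), of a b] r(2) ab by auto
    hence "Q (inv x) n b a" by (rule Q_total[OF x])
    hence "(real a - real b) / real n \<le> val (inv x)" using nonzero_inv[OF x] i(1) by (intro val_ge)
    moreover have "(real a - real b) / real n = - r" by (simp add: ab minus_divide_left)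
    ultimately show False using r(3) by simp
  qed
qed

lemma val_mult:
  assumes x: "x \<in> carrier R" "x \<noteq> \<zero>" and y: "y \<in> carrier R" "y \<noteq> \<zero>"
  shows "val (x \<otimes> y) = val x + val y"
proof (rule antisym)
  have xy: "x \<otimes> y \<in> carrier R" "x \<otimes> y \<noteq> \<zero>" using x y by (auto simp: integral_iff)
  have "(x \<otimes> y) \<otimes> inv y = x" using x y nonzero_inv[OF y] by (simp add: m_assoc)
  thus "val (x \<otimes> y) \<le> val x + val y"
    using val_mult_ge[OF xy nonzero_inv(1,4)[OF y]] val_inv[OF y] by simp
qed (rule val_mult_ge[OF assms])

text \<open>Outside \<open>A\<close> the inverse is a nonunit of \<open>A\<close>; by
  \<open>rank_1\<close> its k-th power is divisible by \<open>p\<close>, so its value is at least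
  1/k and that of \<open>x\<close> is negative.\<close>

lemma val_nonneg_iff:
  assumes x: "x \<in> carrier R" "x \<noteq> \<zero>"
  shows "0 \<le> val x \<longleftrightarrow> x \<in> A"
proof
  assume "x \<in> A"
  hence "Q x 1 0 0" unfolding Q_def using x by (intro bexI[of _ x]) auto
  from val_ge[OF x this] show "0 \<le> val x" by simp
next
  assume ge: "0 \<le> val x"
  show "x \<in> A"
  proof (rule ccontr)
    assume nx: "x \<notin> A"
    hence "inv x \<in> A" using total[OF x] by blast
    then obtain k :: nat and a where k: "a \<in> A" "inv x [^] k = p \<otimes> a"
      using rank_1[of "inv x"] nonzero_inv[OF x] nx by auto
    have "k \<noteq> 0" using k p_mult_neq_one[OF k(1)] by (intro notI) simp
    moreover have "Q (inv x) k 0 1"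
      unfolding Q_def using k nonzero_inv[OF x] A_carr[OF k(1)] by (intro bexI[of _ a]) auto
    ultimately have "0 < val (inv x)"
      using val_ge[OF nonzero_inv(1,4)[OF x], of k 0 1] by (auto intro: less_le_trans[rotated])
    thus False using val_inv[OF x] ge by simp
  qed
qed

lemma val_p: "val p = 1"
proof (rule antisym)
  have "Q (inv p) 1 1 0"
    unfolding Q_def using nonzero_inv[OF p_carr p_nz] A_one by (intro bexI[of _ \<one>]) auto
  from val_ge[OF nonzero_inv(1,4)[OF p_carr p_nz] this] show "val p \<le> 1"
    using val_inv[OF p_carr p_nz] by simp
  have "Q p 1 0 1" unfolding Q_def using A_one by (intro bexI[of _ \<one>]) auto
  from val_ge[OF p_carr p_nz this] show "1 \<le> val p" by simp
qed

text \<open>The absolute value is c to the power \<open>- val\<close>; for Q_p the base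
  \<open>c\<close> will be the prime. For a sum, the term of smaller \<open>val\<close> is factored
  out, and the rest, of the form 1 + y / x, lies in \<open>A\<close>.\<close>

theorem ex_absolute_value:
  fixes c :: real
  assumes c: "c > 1"
  shows "\<exists>v. absolute_value R v \<and> (\<forall>x\<in>A. v x \<le> 1) \<and> v p = 1 / c"
proof -
  define v where "v = (\<lambda>x. if x = \<zero> then 0 else c powr (- val x))"
  have le_1: "c powr t \<le> 1" if "t \<le> 0" for t
    using powr_mono[OF that, of c] c by simp
  have mult: "v (x \<otimes> y) = v x * v y" if "x \<in> carrier R" "y \<in> carrier R" for x y
    using that by (auto simp: v_def integral_iff val_mult powr_add[symmetric])
  have mono: "v (x \<oplus> y) \<le> v x" if x: "x \<in> carrier R" "x \<noteq> \<zero>" and y: "y \<in> carrier R" "y \<noteq> \<zero>" and le: "val x \<le> val y" for x y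
  proof -
    note ix = nonzero_inv[OF x]
    have nz: "inv x \<otimes> y \<in> carrier R" "inv x \<otimes> y \<noteq> \<zero>" using ix y by (auto simp: integral_iff)
    have "val (inv x \<otimes> y) \<ge> 0" using le by (simp add: val_mult ix y val_inv x)
    hence "inv x \<otimes> y \<in> A" using val_nonneg_iff[OF nz] by blast
    hence oneA: "\<one> \<oplus> inv x \<otimes> y \<in> A" using A_add A_one by blast
    have "x \<otimes> (\<one> \<oplus> inv x \<otimes> y) = x \<oplus> (x \<otimes> inv x) \<otimes> y" using ix(1) x y by (simp add: r_distr m_assoc)
    hence eq: "x \<oplus> y = x \<otimes> (\<one> \<oplus> inv x \<otimes> y)" using ix y by simp
    have "v (\<one> \<oplus> inv x \<otimes> y) \<le> 1"
      using val_nonneg_iff[OF A_carr[OF oneA]] oneA c by (auto simp: v_def intro!: le_1)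
    hence "v x * v (\<one> \<oplus> inv x \<otimes> y) \<le> v x * 1" by (intro mult_left_mono) (auto simp: v_def)
    thus ?thesis using mult[OF x(1) A_carr[OF oneA]] by (simp add: eq)
  qed
  have "v (x \<oplus> y) \<le> v x + v y" if xy: "x \<in> carrier R" "y \<in> carrier R" for x y
  proof (cases "x = \<zero> \<or> y = \<zero>")
    case False
    have nonneg: "v x \<ge> 0" "v y \<ge> 0" by (auto simp: v_def)
    show ?thesis
    proof (cases "val x \<le> val y")
      case True
      thus ?thesis using mono[of x y] xy False nonneg by simp
    next
      case le: False
      thus ?thesis using mono[of y x] xy False nonneg by (simp add: a_comm)
    qed
  qed (use xy in \<open>auto simp: v_def\<close>)
  hence "absolute_value R v"
    unfolding absolute_value_def using mult c by (auto simp: v_def)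
  moreover have "v x \<le> 1" if "x \<in> A" for x
    using that val_nonneg_iff[OF A_carr[OF that]] c by (auto simp: v_def intro!: le_1)
  moreover have "v p = 1 / c" using c p_nz by (simp add: v_def val_p powr_minus_divide)
  ultimately show ?thesis by blast
qed

end


section \<open>Polynomial values of bounded degree and maximal subrings\<close>

context ring
begin

text \<open>Values at \<open>x\<close> of polynomials over \<open>A\<close> of degree at most n, in
  Horner form. The degree is recorded because the argument for maximal subrings shortens
  relations.\<close>

primrec pspan :: "'a set \<Rightarrow> 'a \<Rightarrow> nat \<Rightarrow> 'a set" where
  "pspan A x 0 = A"
| "pspan A x (Suc n) = {a \<oplus> x \<otimes> m | a m. a \<in> A \<and> m \<in> pspan A x n}"

declare pspan.simps(2) [simp del]

lemma pspan_Suc_iff: "m \<in> pspan A x (Suc n) \<longleftrightarrow> (\<exists>a k. a \<in> A \<and> k \<in> pspan A x n \<and> m = a \<oplus> x \<otimes> k)"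
  by (auto simp: pspan.simps(2))

end

locale subring_element = field R for R (structure) +
  fixes A :: "'a set" and x :: 'a
  assumes A: "subring A R" and x: "x \<in> carrier R"
begin

lemma
  shows A_carr: "a \<in> A \<Longrightarrow> a \<in> carrier R"
    and A_one: "\<one> \<in> A" and A_zero: "\<zero> \<in> A"
    and A_add: "a \<in> A \<Longrightarrow> b \<in> A \<Longrightarrow> a \<oplus> b \<in> A"
    and A_mult: "a \<in> A \<Longrightarrow> b \<in> A \<Longrightarrow> a \<otimes> b \<in> A"
    and A_neg: "a \<in> A \<Longrightarrow> \<ominus> a \<in> A"
  by (use subringE(1)[OF A] in blast, (rule subringE[OF A]; assumption?)+)

lemma pspan_SucI: "a \<in> A \<Longrightarrow> m \<in> pspan A x n \<Longrightarrow> a \<oplus> x \<otimes> m \<in> pspan A x (Suc n)"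
  unfolding pspan_Suc_iff by blast

lemma pspan_carr: "m \<in> pspan A x n \<Longrightarrow> m \<in> carrier R"
  using x A_carr by (induction n arbitrary: m) (auto simp: pspan_Suc_iff)

lemma pspan_zero: "\<zero> \<in> pspan A x n"
proof (induction n)
  case (Suc n)
  then show ?case using pspan_SucI[OF A_zero Suc] x by simp
qed (simp add: A_zero)

lemma pspan_base: "a \<in> A \<Longrightarrow> a \<in> pspan A x n"
proof (induction n)
  case (Suc n)
  then show ?case using pspan_SucI[OF Suc.prems pspan_zero, of n] x A_carr by simp
qed simp

lemma pspan_shift: "m \<in> pspan A x n \<Longrightarrow> x \<otimes> m \<in> pspan A x (Suc n)"
  using pspan_SucI[OF A_zero, of m n] x pspan_carr[of m n] by simp

lemma pspan_add: "m \<in> pspan A x n \<Longrightarrow> m' \<in> pspan A x n \<Longrightarrow> m \<oplus> m' \<in> pspan A x n"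
proof (induction n arbitrary: m m')
  case (Suc n)
  then obtain a k b l where m: "a \<in> A" "k \<in> pspan A x n" "m = a \<oplus> x \<otimes> k"
    and m': "b \<in> A" "l \<in> pspan A x n" "m' = b \<oplus> x \<otimes> l" unfolding pspan_Suc_iff by blast
  have "m \<oplus> m' = (a \<oplus> b) \<oplus> x \<otimes> (k \<oplus> l)"
    unfolding m(3) m'(3) using A_carr[OF m(1)] A_carr[OF m'(1)] pspan_carr[OF m(2)] pspan_carr[OF m'(2)] x
    by (simp add: r_distr a_ac)
  thus ?case using pspan_SucI[OF A_add[OF m(1) m'(1)] Suc.IH[OF m(2) m'(2)]] by simp
qed (simp add: A_add)

lemma pspan_smult: "a \<in> A \<Longrightarrow> m \<in> pspan A x n \<Longrightarrow> a \<otimes> m \<in> pspan A x n"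
proof (induction n arbitrary: m)
  case (Suc n)
  then obtain b k where m: "b \<in> A" "k \<in> pspan A x n" "m = b \<oplus> x \<otimes> k" unfolding pspan_Suc_iff by blast
  have "a \<otimes> m = (a \<otimes> b) \<oplus> x \<otimes> (a \<otimes> k)"
    unfolding m(3) using A_carr[OF m(1)] A_carr[OF Suc.prems(1)] pspan_carr[OF m(2)] x
    by (simp add: r_distr m_lcomm)
  thus ?case using pspan_SucI[OF A_mult[OF Suc.prems(1) m(1)] Suc.IH[OF Suc.prems(1) m(2)]] by simp
qed (simp add: A_mult)

lemma pspan_Suc: "m \<in> pspan A x n \<Longrightarrow> m \<in> pspan A x (Suc n)"
proof (induction n arbitrary: m)
  case 0
  then show ?case using pspan_base[of m "Suc 0"] by simp
next
  case (Suc n)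
  then obtain b k where m: "b \<in> A" "k \<in> pspan A x n" "m = b \<oplus> x \<otimes> k" unfolding pspan_Suc_iff by blast
  show ?case unfolding m(3) by (rule pspan_SucI[OF m(1) Suc.IH[OF m(2)]])
qed

lemma pspan_mono: "n \<le> k \<Longrightarrow> m \<in> pspan A x n \<Longrightarrow> m \<in> pspan A x k"
  by (induction k rule: dec_induct) (auto intro: pspan_Suc)

lemma pspan_mult: "m \<in> pspan A x n \<Longrightarrow> m' \<in> pspan A x k \<Longrightarrow> m \<otimes> m' \<in> pspan A x (n + k)"
proof (induction n arbitrary: m)
  case (Suc n)
  then obtain b l where m: "b \<in> A" "l \<in> pspan A x n" "m = b \<oplus> x \<otimes> l" unfolding pspan_Suc_iff by blast
  have "m \<otimes> m' = b \<otimes> m' \<oplus> x \<otimes> (l \<otimes> m')"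
    unfolding m(3) using A_carr[OF m(1)] pspan_carr[OF m(2)] pspan_carr[OF Suc.prems(2)] x
    by (simp add: l_distr m_assoc)
  moreover have "b \<otimes> m' \<in> pspan A x (Suc n + k)"
    using pspan_mono[OF _ pspan_smult[OF m(1) Suc.prems(2)]] by simp
  moreover have "x \<otimes> (l \<otimes> m') \<in> pspan A x (Suc n + k)"
    using pspan_shift[OF Suc.IH[OF m(2) Suc.prems(2)]] by simp
  ultimately show ?case using pspan_add by metis
qed (simp add: pspan_smult)

lemma pspan_pow: "x [^] n \<in> pspan A x n"
proof (induction n)
  case (Suc n)
  then show ?case using pspan_shift[OF Suc] x by (simp add: m_comm)
qed (simp add: A_one)

lemma pspan_top:
  "m \<in> pspan A x (Suc n) \<Longrightarrow> \<exists>m'\<in>pspan A x n. \<exists>a\<in>A. m = m' \<oplus> a \<otimes> x [^] Suc n"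
proof (induction n arbitrary: m)
  case 0
  then obtain b l where m: "b \<in> A" "l \<in> A" "m = b \<oplus> x \<otimes> l" unfolding pspan_Suc_iff by auto
  hence "m = b \<oplus> l \<otimes> x [^] Suc 0" using x A_carr by (simp add: m_comm)
  thus ?case using m(1,2) unfolding pspan.simps(1) by blast
next
  case (Suc n)
  then obtain b l where m: "b \<in> A" "l \<in> pspan A x (Suc n)" "m = b \<oplus> x \<otimes> l"
    unfolding pspan_Suc_iff[of _ _ _ "Suc n"] by blast
  obtain m' a where m': "m' \<in> pspan A x n" "a \<in> A" "l = m' \<oplus> a \<otimes> x [^] Suc n" using Suc.IH[OF m(2)] by blast
  have c: "b \<in> carrier R" "a \<in> carrier R" "m' \<in> carrier R" using A_carr m(1) m'(2) pspan_carr[OF m'(1)] by auto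
  have "m = (b \<oplus> x \<otimes> m') \<oplus> a \<otimes> x [^] Suc (Suc n)"
    unfolding m(3) m'(3) using c x by (simp add: r_distr a_assoc m_ac)
  thus ?case using pspan_SucI[OF m(1) m'(1)] m'(2) by blast
qed

text \<open>Multiplication by the n-th power of \<open>x\<close> reverses the coefficients of a
  polynomial in \<open>inv x\<close>.\<close>

lemma pspan_inv:
  assumes "x \<noteq> \<zero>"
  shows "m \<in> pspan A (inv x) n \<Longrightarrow> x [^] n \<otimes> m \<in> pspan A x n"
proof (induction n arbitrary: m)
  case 0
  then show ?case using A_carr by simp
next
  case (Suc n)
  note ix = nonzero_inv[OF x assms]
  interpret inv: subring_element R A "inv x"
    by (intro subring_element.intro subring_element_axioms.intro field_axioms A ix(1))
  obtain b l where m: "b \<in> A" "l \<in> pspan A (inv x) n" "m = b \<oplus> inv x \<otimes> l"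
    using Suc.prems unfolding pspan_Suc_iff by blast
  have c: "b \<in> carrier R" "l \<in> carrier R" using A_carr m(1) inv.pspan_carr[OF m(2)] by auto
  have "x [^] Suc n \<otimes> m = b \<otimes> x [^] Suc n \<oplus> (x \<otimes> inv x) \<otimes> (x [^] n \<otimes> l)"
    unfolding m(3) using c x ix(1) by (simp add: r_distr m_ac)
  also have "(x \<otimes> inv x) \<otimes> (x [^] n \<otimes> l) = x [^] n \<otimes> l" using c x ix by simp
  finally have "x [^] Suc n \<otimes> m = b \<otimes> x [^] Suc n \<oplus> x [^] n \<otimes> l" .
  thus ?case
    using pspan_add[OF pspan_smult[OF m(1) pspan_pow] pspan_Suc[OF Suc.IH[OF m(2)]]] by simp
qed

lemma pspan_subring: "subring (\<Union>n. pspan A x n) R"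
proof (rule subringI)
  show "(\<Union>n. pspan A x n) \<subseteq> carrier R" using pspan_carr by blast
  show "\<one> \<in> (\<Union>n. pspan A x n)" using pspan_base[OF A_one] by blast
next
  fix h assume "h \<in> (\<Union>n. pspan A x n)"
  then obtain n where h: "h \<in> pspan A x n" by blast
  have "\<ominus> \<one> \<otimes> h \<in> pspan A x n" by (intro pspan_smult A_neg A_one h)
  moreover have "\<ominus> \<one> \<otimes> h = \<ominus> h" using pspan_carr[OF h] by (simp add: l_minus)
  ultimately show "\<ominus> h \<in> (\<Union>n. pspan A x n)" by auto
next
  fix h k assume "h \<in> (\<Union>n. pspan A x n)" "k \<in> (\<Union>n. pspan A x n)"
  then obtain m n where hk: "h \<in> pspan A x m" "k \<in> pspan A x n" by blast
  show "h \<otimes> k \<in> (\<Union>n. pspan A x n)" using pspan_mult[OF hk] by blast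
  have "h \<in> pspan A x (max m n)" "k \<in> pspan A x (max m n)" using hk pspan_mono by (meson max.cobounded1 max.cobounded2)+
  thus "h \<oplus> k \<in> (\<Union>n. pspan A x n)" using pspan_add by blast
qed

end

text \<open>
  Such a maximal subring \<open>A\<close> is a valuation ring: otherwise \<open>inv p\<close> is a polynomial over \<open>A\<close> in \<open>x\<close> and also one in
  \<open>inv x\<close>, and the relation of higher degree can be shortened by means of the other.
\<close>

locale maximal_subring = field R for R (structure) +
  fixes A :: "'a set" and p :: 'a
  assumes A: "subring A R" and p_in: "p \<in> A" and p_nz: "p \<noteq> \<zero>" and inv_p: "inv p \<notin> A"
    and maximal: "subring B R \<Longrightarrow> A \<subseteq> B \<Longrightarrow> inv p \<notin> B \<Longrightarrow> B = A"
begin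

lemma
  shows A_carr: "a \<in> A \<Longrightarrow> a \<in> carrier R"
    and A_one: "\<one> \<in> A"
    and A_add: "a \<in> A \<Longrightarrow> b \<in> A \<Longrightarrow> a \<oplus> b \<in> A"
    and A_mult: "a \<in> A \<Longrightarrow> b \<in> A \<Longrightarrow> a \<otimes> b \<in> A"
    and A_neg: "a \<in> A \<Longrightarrow> \<ominus> a \<in> A"
  by (use subringE(1)[OF A] in blast, (rule subringE[OF A]; assumption?)+)

lemma subring_elementI: "x \<in> carrier R \<Longrightarrow> subring_element R A x"
  by (intro subring_element.intro subring_element_axioms.intro field_axioms A)

lemma p_carr: "p \<in> carrier R"
  using p_in A_carr by blast

lemma ip: "inv p \<in> carrier R" "p \<otimes> inv p = \<one>"
  using nonzero_inv[OF p_carr p_nz] by auto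

lemma p_mult_neq_one: "a \<in> A \<Longrightarrow> p \<otimes> a \<noteq> \<one>"
  using inv_eqI[OF p_carr A_carr] inv_p by metis

text \<open>Otherwise A[x] would be a larger subring without \<open>inv p\<close>.\<close>

lemma notin_imp:
  assumes "x \<in> carrier R" "x \<notin> A"
  shows "\<exists>n. inv p \<in> pspan A x n"
proof (rule ccontr)
  interpret subring_element R A x using assms(1) by (rule subring_elementI)
  assume "\<nexists>n. inv p \<in> pspan A x n"
  hence "(\<Union>n. pspan A x n) = A"
    using pspan_base by (intro maximal pspan_subring) blast+
  moreover have "x \<in> pspan A x 1" using pspan_pow[of 1] x by simp
  ultimately show False using assms(2) by blast
qed

text \<open>\<open>inv p\<close> is a polynomial in \<open>inv y\<close> of some degree n;
  multiplied by y^n it becomes a polynomial in \<open>y\<close>, an element of \<open>A\<close>.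
  This is the rank one condition.\<close>

lemma nonunit_power:
  assumes "y \<in> A" "y \<noteq> \<zero>" "inv y \<notin> A"
  shows "\<exists>k::nat. \<exists>a\<in>A. y [^] k = p \<otimes> a"
proof -
  have y: "y \<in> carrier R" using assms A_carr by blast
  interpret y: subring_element R A y using y by (rule subring_elementI)
  obtain n where n: "inv p \<in> pspan A (inv y) n" using notin_imp[OF nonzero_inv(1)[OF y assms(2)] assms(3)] by blast
  have "y [^] n \<otimes> inv p \<in> pspan A y n" by (rule y.pspan_inv[OF assms(2) n])
  moreover have "l \<in> pspan A y m \<Longrightarrow> l \<in> A" for l m
    by (induction m arbitrary: l) (auto simp: pspan_Suc_iff A_add A_mult assms(1))
  ultimately have "y [^] n \<otimes> inv p \<in> A" by blast
  moreover have "y [^] n = p \<otimes> (y [^] n \<otimes> inv p)"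
  proof -
    have "p \<otimes> (y [^] n \<otimes> inv p) = y [^] n \<otimes> (p \<otimes> inv p)" using y p_carr ip(1) by (simp add: m_lcomm)
    thus ?thesis using ip y by simp
  qed
  ultimately show ?thesis by blast
qed

text \<open>All powers of 1 - p b are 1 modulo p. By \<open>nonunit_power\<close> a nonunit would
  have a power divisible by \<open>p\<close>, which makes 1 divisible by \<open>p\<close>.\<close>

lemma unit_one_minus:
  assumes b: "b \<in> A"
  shows "\<one> \<ominus> p \<otimes> b \<noteq> \<zero>" "inv (\<one> \<ominus> p \<otimes> b) \<in> A"
proof -
  define u where "u = \<one> \<ominus> p \<otimes> b"
  have u: "u \<in> A" unfolding u_def minus_eq by (intro A_add A_one A_neg A_mult p_in b)
  have bc: "b \<in> carrier R" using A_carr b by blast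
  show nz: "\<one> \<ominus> p \<otimes> b \<noteq> \<zero>"
    using p_mult_neq_one[OF b] p_carr bc by (metis m_closed one_closed r_right_minus_eq)
  show "inv (\<one> \<ominus> p \<otimes> b) \<in> A"
  proof (rule ccontr)
    assume "inv (\<one> \<ominus> p \<otimes> b) \<notin> A"
    then obtain k :: nat and a where k: "a \<in> A" "u [^] k = p \<otimes> a"
      using nonunit_power[OF u] nz unfolding u_def by blast
    have "\<exists>c\<in>A. u [^] (n::nat) = \<one> \<ominus> p \<otimes> c" for n
    proof (induction n)
      case 0
      have "u [^] (0::nat) = \<one> \<ominus> p \<otimes> \<zero>" using p_carr by (simp add: minus_eq)
      then show ?case using subringE(2)[OF A] by blast
    next
      case (Suc n)
      then obtain c where c: "c \<in> A" "u [^] n = \<one> \<ominus> p \<otimes> c" by blast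
      have cc: "c \<in> carrier R" using A_carr c by blast
      have "u [^] Suc n = (\<one> \<ominus> p \<otimes> c) \<otimes> (\<one> \<ominus> p \<otimes> b)" using c by (simp add: u_def)
      also have "\<dots> = \<one> \<ominus> p \<otimes> (c \<oplus> b \<ominus> p \<otimes> c \<otimes> b)"
        using cc bc p_carr by algebra
      finally have "u [^] Suc n = \<one> \<ominus> p \<otimes> (c \<oplus> b \<ominus> p \<otimes> c \<otimes> b)" .
      moreover have "c \<oplus> b \<ominus> p \<otimes> c \<otimes> b \<in> A"
        unfolding minus_eq using c(1) b p_in by (intro A_add A_neg A_mult)
      ultimately show ?case by blast
    qed
    then obtain c where c: "c \<in> A" "u [^] k = \<one> \<ominus> p \<otimes> c" by blast
    have carr: "a \<in> carrier R" "c \<in> carrier R" using A_carr k c by auto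
    have "p \<otimes> (a \<oplus> c) = p \<otimes> a \<oplus> p \<otimes> c" using carr p_carr by (simp add: r_distr)
    also have "\<dots> = (\<one> \<ominus> p \<otimes> c) \<oplus> p \<otimes> c" using k c by simp
    also have "\<dots> = \<one>" using carr p_carr by algebra
    finally show False using p_mult_neq_one[OF A_add[OF k(1) c(1)]] by simp
  qed
qed

lemma ex_shorter_relation:
  assumes x: "x \<in> carrier R" "x \<noteq> \<zero>" and mn: "m \<le> n" and m: "inv p \<in> pspan A (inv x) m"
    and n: "inv p \<in> pspan A x n"
  shows "\<exists>k<n. inv p \<in> pspan A x k"
proof -
  note ix = nonzero_inv[OF x]
  interpret x: subring_element R A x using x(1) by (rule subring_elementI)
  interpret ix: subring_element R A "inv x" using ix(1) by (rule subring_elementI)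
  have "m \<noteq> 0" using m inv_p by (cases "m = 0") auto
  then obtain m' where m': "m = Suc m'" by (cases m) auto
  then obtain n' where n': "n = Suc n'" using mn by (cases n) auto
  obtain b b' where b: "b \<in> A" "b' \<in> pspan A (inv x) m'" "inv p = b \<oplus> inv x \<otimes> b'"
    using m unfolding m' pspan_Suc_iff by blast
  have c: "b \<in> carrier R" "b' \<in> carrier R" using A_carr b(1) ix.pspan_carr[OF b(2)] by auto
  define u where "u = \<one> \<ominus> p \<otimes> b"
  have uc: "u \<in> carrier R" "u \<noteq> \<zero>" "inv u \<in> A" "u \<otimes> inv u = \<one>"
    using unit_one_minus[OF b(1)] c p_carr nonzero_inv[of u] by (auto simp: u_def)
  have iu: "inv u \<in> carrier R" using A_carr uc(3) by blast
  \<comment> \<open>The constant term \<open>b\<close> is moved to the left: inv p - b = inv p (1 -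
    p b), and 1 - p b is a unit of \<open>A\<close>. So \<open>inv p\<close> becomes a polynomial in
    \<open>inv x\<close> without constant term, and x^m / p has degree below m in
    \<open>x\<close>.\<close>
  have "inv p \<otimes> u = inv p \<ominus> (p \<otimes> inv p) \<otimes> b" using c p_carr ip(1) unfolding u_def by algebra
  also have "\<dots> = (b \<oplus> inv x \<otimes> b') \<ominus> b" using ip c b(3) by simp
  also have "\<dots> = inv x \<otimes> b'" using c ix(1) by algebra
  finally have e: "inv p \<otimes> u = inv x \<otimes> b'" .
  define b'' where "b'' = inv u \<otimes> b'"
  have b'': "b'' \<in> pspan A (inv x) m'" unfolding b''_def using ix.pspan_smult[OF uc(3) b(2)] .
  have b''c: "b'' \<in> carrier R" by (rule ix.pspan_carr[OF b''])
  have "inv p = (inv p \<otimes> u) \<otimes> inv u" using uc ip iu by (simp add: m_assoc)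
  hence e2: "inv p = inv x \<otimes> b''" unfolding e b''_def using ix(1) c iu by (simp add: m_ac)
  have "x [^] m \<otimes> inv p = (x \<otimes> inv x) \<otimes> (x [^] m' \<otimes> b'')"
    unfolding e2 m' using x(1) ix(1) b''c by (simp add: m_ac)
  hence "x [^] m \<otimes> inv p = x [^] m' \<otimes> b''" using ix(2) x(1) b''c by simp
  hence xm: "x [^] m \<otimes> inv p \<in> pspan A x m'" using x.pspan_inv[OF x(2) b''] by simp
  obtain r a where r: "r \<in> pspan A x n'" "a \<in> A" "inv p = r \<oplus> a \<otimes> x [^] n"
    using x.pspan_top[OF n[unfolded n']] unfolding n' by blast
  have ac: "a \<in> carrier R" using A_carr r(2) by blast
  \<comment> \<open>The leading term of the other relation is rewritten by means of x^m / p; here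
    \<open>m <= n\<close> enters, and the degree drops to n - 1.\<close>
  have "a \<otimes> x [^] n = a \<otimes> (x [^] (n - m) \<otimes> x [^] m) \<otimes> (p \<otimes> inv p)"
    using mn x(1) ac ip by (simp add: nat_pow_mult)
  also have "\<dots> = (a \<otimes> p) \<otimes> (x [^] (n - m) \<otimes> (x [^] m \<otimes> inv p))"
    using x(1) ac p_carr ip(1) by (simp add: m_ac)
  also have "\<dots> \<in> pspan A x (n - m + m')"
    by (intro x.pspan_smult A_mult r(2) p_in x.pspan_mult x.pspan_pow xm)
  also have "n - m + m' = n'" using mn m' n' by simp
  finally have "inv p \<in> pspan A x n'" unfolding r(3) by (intro x.pspan_add r(1))
  thus ?thesis using n' by blast
qed

text \<open>Of the two shortest relations, the one of higher degree could be shortened; the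
  situation is symmetric in \<open>x\<close> and \<open>inv x\<close>.\<close>

lemma total:
  assumes x: "x \<in> carrier R" "x \<noteq> \<zero>"
  shows "x \<in> A \<or> inv x \<in> A"
proof (rule ccontr)
  assume "\<not> (x \<in> A \<or> inv x \<in> A)"
  hence nin: "x \<notin> A" "inv x \<notin> A" by blast+
  note ix = nonzero_inv[OF x]
  define n where "n = (LEAST n. inv p \<in> pspan A x n)"
  define m where "m = (LEAST n. inv p \<in> pspan A (inv x) n)"
  have n: "inv p \<in> pspan A x n" unfolding n_def using notin_imp[OF x(1) nin(1)] by (rule LeastI_ex)
  have m: "inv p \<in> pspan A (inv x) m" unfolding m_def using notin_imp[OF ix(1) nin(2)] by (rule LeastI_ex)
  show False
  proof (cases "m \<le> n")
    case True
    then obtain k where "k < n" "inv p \<in> pspan A x k" using ex_shorter_relation[OF x True m n] by blast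
    thus False using not_less_Least unfolding n_def by blast
  next
    case False
    hence "n \<le> m" by simp
    then obtain k where "k < m" "inv p \<in> pspan A (inv x) k"
      using ex_shorter_relation[OF ix(1,4) _ _ m, of n] n ix(5) by auto
    thus False using not_less_Least unfolding m_def by blast
  qed
qed

end

context field
begin

lemma ex_maximal_subring:
  assumes Z: "subring Z R" and p: "p \<in> Z" "p \<noteq> \<zero>" "inv p \<notin> Z"
  shows "\<exists>A. maximal_subring R A p \<and> Z \<subseteq> A"
proof -
  define F where "F = {A. subring A R \<and> Z \<subseteq> A \<and> inv p \<notin> A}"
  have "\<exists>M\<in>F. \<forall>Y\<in>F. M \<subseteq> Y \<longrightarrow> Y = M"
  proof (rule subset_Zorn_nonempty)
    have "Z \<in> F" using Z p(3) by (simp add: F_def)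
    thus "F \<noteq> {}" by blast
  next
    fix C assume C: "C \<noteq> {}" "subset.chain F C"
    have sub: "subring A R" if AC: "A \<in> C" for A
    proof -
      have "A \<in> F" using C(2) AC unfolding subset.chain_def by blast
      thus ?thesis by (simp add: F_def)
    qed
    have "subring (\<Union>C) R"
    proof (rule subringI)
      show "\<Union>C \<subseteq> carrier R" using subringE(1)[OF sub] by blast
      show "\<one> \<in> \<Union>C" using subringE(3)[OF sub] C(1) by blast
      show "\<ominus> h \<in> \<Union>C" if "h \<in> \<Union>C" for h using subringE(5)[OF sub] that by blast
      fix h k assume "h \<in> \<Union>C" "k \<in> \<Union>C"
      then obtain A B where AB: "h \<in> A" "A \<in> C" "k \<in> B" "B \<in> C" by blast
      hence "A \<subseteq> B \<or> B \<subseteq> A" using C(2) unfolding subset.chain_def by blast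
      then obtain D where D: "D \<in> C" "h \<in> D" "k \<in> D" using AB by blast
      show "h \<otimes> k \<in> \<Union>C" "h \<oplus> k \<in> \<Union>C"
        using subringE(6,7)[OF sub[OF D(1)] D(2,3)] D(1) by blast+
    qed
    moreover have "C \<subseteq> F" using C(2) unfolding subset.chain_def by blast
    hence "Z \<subseteq> \<Union>C" "inv p \<notin> \<Union>C" using C(1) unfolding F_def by blast+
    ultimately show "\<Union>C \<in> F" by (simp add: F_def)
  qed
  then obtain A where A: "A \<in> F" "\<And>B. B \<in> F \<Longrightarrow> A \<subseteq> B \<Longrightarrow> B = A" by blast
  have "B = A" if "subring B R" "A \<subseteq> B" "inv p \<notin> B" for B
    using A(1) that by (intro A(2)) (auto simp: F_def)
  moreover have "subring A R" "p \<in> A" "inv p \<notin> A" using A(1) p(1) unfolding F_def by blast+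
  ultimately have "maximal_subring R A p"
    using p(2) by (intro maximal_subring.intro maximal_subring_axioms.intro field_axioms)
  thus ?thesis using A(1) unfolding F_def by blast
qed

text \<open>Zorn's lemma gives the valuation ring, and \<open>alg\<close> yields
  \<open>archimedean\<close>. For z outside \<open>A\<close> the inverse lies in \<open>A\<close>;
  dividing the equation of z by a power of z puts p^j times leading coefficient times z into
  \<open>A\<close>, and p^k clears the leading coefficient.\<close>

theorem ex_absolute_value_extending:
  fixes c :: real
  assumes Z: "subring Z R" and p: "p \<in> Z" "p \<noteq> \<zero>" "inv p \<notin> Z" and c: "c > 1"
    and alg: "\<And>z. z \<in> carrier R \<Longrightarrow> \<exists>P (j::nat) (k::nat). P \<noteq> [] \<and> set P \<subseteq> carrier R \<and> hd P \<noteq> \<zero> \<and>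
      eval P z = \<zero> \<and> (\<forall>a\<in>set P. p [^] j \<otimes> a \<in> Z) \<and> p [^] k \<otimes> inv (hd P) \<in> Z"
  shows "\<exists>v. absolute_value R v \<and> (\<forall>x\<in>Z. v x \<le> 1) \<and> v p = 1 / c"
proof -
  obtain A where A: "maximal_subring R A p" "Z \<subseteq> A" using ex_maximal_subring[OF Z p] by blast
  interpret A: maximal_subring R A p by fact
  have pj: "p [^] (j::nat) \<in> A" for j by (induction j) (auto simp: A.A_one A.A_mult A.p_in)
  have pc: "p \<in> carrier R" by (rule A.p_carr)
  have "\<exists>k::nat. p [^] k \<otimes> z \<in> A" if z: "z \<in> carrier R" for z
  proof (cases "z \<in> A")
    case True
    then show ?thesis using z by (intro exI[of _ 0]) simp
  next
    case False
    have z0: "z \<noteq> \<zero>" using False subringE(2)[OF A.A] by auto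
    have iz: "inv z \<in> A" using A.total[OF z z0] False by blast
    have izc: "inv z \<in> carrier R" "z \<otimes> inv z = \<one>" using nonzero_inv[OF z z0] by auto
    obtain P j k where P: "P \<noteq> []" "set P \<subseteq> carrier R" "hd P \<noteq> \<zero>" "eval P z = \<zero>"
      "\<And>a. a \<in> set P \<Longrightarrow> p [^] (j::nat) \<otimes> a \<in> A" "p [^] (k::nat) \<otimes> inv (hd P) \<in> A"
      using alg[OF z] A(2) by blast
    \<comment> \<open>\<open>y\<close> is the sum of the coefficients times increasing powers of
      \<open>inv z\<close>, the leading one with exponent 0; the extra factor \<open>z\<close> on
      the left lets the empty list fit.\<close>
    have ev: "\<exists>y\<in>carrier R. p [^] j \<otimes> y \<in> A \<and> z \<otimes> eval L z = z [^] length L \<otimes> y"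
      if "set L \<subseteq> carrier R" "\<forall>a\<in>set L. p [^] j \<otimes> a \<in> A" for L
      using that
    proof (induction L)
      case Nil
      then show ?case using pc z subringE(2)[OF A.A] by (intro bexI[of _ \<zero>]) auto
    next
      case (Cons a L)
      then obtain y where y: "y \<in> carrier R" "p [^] j \<otimes> y \<in> A" "z \<otimes> eval L z = z [^] length L \<otimes> y" by auto
      have ac: "a \<in> carrier R" "p [^] j \<otimes> a \<in> A" using Cons.prems by auto
      have evc: "eval L z \<in> carrier R" using Cons.prems z by (intro eval_in_carrier) auto
      have "z \<otimes> eval (a # L) z = z [^] Suc (length L) \<otimes> a \<oplus> z \<otimes> eval L z"
        using ac(1) evc z by (simp add: r_distr m_ac)
      also have "z \<otimes> eval L z = (z [^] length L \<otimes> y) \<otimes> (z \<otimes> inv z)" using y z izc by simp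
      also have "z [^] Suc (length L) \<otimes> a \<oplus> \<dots> = z [^] Suc (length L) \<otimes> (a \<oplus> inv z \<otimes> y)"
        using ac(1) y(1) z izc(1) by (simp add: r_distr m_ac)
      finally have "z \<otimes> eval (a # L) z = z [^] length (a # L) \<otimes> (a \<oplus> inv z \<otimes> y)" by simp
      moreover have "p [^] j \<otimes> (a \<oplus> inv z \<otimes> y) = p [^] j \<otimes> a \<oplus> inv z \<otimes> (p [^] j \<otimes> y)"
        using ac(1) y(1) pc izc(1) by (simp add: r_distr m_lcomm)
      hence "p [^] j \<otimes> (a \<oplus> inv z \<otimes> y) \<in> A" using A.A_add[OF ac(2) A.A_mult[OF iz y(2)]] by simp
      ultimately show ?case using ac(1) y(1) izc(1) by (intro bexI[of _ "a \<oplus> inv z \<otimes> y"]) auto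
    qed
    obtain a L where aL: "P = a # L" using P(1) by (cases P) auto
    have ac: "a \<in> carrier R" "a \<noteq> \<zero>" using P aL by auto
    note ia = nonzero_inv[OF ac]
    have L: "set L \<subseteq> carrier R" "\<forall>b\<in>set L. p [^] j \<otimes> b \<in> A" using P aL by auto
    obtain y where y: "y \<in> carrier R" "p [^] j \<otimes> y \<in> A" "z \<otimes> eval L z = z [^] length L \<otimes> y" using ev[OF L] by blast
    have evc: "eval L z \<in> carrier R" using L z by (intro eval_in_carrier) auto
    have "z [^] length L \<otimes> (a \<otimes> z \<oplus> y) = z \<otimes> eval P z"
      unfolding aL using ac(1) y evc z by (simp add: r_distr m_ac flip: y(3))
    hence "z [^] length L \<otimes> (a \<otimes> z \<oplus> y) = \<zero>" using P(4) z by simp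
    hence "a \<otimes> z \<oplus> y = \<zero>"
      using nat_pow_nonzero[OF z z0, of "length L"] ac(1) z y(1) by (simp add: integral_iff)
    hence "\<ominus> y = a \<otimes> z" using ac(1) z y(1) by (intro minus_equality) auto
    hence "p [^] j \<otimes> (a \<otimes> z) = \<ominus> (p [^] j \<otimes> y)" using y(1) pc r_minus[of "p [^] j" y] by simp
    hence az: "p [^] j \<otimes> (a \<otimes> z) \<in> A" using A.A_neg[OF y(2)] by simp
    have "(p [^] k \<otimes> inv a) \<otimes> (p [^] j \<otimes> (a \<otimes> z)) = (p [^] k \<otimes> p [^] j) \<otimes> ((a \<otimes> inv a) \<otimes> z)"
      using ac(1) ia(1) z pc by (simp add: m_ac)
    also have "\<dots> = p [^] (k + j) \<otimes> z" using ia z pc by (simp add: nat_pow_mult)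
    finally have "p [^] (k + j) \<otimes> z \<in> A" using A.A_mult[OF _ az, of "p [^] k \<otimes> inv a"] P(6) aL by simp
    thus ?thesis by blast
  qed
  hence "valuation_ring R A p"
    by (intro valuation_ring.intro field_axioms valuation_ring_axioms.intro
        A.A A.p_in A.p_nz A.inv_p A.total A.nonunit_power)
  from valuation_ring.ex_absolute_value[OF this c] show ?thesis using A(2) by blast
qed

end

section \<open>Embeddings into an algebraically closed field\<close>

text \<open>A polynomial of least degree that kills \<open>x\<close> has nonzero constant term c, as
  otherwise X could be cancelled; solving c + x q(x) = 0 gives the inverse. Domains of partial
  embeddings are thereby closed under inverses.\<close>

lemma algebraic_inverse_poly:
  fixes x :: "'a::field_char_0"
  assumes "algebraic x" "x \<noteq> 0"
  shows "\<exists>g::'a poly. (\<forall>i. coeff g i \<in> \<rat>) \<and> inverse x = poly g x"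
proof -
  define R where "R = (\<lambda>p::'a poly. (\<forall>i. coeff p i \<in> \<rat>) \<and> p \<noteq> 0 \<and> poly p x = 0)"
  obtain p0 where "R p0"
    using assms(1) unfolding algebraic_def R_def by (metis Ints_subset_Rats subsetD)
  define p where "p = arg_min degree R"
  have p: "R p" "\<And>q. R q \<Longrightarrow> degree p \<le> degree q"
    using arg_min_nat_lemma[of R p0 degree] \<open>R p0\<close> unfolding p_def by auto
  obtain c q where pq: "p = pCons c q" by (cases p)
  have q: "coeff q i \<in> \<rat>" for i
    using p(1) unfolding R_def pq by (metis coeff_pCons_Suc)
  have c: "c \<in> \<rat>" using p(1) unfolding R_def pq by (metis coeff_pCons_0)
  have eq: "c + x * poly q x = 0" using p(1) by (simp add: R_def pq)
  have "c \<noteq> 0"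
  proof
    assume "c = 0"
    hence "q \<noteq> 0" "poly q x = 0" using p(1) eq assms(2) by (auto simp: R_def pq)
    hence "R q" using q by (simp add: R_def)
    from p(2)[OF this] show False using \<open>q \<noteq> 0\<close> by (simp add: pq)
  qed
  have "inverse x = poly (smult (- inverse c) q) x"
    using eq \<open>c \<noteq> 0\<close> assms(2) by (simp add: field_simps add_eq_0_iff)
  moreover have "coeff (smult (- inverse c) q) i \<in> \<rat>" for i using q c by simp
  ultimately show ?thesis by blast
qed

locale embedding_target = field L for L :: "('b, 'm) ring_scheme" (structure) +
  fixes f0 :: "rat \<Rightarrow> 'b"
  assumes f0: "f0 \<in> ring_hom ring_of_type_algebra L"
    and closed: "P \<in> carrier (poly_ring L) \<Longrightarrow> length P > 1 \<Longrightarrow> \<exists>x\<in>carrier L. eval P x = \<zero>"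
begin

lemma
  shows f0_carr [simp]: "f0 q \<in> carrier L"
    and f0_add: "f0 (q + s) = f0 q \<oplus> f0 s"
    and f0_mult: "f0 (q * s) = f0 q \<otimes> f0 s"
    and f0_one: "f0 1 = \<one>"
  using ring_hom_closed[OF f0] ring_hom_add[OF f0] ring_hom_mult[OF f0] ring_hom_one[OF f0]
  by (auto simp: ring_of_type_algebra_def)

lemma f0_zero: "f0 0 = \<zero>"
proof -
  have "f0 0 = f0 0 \<oplus> f0 0" using f0_add[of 0 0] by simp
  thus ?thesis by (metis add.l_cancel_one' f0_carr)
qed

lemma f0_minus_one: "f0 (- 1) = \<ominus> \<one>"
proof -
  have "f0 (- 1) \<oplus> \<one> = \<zero>" using f0_add[of "- 1" 1] by (simp add: f0_one f0_zero)
  thus ?thesis by (metis f0_carr minus_equality one_closed)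
qed

text \<open>Mediates between polynomials over a type and the coefficient lists of the record
  \<open>L\<close>: the coefficients are transported by \<open>h\<close> before evaluation.\<close>

definition horner :: "('c \<Rightarrow> 'b) \<Rightarrow> 'b \<Rightarrow> 'c::zero poly \<Rightarrow> 'b" where
  "horner h r g = foldr (\<lambda>c acc. h c \<oplus> r \<otimes> acc) (coeffs g) \<zero>"

lemma horner_0 [simp]: "horner h r 0 = \<zero>"
  by (simp add: horner_def)

lemma horner_pCons:
  assumes "h 0 = \<zero>" "r \<in> carrier L"
  shows "horner h r (pCons c g) = h c \<oplus> r \<otimes> horner h r g"
  using assms by (auto simp: horner_def cCons_def)

lemma eval_append:
  assumes "set l \<subseteq> carrier L" "b \<in> carrier L" "r \<in> carrier L"
  shows "eval (l @ [b]) r = eval l r \<otimes> r \<oplus> b"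
  using assms
proof (induction l)
  case (Cons a l)
  have "eval l r \<in> carrier L" using Cons.prems by (intro eval_in_carrier) auto
  thus ?case using Cons by (simp add: l_distr a_assoc m_assoc)
qed simp

lemma eval_rev_map:
  assumes "\<And>c. c \<in> set cs \<Longrightarrow> h c \<in> carrier L" "r \<in> carrier L"
  shows "eval (rev (map h cs)) r = foldr (\<lambda>c acc. h c \<oplus> r \<otimes> acc) cs \<zero>"
  using assms
proof (induction cs)
  case (Cons c cs)
  have "eval (rev (map h cs)) r \<in> carrier L" using Cons.prems by (intro eval_in_carrier) auto
  moreover have "eval (rev (map h (c # cs))) r = eval (rev (map h cs)) r \<otimes> r \<oplus> h c"
    using Cons.prems eval_append[of "rev (map h cs)" "h c" r] by auto
  ultimately show ?case using Cons by (simp add: m_comm a_comm)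
qed simp

end

text \<open>A partial homomorphism is encoded by its graph, so that a chain is bounded by its union.
  Single-valuedness is required only at 0; the general case follows by subtraction.\<close>

locale partial_embedding = embedding_target L f0 for L :: "('b, 'm) ring_scheme" (structure) and f0 :: "rat \<Rightarrow> 'b" +
  fixes G :: "('a::field_char_0 \<times> 'b) set"
  assumes G_carr: "(x, l) \<in> G \<Longrightarrow> l \<in> carrier L"
    and G_rat: "(of_rat q, f0 q) \<in> G"
    and G_add: "(x, l) \<in> G \<Longrightarrow> (y, k) \<in> G \<Longrightarrow> (x + y, l \<oplus> k) \<in> G"
    and G_mult: "(x, l) \<in> G \<Longrightarrow> (y, k) \<in> G \<Longrightarrow> (x * y, l \<otimes> k) \<in> G"
    and G_zero: "(0, l) \<in> G \<Longrightarrow> l = \<zero>"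
begin

lemma functional:
  assumes "(x, l) \<in> G" "(x, k) \<in> G"
  shows "l = k"
proof -
  have c: "l \<in> carrier L" "k \<in> carrier L" using assms G_carr by blast+
  have "(- 1, \<ominus> \<one>) \<in> G" using G_rat[of "- 1"] by (simp add: f0_minus_one of_rat_minus)
  from G_add[OF assms(1) G_mult[OF this assms(2)]]
  have "(0, l \<oplus> \<ominus> \<one> \<otimes> k) \<in> G" by simp
  hence "l \<oplus> \<ominus> \<one> \<otimes> k = \<zero>" by (rule G_zero)
  hence "l \<ominus> k = \<zero>" using c by (simp add: l_minus minus_eq)
  thus ?thesis using c r_right_minus_eq by blast
qed

definition D where "D = fst ` G"

definition h where "h x = (THE l. (x, l) \<in> G)"

lemma h_eqI: "(x, l) \<in> G \<Longrightarrow> h x = l"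
  unfolding h_def by (rule the_equality) (auto intro: functional)

lemma G_D: "(x, l) \<in> G \<Longrightarrow> x \<in> D"
  unfolding D_def by (rule image_eqI[of _ _ "(x, l)"]) auto

lemma h_in_G: "x \<in> D \<Longrightarrow> (x, h x) \<in> G"
  using h_eqI by (auto simp: D_def)

lemma h_carr: "x \<in> D \<Longrightarrow> h x \<in> carrier L"
  using G_carr h_in_G by blast

lemma
  assumes "x \<in> D" "y \<in> D"
  shows h_add: "h (x + y) = h x \<oplus> h y" and D_add: "x + y \<in> D"
    and h_mult: "h (x * y) = h x \<otimes> h y" and D_mult: "x * y \<in> D"
  using G_add[OF h_in_G h_in_G, OF assms] G_mult[OF h_in_G h_in_G, OF assms]
  by (auto intro: h_eqI G_D)

lemma D_rat: "of_rat q \<in> D" and h_rat: "h (of_rat q) = f0 q"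
  using G_rat[of q] by (auto intro: h_eqI G_D)

lemma D_0: "0 \<in> D" and D_1: "1 \<in> D" and h_0: "h 0 = \<zero>" and h_1: "h 1 = \<one>"
  using D_rat[of 0] D_rat[of 1] h_rat[of 0] h_rat[of 1] by (simp_all add: f0_zero f0_one)

lemma D_uminus: "x \<in> D \<Longrightarrow> - x \<in> D"
  using D_mult[OF D_rat[of "- 1"], of x] by (simp add: of_rat_minus)

lemma D_diff: "x \<in> D \<Longrightarrow> y \<in> D \<Longrightarrow> x - y \<in> D"
  using D_add[OF _ D_uminus, of x y] by simp

lemma D_sum: "(\<And>i. i \<in> A \<Longrightarrow> f i \<in> D) \<Longrightarrow> (\<Sum>i\<in>A. f i) \<in> D"
  by (induction A rule: infinite_finite_induct) (auto simp: D_0 D_add)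

lemma D_power: "x \<in> D \<Longrightarrow> x ^ n \<in> D"
  by (induction n) (auto simp: D_1 D_mult)

lemma D_inverse:
  assumes "x \<in> D" "Polynomial.algebraic x"
  shows "inverse x \<in> D"
proof (cases "x = 0")
  case False
  obtain g :: "'a poly" where g: "\<And>i. Polynomial.coeff g i \<in> \<rat>" "inverse x = poly g x"
    using algebraic_inverse_poly[OF assms(2) False] by blast
  have "Polynomial.coeff g i \<in> D" for i using g(1)[of i] D_rat by (auto simp: Rats_def)
  thus ?thesis unfolding g(2) poly_altdef using assms(1) by (intro D_sum D_mult D_power)
qed (simp add: D_0)

definition DP where "DP = {g. \<forall>i. Polynomial.coeff g i \<in> D}"

lemma DP_coeff: "g \<in> DP \<Longrightarrow> Polynomial.coeff g i \<in> D"
  by (simp add: DP_def)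

lemma DP_0: "0 \<in> DP"
  by (simp add: DP_def D_0)

lemma DP_pCons: "pCons c g \<in> DP \<longleftrightarrow> c \<in> D \<and> g \<in> DP"
proof
  assume "pCons c g \<in> DP"
  hence A: "Polynomial.coeff (pCons c g) i \<in> D" for i by (simp add: DP_def)
  show "c \<in> D \<and> g \<in> DP" using A[of 0] A[of "Suc _"] by (simp add: DP_def)
qed (auto simp: DP_def coeff_pCons split: nat.splits)

lemma
  shows DP_add: "f \<in> DP \<Longrightarrow> g \<in> DP \<Longrightarrow> f + g \<in> DP"
    and DP_diff: "f \<in> DP \<Longrightarrow> g \<in> DP \<Longrightarrow> f - g \<in> DP"
    and DP_smult: "c \<in> D \<Longrightarrow> g \<in> DP \<Longrightarrow> smult c g \<in> DP"
  by (simp_all add: DP_def D_add D_diff D_mult)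

lemma DP_mult: "f \<in> DP \<Longrightarrow> g \<in> DP \<Longrightarrow> f * g \<in> DP"
proof -
  assume fg: "f \<in> DP" "g \<in> DP"
  have "Polynomial.coeff (f * g) i \<in> D" for i
    unfolding coeff_mult by (intro D_sum D_mult DP_coeff fg)
  thus ?thesis by (simp add: DP_def)
qed

lemma DP_monom: "c \<in> D \<Longrightarrow> Polynomial.monom c n \<in> DP"
  by (simp add: DP_def D_0)

end

locale embedding_step = partial_embedding L f0 G
  for L :: "('b, 'm) ring_scheme" (structure) and f0 :: "rat \<Rightarrow> 'b" and G :: "('a::field_char_0 \<times> 'b) set" +
  fixes y :: 'a and m :: "'a poly" and r :: 'b
  assumes r: "r \<in> carrier L"
    and m: "m \<in> DP" "Polynomial.lead_coeff m = 1" "poly m y = 0"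
    and minimal: "f \<in> DP \<Longrightarrow> f \<noteq> 0 \<Longrightarrow> poly f y = 0 \<Longrightarrow> Polynomial.degree m \<le> Polynomial.degree f"
    and root: "horner h r m = \<zero>"
begin

abbreviation ev where "ev \<equiv> horner h r"

lemma ev_pCons: "ev (pCons c g) = h c \<oplus> r \<otimes> ev g"
  by (simp add: horner_pCons h_0 r)

lemma ev_carr: "g \<in> DP \<Longrightarrow> ev g \<in> carrier L"
  by (induction g) (auto simp: ev_pCons DP_pCons h_carr r)

lemma ev_add: "f \<in> DP \<Longrightarrow> g \<in> DP \<Longrightarrow> ev (f + g) = ev f \<oplus> ev g"
proof (induction f g rule: poly_induct2)
  case (pCons a f b g)
  hence c: "h a \<in> carrier L" "h b \<in> carrier L" "ev f \<in> carrier L" "ev g \<in> carrier L"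
    by (auto simp: DP_pCons h_carr ev_carr)
  show ?case using pCons c r by (simp add: ev_pCons DP_pCons h_add r_distr a_ac)
qed simp

lemma ev_smult: "c \<in> D \<Longrightarrow> g \<in> DP \<Longrightarrow> ev (smult c g) = h c \<otimes> ev g"
proof (induction g)
  case 0
  thus ?case by (simp add: h_carr)
next
  case (pCons a g)
  hence c: "h a \<in> carrier L" "h c \<in> carrier L" "ev g \<in> carrier L" by (auto simp: DP_pCons h_carr ev_carr)
  show ?case using pCons c r by (simp add: ev_pCons DP_pCons h_mult r_distr m_lcomm)
qed

lemma ev_mult: "f \<in> DP \<Longrightarrow> g \<in> DP \<Longrightarrow> ev (f * g) = ev f \<otimes> ev g"
proof (induction f)
  case 0
  thus ?case by (simp add: ev_carr)
next
  case (pCons a f)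
  hence a: "a \<in> D" "f \<in> DP" by (auto simp: DP_pCons)
  hence c: "h a \<in> carrier L" "ev f \<in> carrier L" "ev g \<in> carrier L" using pCons.prems by (auto simp: h_carr ev_carr)
  have "ev (pCons a f * g) = ev (smult a g + pCons 0 (f * g))" by simp
  also have "\<dots> = h a \<otimes> ev g \<oplus> r \<otimes> (ev f \<otimes> ev g)"
    using a pCons by (subst ev_add) (auto simp: DP_smult DP_pCons D_0 DP_mult ev_smult ev_pCons h_0 c r)
  also have "\<dots> = ev (pCons a f) \<otimes> ev g" using c r by (simp add: ev_pCons l_distr m_assoc)
  finally show ?case .
qed

text \<open>Division by the monic \<open>m\<close>, one leading term at a time. It makes the value
  at \<open>r\<close> depend only on the value at \<open>y\<close>, so that the extension to D[y] is
  well defined.\<close>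

lemma ev_eq_zero: "f \<in> DP \<Longrightarrow> poly f y = 0 \<Longrightarrow> ev f = \<zero>"
proof (induction "Polynomial.degree f" arbitrary: f rule: less_induct)
  case less
  show ?case
  proof (cases "f = 0")
    case False
    define n k c where "n = Polynomial.degree f" and "k = n - Polynomial.degree m" and "c = Polynomial.lead_coeff f"
    have mn: "Polynomial.degree m \<le> n" using minimal less.prems False by (simp add: n_def)
    have m0: "m \<noteq> 0" using m(2) by auto
    have "Polynomial.degree m \<noteq> 0" using m by (metis degree_eq_zeroE lead_coeff_pCons(2) mult_zero_right poly_const_conv one_neq_zero)
    hence n0: "n > 0" using mn by simp
    define q where "q = Polynomial.monom c k * m"
    define f' where "f' = f - q"
    have c: "c \<in> D" "c \<noteq> 0" using less.prems(1) False by (auto simp: c_def DP_coeff)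
    have q: "q \<in> DP" unfolding q_def using m(1) DP_monom[OF c(1)] by (intro DP_mult)
    have degq: "Polynomial.degree q = n" "Polynomial.coeff q n = c"
    proof -
      show "Polynomial.degree q = n" unfolding q_def using c(2) m0 mn
        by (subst degree_mult_eq) (auto simp: degree_monom_eq k_def)
      moreover have "Polynomial.lead_coeff q = c" unfolding q_def lead_coeff_mult using m(2) c(2) by (simp add: degree_monom_eq)
      ultimately show "Polynomial.coeff q n = c" by simp
    qed
    have f': "f' \<in> DP" unfolding f'_def using less.prems(1) q by (rule DP_diff)
    have "Polynomial.coeff f' i = 0" if "i > n - 1" for i
      using that n0 degq by (cases "i = n") (auto simp: f'_def c_def n_def coeff_eq_0)
    hence "Polynomial.degree f' \<le> n - 1" by (intro degree_le) auto
    hence "Polynomial.degree f' < Polynomial.degree f" using n0 by (simp add: n_def)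
    moreover have "poly f' y = 0" using less.prems(2) m(3) by (simp add: f'_def q_def)
    ultimately have "ev f' = \<zero>" using less.hyps f' by blast
    moreover have "ev q = \<zero>"
      unfolding q_def using ev_mult[OF DP_monom[OF c(1)] m(1)] root ev_carr[OF DP_monom[OF c(1)]] by simp
    moreover have "ev f = ev f' \<oplus> ev q" using ev_add[OF f' q] by (simp add: f'_def)
    ultimately show ?thesis by simp
  qed simp
qed

definition G' where "G' = (\<lambda>g. (poly g y, ev g)) ` DP"

lemma G'_I: "g \<in> DP \<Longrightarrow> (poly g y, ev g) \<in> G'"
  by (auto simp: G'_def)

lemma subset_G': "G \<subseteq> G'"
proof
  fix u assume "u \<in> G"
  obtain x l where u: "u = (x, l)" by (cases u)
  hence x: "x \<in> D" "h x = l" using \<open>u \<in> G\<close> G_D h_eqI by auto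
  have "[:x:] \<in> DP" using x by (simp add: DP_pCons DP_0)
  from G'_I[OF this] show "u \<in> G'"
    using x(2) h_carr[OF x(1)] r by (simp add: u ev_pCons)
qed

lemma y_r_G': "(y, r) \<in> G'"
proof -
  have "[:0, 1:] \<in> DP" by (simp add: DP_pCons DP_0 D_0 D_1)
  from G'_I[OF this] show ?thesis using r by (simp add: ev_pCons h_0 h_1)
qed

lemma partial_embedding_G': "partial_embedding L f0 G'"
proof (intro partial_embedding.intro partial_embedding_axioms.intro embedding_target_axioms)
  show "l \<in> carrier L" if "(x, l) \<in> G'" for x l
    using that ev_carr by (auto simp: G'_def)
  show "l = \<zero>" if "(0, l) \<in> G'" for l
    using that ev_eq_zero by (auto simp: G'_def)
  show "(of_rat q, f0 q) \<in> G'" for q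
    using subset_G' G_rat by blast
  fix x l z k assume "(x, l) \<in> G'" "(z, k) \<in> G'"
  then obtain f g where f: "f \<in> DP" "x = poly f y" "l = ev f" and g: "g \<in> DP" "z = poly g y" "k = ev g"
    by (auto simp: G'_def)
  show "(x + z, l \<oplus> k) \<in> G'" using G'_I[OF DP_add[OF f(1) g(1)]] f g by (simp add: ev_add)
  show "(x * z, l \<otimes> k) \<in> G'" using G'_I[OF DP_mult[OF f(1) g(1)]] f g by (simp add: ev_mult)
qed

end

context partial_embedding
begin

lemma ex_extension:
  assumes alg: "\<And>x::'a. Polynomial.algebraic x"
  shows "\<exists>G'. partial_embedding L f0 G' \<and> G \<subseteq> G' \<and> y \<in> fst ` G'"
proof -
  define R where "R = (\<lambda>f. f \<in> DP \<and> f \<noteq> 0 \<and> poly f y = 0)"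
  obtain p0 where p0: "\<And>i. Polynomial.coeff p0 i \<in> \<int>" "p0 \<noteq> 0" "poly p0 y = 0"
    using alg[of y] unfolding algebraic_def by blast
  have "Polynomial.coeff p0 i \<in> D" for i
    using p0(1)[of i] D_rat by (metis Ints_cases of_rat_of_int_eq)
  hence "R p0" using p0 by (simp add: R_def DP_def)
  define p where "p = arg_min Polynomial.degree R"
  have p: "R p" "\<And>q. R q \<Longrightarrow> Polynomial.degree p \<le> Polynomial.degree q"
    using arg_min_nat_lemma[of R p0 Polynomial.degree] \<open>R p0\<close> unfolding p_def by auto
  \<comment> \<open>Normalizing needs the inverse of a coefficient in \<open>D\<close>, which is
    available because all elements are algebraic.\<close>
  define m where "m = smult (inverse (Polynomial.lead_coeff p)) p"
  have p0: "p \<noteq> 0" "p \<in> DP" using p(1) by (auto simp: R_def)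
  have m: "m \<in> DP" "Polynomial.lead_coeff m = 1" "poly m y = 0" "Polynomial.degree m = Polynomial.degree p"
    using p(1) p0 D_inverse[OF DP_coeff alg] by (auto simp: m_def R_def intro!: DP_smult)
  have "Polynomial.degree m \<noteq> 0" using m by (metis degree_eq_zeroE lead_coeff_pCons(2) mult_zero_right poly_const_conv one_neq_zero)
  \<comment> \<open>Lists of the polynomial ring over \<open>L\<close> begin with the leading
    coefficient, \<open>coeffs\<close> with the constant one.\<close>
  define P where "P = rev (map h (coeffs m))"
  have m0: "m \<noteq> 0" using m(2) by auto
  have sub: "h c \<in> carrier L" if "c \<in> set (coeffs m)" for c
    using that DP_coeff[OF m(1)] by (auto simp: coeffs_def m0 intro!: h_carr split: if_splits)
  have "hd P = \<one>"
    using m0 m(2) by (simp add: P_def hd_rev last_map last_coeffs_eq_coeff_degree h_1)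
  hence "P \<in> carrier (poly_ring L)"
    using sub m0 by (auto simp: P_def univ_poly_def polynomial_def)
  moreover have "length P > 1"
    using \<open>Polynomial.degree m \<noteq> 0\<close> m0 by (simp add: P_def degree_eq_length_coeffs)
  ultimately obtain r where r: "r \<in> carrier L" "eval P r = \<zero>" using closed by blast
  have "horner h r m = \<zero>"
    using r eval_rev_map[of "coeffs m" h r] sub by (simp add: horner_def P_def)
  then interpret embedding_step L f0 G y m r
    using r m p(2) by unfold_locales (auto simp: R_def)
  show ?thesis using partial_embedding_G' subset_G' y_r_G' by force
qed

theorem ex_total_extension:
  assumes alg: "\<And>x::'a. Polynomial.algebraic x"
  shows "\<exists>f\<in>ring_hom (ring_of_type_algebra :: 'a ring) L. (\<forall>(x, l)\<in>G. f x = l)"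
proof -
  define F where "F = {H. partial_embedding L f0 H \<and> G \<subseteq> H}"
  have "\<exists>M\<in>F. \<forall>Y\<in>F. M \<subseteq> Y \<longrightarrow> Y = M"
  proof (rule subset_Zorn_nonempty)
    have "G \<in> F" unfolding F_def using partial_embedding_axioms by simp
    thus "F \<noteq> {}" by blast
  next
    fix C assume C: "C \<noteq> {}" "subset.chain F C"
    have pe: "partial_embedding L f0 H" "G \<subseteq> H" if HC: "H \<in> C" for H
      using C(2) HC unfolding subset.chain_def F_def by blast+
    have "partial_embedding L f0 (\<Union>C)"
    proof (intro partial_embedding.intro partial_embedding_axioms.intro embedding_target_axioms)
      show "l \<in> carrier L" if xl: "(x, l) \<in> \<Union>C" for x l
      proof -
        obtain H where H: "H \<in> C" "(x, l) \<in> H" using xl by blast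
        show ?thesis by (rule partial_embedding.G_carr[OF pe(1)[OF H(1)] H(2)])
      qed
      show "l = \<zero>" if xl: "(0, l) \<in> \<Union>C" for l
      proof -
        obtain H where H: "H \<in> C" "(0, l) \<in> H" using xl by blast
        show ?thesis by (rule partial_embedding.G_zero[OF pe(1)[OF H(1)] H(2)])
      qed
      show "(of_rat q, f0 q) \<in> \<Union>C" for q using C(1) pe(2) G_rat by blast
      fix x l z k assume "(x, l) \<in> \<Union>C" "(z, k) \<in> \<Union>C"
      then obtain A B where AB: "(x, l) \<in> A" "A \<in> C" "(z, k) \<in> B" "B \<in> C" by blast
      hence "A \<subseteq> B \<or> B \<subseteq> A" using C(2) unfolding subset.chain_def by blast
      then obtain H where H: "H \<in> C" "(x, l) \<in> H" "(z, k) \<in> H" using AB by blast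
      show "(x + z, l \<oplus> k) \<in> \<Union>C" "(x * z, l \<otimes> k) \<in> \<Union>C"
        using partial_embedding.G_add[OF pe(1)[OF H(1)] H(2,3)]
          partial_embedding.G_mult[OF pe(1)[OF H(1)] H(2,3)] H(1) by blast+
    qed
    moreover have "G \<subseteq> \<Union>C" using C(1) pe(2) by blast
    ultimately show "\<Union>C \<in> F" by (simp add: F_def)
  qed
  then obtain M where M: "M \<in> F" "\<And>Y. Y \<in> F \<Longrightarrow> M \<subseteq> Y \<Longrightarrow> Y = M" by blast
  have "partial_embedding L f0 M" and GM: "G \<subseteq> M" using M(1) by (auto simp: F_def)
  then interpret M: partial_embedding L f0 M by simp
  have all: "y \<in> M.D" for y
  proof -
    obtain G' where G': "partial_embedding L f0 G'" "M \<subseteq> G'" "y \<in> fst ` G'"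
      using M.ex_extension[OF alg] by blast
    hence "G' \<in> F" using GM by (auto simp: F_def)
    hence "G' = M" using M(2) G'(2) by blast
    thus ?thesis using G'(3) by (simp add: M.D_def)
  qed
  have "M.h \<in> ring_hom (ring_of_type_algebra :: 'a ring) L"
    by (rule ring_hom_memI) (simp_all add: ring_of_type_algebra_def M.h_carr M.h_add M.h_mult M.h_1 all)
  moreover have "\<forall>(x, l)\<in>G. M.h x = l" using GM M.h_eqI by blast
  ultimately show ?thesis by blast
qed

end

context embedding_target
begin

lemma partial_embedding_rat: "partial_embedding L f0 (range (\<lambda>q. (of_rat q :: 'a::field_char_0, f0 q)))"
  by unfold_locales (auto simp: f0_zero of_rat_add[symmetric] of_rat_mult[symmetric] f0_add[symmetric] f0_mult[symmetric])

theorem ex_embedding: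
  assumes "\<And>x::'a::field_char_0. Polynomial.algebraic x"
  shows "\<exists>f\<in>ring_hom (ring_of_type_algebra :: 'a ring) L. \<forall>q. f (of_rat q) = f0 q"
proof -
  interpret partial_embedding L f0 "range (\<lambda>q. (of_rat q :: 'a, f0 q))"
    by (rule partial_embedding_rat)
  obtain f where f: "f \<in> ring_hom (ring_of_type_algebra :: 'a ring) L"
      "\<forall>(x, l)\<in>range (\<lambda>q. (of_rat q :: 'a, f0 q)). f x = l"
    using ex_total_extension[OF assms] by blast
  have "f (of_rat q) = f0 q" for q using f(2) by auto
  thus ?thesis using f(1) by blast
qed

text \<open>Zorn's lemma is started not from the rationals but from the map on Q[x] with x sent to
  \<open>r\<close>, which is well defined because \<open>m\<close> is minimal.\<close>

theorem ex_embedding_root: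
  fixes x :: "'a::field_char_0" and m :: "rat poly"
  assumes alg: "\<And>x::'a. Polynomial.algebraic x"
    and m: "Polynomial.lead_coeff m = 1" "poly (map_poly of_rat m) x = 0"
      "\<And>f. f \<noteq> 0 \<Longrightarrow> poly (map_poly of_rat f) x = 0 \<Longrightarrow> Polynomial.degree m \<le> Polynomial.degree f"
    and r: "r \<in> carrier L" "horner f0 r m = \<zero>"
  shows "\<exists>f\<in>ring_hom (ring_of_type_algebra :: 'a ring) L. (\<forall>q. f (of_rat q) = f0 q) \<and> f x = r"
proof -
  define G where "G = range (\<lambda>q. (of_rat q :: 'a, f0 q))"
  interpret partial_embedding L f0 G unfolding G_def by (rule partial_embedding_rat)
  have "fst ` G = \<rat>" by (simp add: G_def image_image Rats_def)
  hence D: "D = \<rat>" by (simp only: D_def)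
  have horner: "horner h r (map_poly of_rat f) = horner f0 r f" for f
    by (induction f) (simp_all add: map_poly_pCons horner_pCons h_0 f0_zero r h_rat)
  have DP: "\<exists>g. f = map_poly of_rat g" if "f \<in> DP" for f
  proof -
    have "\<forall>i. \<exists>q. Polynomial.coeff f i = of_rat q" using DP_coeff[OF that] D by (auto simp: Rats_def)
    then obtain q where q: "\<And>i. Polynomial.coeff f i = of_rat (q i)" by metis
    define g where "g = Poly (map q [0..<Suc (Polynomial.degree f)])"
    have "Polynomial.coeff g i = q i" for i
    proof (cases "i \<le> Polynomial.degree f")
      case False
      hence "of_rat (q i) = (0::'a)" using q[of i] by (simp add: coeff_eq_0)
      thus ?thesis using False by (simp add: g_def nth_default_def)
    qed (simp add: g_def nth_default_def del: upt_Suc)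
    thus ?thesis by (intro exI[of _ g] poly_eqI) (simp add: coeff_map_poly q)
  qed
  interpret embedding_step L f0 G x "map_poly of_rat m" r
  proof
    show "map_poly of_rat m \<in> DP" by (simp add: DP_def coeff_map_poly D)
    show "Polynomial.lead_coeff (map_poly of_rat m :: 'a poly) = 1" using m(1) by (simp add: degree_map_poly coeff_map_poly)
    show "horner h r (map_poly of_rat m) = \<zero>" using r horner by simp
    fix f assume f: "f \<in> DP" "f \<noteq> 0" "poly f x = 0"
    then obtain g where g: "f = map_poly of_rat g" using DP by blast
    moreover have "g \<noteq> 0" using g f(2) by auto
    ultimately show "Polynomial.degree (map_poly of_rat m :: 'a poly) \<le> Polynomial.degree f"
      using f m(3)[of g] by (auto simp: degree_map_poly)
  qed (use r m in auto)
  interpret G': partial_embedding L f0 G' by (rule partial_embedding_G')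
  obtain f where f: "f \<in> ring_hom (ring_of_type_algebra :: 'a ring) L" "\<forall>(x, l)\<in>G'. f x = l"
    using G'.ex_total_extension[OF alg] by blast
  have "f x = r" using f(2) y_r_G' by auto
  moreover have "f (of_rat q) = f0 q" for q using f(2) G'.G_rat[of q] by auto
  ultimately show ?thesis using f(1) by blast
qed

lemma hom_horner:
  assumes "f \<in> ring_hom (ring_of_type_algebra :: 'a::field_char_0 ring) L" "\<And>q. f (of_rat q) = f0 q"
  shows "f (poly (map_poly of_rat m) s) = horner f0 (f s) m"
proof -
  have f: "f (x + y) = f x \<oplus> f y" "f (x * y) = f x \<otimes> f y" "f x \<in> carrier L" for x y
    using ring_hom_closed[OF assms(1)] ring_hom_add[OF assms(1)] ring_hom_mult[OF assms(1)]
    by (auto simp: ring_of_type_algebra_def)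
  have "f 0 = \<zero>" using assms(2)[of 0] by (simp add: f0_zero)
  thus ?thesis
    by (induction m) (simp_all add: map_poly_pCons f horner_pCons f0_zero assms(2))
qed

end

section \<open>The \<open>p\<close>-adic numbers\<close>

lemma type_ring_simps [simp]:
  "x \<in> carrier ring_of_type_algebra"
  "x \<otimes>\<^bsub>ring_of_type_algebra\<^esub> y = x * y" "x \<oplus>\<^bsub>ring_of_type_algebra\<^esub> y = x + y"
  "\<one>\<^bsub>ring_of_type_algebra\<^esub> = (1::'k::field)" "\<zero>\<^bsub>ring_of_type_algebra\<^esub> = (0::'k)"
  by (simp_all add: ring_of_type_algebra_def)

lemma valued_field_nonarch:
  assumes "nonarch_abs w"
  shows "valued_field ring_of_type_algebra (w :: 'k::field_char_0 \<Rightarrow> real)"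
proof -
  interpret nonarch_abs w by fact
  have "w (x + y) \<le> w x + w y" for x y
  proof -
    have "max (w x) (w y) \<le> w x + w y" using nonneg[of x] nonneg[of y] by (intro max.boundedI) linarith+
    thus ?thesis using ultra[of x y] by (rule order.trans[rotated])
  qed
  hence "absolute_value ring_of_type_algebra w" by (simp add: absolute_value_def mult)
  thus ?thesis
    by (intro valued_field.intro valued_field_axioms.intro field_from_type_algebra)
qed

text \<open>Frees \<open>padic_order\<close> from lowest terms, by cross-multiplication and
  additivity of the multiplicity.\<close>

lemma padic_order_fraction:
  assumes p: "Factorial_Ring.prime p" and ab: "a \<noteq> 0" "b \<noteq> 0"
  shows "padic_order p (of_int a / of_int b) = int (multiplicity (int p) a) - int (multiplicity (int p) b)"
proof -
  define n d where "n = fst (quotient_of (of_int a / of_int b))" and "d = snd (quotient_of (of_int a / of_int b))"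
  have d: "d > 0" unfolding d_def by (rule quotient_of_denom_pos')
  have eq: "of_int a / of_int b = (of_int n / of_int d :: rat)"
    using quotient_of_div[of "of_int a / of_int b"] unfolding n_def d_def by (metis prod.collapse)
  hence "n \<noteq> 0" using ab d by auto
  have "(of_int (a * d) :: rat) = of_int (n * b)" using eq ab d by (simp add: field_simps)
  hence "a * d = n * b" by (simp only: of_int_eq_iff)
  moreover have pe: "prime_elem (int p)" using p by simp
  ultimately have "multiplicity (int p) a + multiplicity (int p) d = multiplicity (int p) n + multiplicity (int p) b"
    using prime_elem_multiplicity_mult_distrib[OF pe, of a d] prime_elem_multiplicity_mult_distrib[OF pe, of n b] ab d \<open>n \<noteq> 0\<close>
    by simp
  thus ?thesis unfolding padic_order_def n_def[symmetric] d_def[symmetric] by simp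
qed

text \<open>In logarithms to base \<open>q\<close>: every rational upper bound (a - b) / n of log r
  is one of log t. Only powers of r, t and q are compared, which suits an absolute value controlled
  merely on Z_p and at p.\<close>

lemma real_le_by_powers:
  fixes r t q :: real
  assumes "q > 1" "r > 0" "t > 0"
    and "\<And>n a b::nat. n > 0 \<Longrightarrow> r ^ n * q ^ b \<le> q ^ a \<Longrightarrow> t ^ n * q ^ b \<le> q ^ a"
  shows "t \<le> r"
proof (rule ccontr)
  assume "\<not> t \<le> r"
  hence "log q r < log q t" using assms by simp
  then obtain c where c: "c \<in> \<rat>" "log q r < c" "c < log q t" using Rats_dense_in_real by blast
  then obtain i :: int and n :: nat where i: "n > 0" "c = real_of_int i / real n"
    by (metis Rats_cases' of_int_of_nat_eq zero_less_imp_eq_int of_nat_0_less_iff)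
  define a b where "a = nat i" and "b = nat (- i)"
  have ab: "c * real n = real a - real b" using i by (auto simp: a_def b_def)
  have le: "s ^ n * q ^ b \<le> q ^ a \<longleftrightarrow> log q s \<le> c" if "s > 0" for s
  proof -
    have "s ^ n * q ^ b \<le> q ^ a \<longleftrightarrow> log q (s ^ n * q ^ b) \<le> log q (q ^ a)"
      using assms that by (subst log_le_cancel_iff) auto
    also have "log q (s ^ n * q ^ b) = real n * log q s + real b"
      using assms that by (simp add: log_mult log_nat_power)
    also have "log q (q ^ a) = real a" using assms by (simp add: log_nat_power)
    also have "real n * log q s + real b \<le> real a \<longleftrightarrow> real n * log q s \<le> real n * c"
      using ab by (simp add: mult.commute le_diff_eq)
    also have "\<dots> \<longleftrightarrow> log q s \<le> c" using i(1) by simp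
    finally show ?thesis .
  qed
  have "r ^ n * q ^ b \<le> q ^ a" using le[OF assms(2)] c by simp
  hence "t ^ n * q ^ b \<le> q ^ a" using assms(4)[OF i(1)] by blast
  thus False using le[OF assms(3)] c by simp
qed

section \<open>Q_p and the absolute value on its closure\<close>

locale prime_number =
  fixes p :: nat
  assumes prime: "Factorial_Ring.prime p"
begin

lemma p_gt_1: "real p > 1" and p_pos: "p > 0"
  using prime_gt_1_nat[OF prime] by auto

lemma padic_order_mult:
  assumes "x \<noteq> 0" "y \<noteq> 0"
  shows "padic_order p (x * y) = padic_order p x + padic_order p y"
proof -
  obtain a b where x: "x = of_int a / of_int b" "b \<noteq> 0" by (metis Fract_of_int_quotient Rat_cases less_irrefl)
  obtain c d where y: "y = of_int c / of_int d" "d \<noteq> 0" by (metis Fract_of_int_quotient Rat_cases less_irrefl)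
  have nz: "a \<noteq> 0" "c \<noteq> 0" using assms x y by auto
  have pe: "prime_elem (int p)" using prime by simp
  have "x * y = of_int (a * c) / of_int (b * d)" by (simp add: x y)
  thus ?thesis
    using padic_order_fraction[OF prime, of "a * c" "b * d"] x y nz
    by (simp add: padic_order_fraction[OF prime] prime_elem_multiplicity_mult_distrib[OF pe])
qed

lemma padic_order_add:
  assumes "x \<noteq> 0" "y \<noteq> 0" "x + y \<noteq> 0"
  shows "padic_order p (x + y) \<ge> min (padic_order p x) (padic_order p y)"
proof -
  obtain a b where x: "x = of_int a / of_int b" "b \<noteq> 0" by (metis Fract_of_int_quotient Rat_cases less_irrefl)
  obtain c d where y: "y = of_int c / of_int d" "d \<noteq> 0" by (metis Fract_of_int_quotient Rat_cases less_irrefl)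
  define A B D where "A = a * d" and "B = c * b" and "D = b * d"
  have xy: "x = of_int A / of_int D" "y = of_int B / of_int D" "D \<noteq> 0"
    using x y by (auto simp: A_def B_def D_def)
  hence s: "x + y = of_int (A + B) / of_int D" by (simp add: add_divide_distrib)
  have nz: "A \<noteq> 0" "B \<noteq> 0" "A + B \<noteq> 0" using assms xy s by auto
  define k where "k = min (multiplicity (int p) A) (multiplicity (int p) B)"
  have "int p ^ k dvd A" "int p ^ k dvd B" by (auto simp: k_def intro: multiplicity_dvd')
  hence "int p ^ k dvd A + B" by simp
  hence "k \<le> multiplicity (int p) (A + B)"
    using nz(3) prime by (intro multiplicity_geI) auto
  hence "padic_order p (of_int (A + B) / of_int D) \<ge> int k - int (multiplicity (int p) D)"
    using padic_order_fraction[OF prime nz(3) xy(3)] by linarith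
  thus ?thesis
    unfolding s using padic_order_fraction[OF prime nz(1) xy(3)] padic_order_fraction[OF prime nz(2) xy(3)] xy(1,2)
    by (simp add: k_def min_def split: if_splits)
qed

lemma nonarch_padic_abs: "nonarch_abs (padic_abs p)"
proof
  fix x y :: rat
  show "0 \<le> padic_abs p x" by (simp add: padic_abs_def)
  show "padic_abs p x = 0 \<longleftrightarrow> x = 0" using p_pos by (simp add: padic_abs_def)
  show "padic_abs p (x * y) = padic_abs p x * padic_abs p y"
    using p_pos by (simp add: padic_abs_def padic_order_mult power_int_add[symmetric])
  show "padic_abs p (x + y) \<le> max (padic_abs p x) (padic_abs p y)"
  proof (cases "x = 0 \<or> y = 0 \<or> x + y = 0")
    case False
    hence "- padic_order p (x + y) \<le> max (- padic_order p x) (- padic_order p y)"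
      using padic_order_add[of x y] by linarith
    hence "real p powi (- padic_order p (x + y)) \<le> real p powi (max (- padic_order p x) (- padic_order p y))"
      using p_gt_1 by (intro power_int_increasing) auto
    thus ?thesis using False by (auto simp: padic_abs_def max_def split: if_splits)
  qed (auto simp: padic_abs_def le_max_iff_disj)
qed

sublocale Q: nonarch_abs "padic_abs p"
  by (rule nonarch_padic_abs)

lemma padic_abs_p: "padic_abs p (of_nat p) = 1 / real p"
proof -
  have "padic_order p (of_int (int p) / of_int 1) = 1"
    using padic_order_fraction[OF prime, of "int p" 1] p_pos prime by simp
  thus ?thesis using p_pos by (simp add: padic_abs_def power_int_minus field_simps)
qed

lemma padic_abs_le_1E:
  assumes "padic_abs p x \<le> 1"
  obtains a b where "x = of_int a / of_int b" "b \<noteq> 0" "\<not> int p dvd b"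
proof -
  obtain a b where x: "x = of_int a / of_int b" "b > 0" "coprime a b"
    by (metis quotient_of_div quotient_of_denom_pos quotient_of_coprime prod.collapse)
  have "\<not> int p dvd b"
  proof
    assume dv: "int p dvd b"
    then obtain c where c: "b = int p * c" by blast
    have "\<not> int p dvd a"
    proof
      assume "int p dvd a"
      hence "is_unit (int p)" using dv x(3) by (rule coprime_common_divisor[rotated])
      moreover have "Factorial_Ring.prime (int p)" using prime by simp
      ultimately show False using not_prime_unit by blast
    qed
    hence "multiplicity (int p) a = 0" "a \<noteq> 0" by (auto simp: not_dvd_imp_multiplicity_0)
    moreover have "multiplicity (int p) b > 0"
      using multiplicity_geI[of b "int p" 1] dv x(2) p_gt_1 by simp
    ultimately have "padic_order p x < 0" unfolding x(1) using padic_order_fraction[OF prime, of a b] x(2) by simp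
    hence "1 < real p powi (- padic_order p x)" using p_gt_1 by (intro one_less_power_int) auto
    moreover have "x \<noteq> 0" using x \<open>a \<noteq> 0\<close> by auto
    ultimately show False using assms by (simp add: padic_abs_def)
  qed
  thus ?thesis using that x by blast
qed

sublocale VQ: valued_field ring_of_type_algebra "padic_abs p"
  by (rule valued_field_nonarch[OF nonarch_padic_abs])

sublocale VQp: valued_field "Qp p" "Qp_abs p"
  unfolding Qp_def Qp_abs_def by (rule VQ.valued_field_completion)

lemma Qp_ultra:
  "x \<in> carrier (Qp p) \<Longrightarrow> y \<in> carrier (Qp p) \<Longrightarrow> Qp_abs p (x \<oplus>\<^bsub>Qp p\<^esub> y) \<le> max (Qp_abs p x) (Qp_abs p y)"
  unfolding Qp_def Qp_abs_def by (rule VQ.completion_abs_ultra) (auto simp: Q.ultra)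

definition emb :: "rat \<Rightarrow> (nat \<Rightarrow> rat) set" where
  "emb = completion_embed ring_of_type_algebra (padic_abs p)"

lemma emb_hom: "emb \<in> ring_hom ring_of_type_algebra (Qp p)"
  unfolding emb_def Qp_def by (rule VQ.completion_embed_hom)

lemma emb_carr: "emb q \<in> carrier (Qp p)"
  using ring_hom_closed[OF emb_hom] by simp

lemma Qp_abs_emb: "Qp_abs p (emb q) = padic_abs p q"
  unfolding emb_def Qp_abs_def by (rule VQ.completion_abs_embed) simp

abbreviation "L \<equiv> Qp_closure p"

definition incl :: "(nat \<Rightarrow> rat) set \<Rightarrow> qp_closure" where
  "incl = ring.indexed_const (Qp p)"

lemma algebraic_closure_L: "algebraic_closure L (incl ` carrier (Qp p))"
  and incl_hom: "incl \<in> ring_hom (Qp p) L"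
  unfolding incl_def Qp_closure_def by (rule VQp.alg_closureE)+

sublocale L: algebraic_closure L "incl ` carrier (Qp p)"
  by (rule algebraic_closure_L)

sublocale incl: ring_hom_ring "Qp p" L incl
  by (rule ring_hom_ringI2[OF VQp.ring_axioms L.ring_axioms incl_hom])

lemma incl_inj: "x \<in> carrier (Qp p) \<Longrightarrow> y \<in> carrier (Qp p) \<Longrightarrow> incl x = incl y \<longleftrightarrow> x = y"
  using VQp.indexed_const_inj_on unfolding incl_def inj_on_def by (metis VQp.indexed_const_eq_iff)

definition Zp where "Zp = incl ` {x \<in> carrier (Qp p). Qp_abs p x \<le> 1}"

text \<open>The prime number as an element of Q_p; not a prime ideal here.\<close>

definition P where "P = emb (of_nat p)"

lemma P_carr: "P \<in> carrier (Qp p)" and Qp_abs_P: "Qp_abs p P = 1 / real p"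
  by (auto simp: P_def emb_carr Qp_abs_emb padic_abs_p)

lemma P_nz: "P \<noteq> \<zero>\<^bsub>Qp p\<^esub>"
  using Qp_abs_P p_pos by auto

lemma Qp_abs_pow: "x \<in> carrier (Qp p) \<Longrightarrow> Qp_abs p (x [^]\<^bsub>Qp p\<^esub> (n::nat)) = Qp_abs p x ^ n"
  by (induction n) (auto simp: VQp.v_mult)

lemma incl_pow: "x \<in> carrier (Qp p) \<Longrightarrow> incl (x [^]\<^bsub>Qp p\<^esub> (n::nat)) = incl x [^]\<^bsub>L\<^esub> n"
  by (rule incl.hom_nat_pow)

lemma subring_Zp: "subring Zp L"
proof (rule L.subringI)
  show "Zp \<subseteq> carrier L" using incl.hom_closed by (auto simp: Zp_def)
  show "\<one>\<^bsub>L\<^esub> \<in> Zp" unfolding Zp_def by (intro image_eqI[of _ _ "\<one>\<^bsub>Qp p\<^esub>"]) auto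
next
  fix h assume "h \<in> Zp"
  then obtain x where x: "x \<in> carrier (Qp p)" "Qp_abs p x \<le> 1" "h = incl x" by (auto simp: Zp_def)
  show "\<ominus>\<^bsub>L\<^esub> h \<in> Zp" unfolding Zp_def using x by (intro image_eqI[of _ _ "\<ominus>\<^bsub>Qp p\<^esub> x"]) auto
next
  fix h k assume "h \<in> Zp" "k \<in> Zp"
  then obtain x y where x: "x \<in> carrier (Qp p)" "Qp_abs p x \<le> 1" "h = incl x"
    and y: "y \<in> carrier (Qp p)" "Qp_abs p y \<le> 1" "k = incl y" by (auto simp: Zp_def)
  have "Qp_abs p x * Qp_abs p y \<le> 1 * 1" using x y by (intro mult_mono) (auto simp: VQp.v_nonneg)
  thus "h \<otimes>\<^bsub>L\<^esub> k \<in> Zp" unfolding Zp_def using x y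
    by (intro image_eqI[of _ _ "x \<otimes>\<^bsub>Qp p\<^esub> y"]) (auto simp: VQp.v_mult)
  show "h \<oplus>\<^bsub>L\<^esub> k \<in> Zp" unfolding Zp_def using x y Qp_ultra[of x y]
    by (intro image_eqI[of _ _ "x \<oplus>\<^bsub>Qp p\<^esub> y"]) auto
qed

text \<open>A power of p exceeding finitely many absolute values is a common denominator. It
  supplies the exponents that \<open>ex_absolute_value_extending\<close> asks for.\<close>

lemma power_P_mult_in_Zp:
  assumes "finite S" "S \<subseteq> incl ` carrier (Qp p)"
  shows "\<exists>j::nat. \<forall>a\<in>S. incl P [^]\<^bsub>L\<^esub> j \<otimes>\<^bsub>L\<^esub> a \<in> Zp"
proof -
  have "\<forall>a\<in>S. \<exists>x. x \<in> carrier (Qp p) \<and> a = incl x" using assms(2) by blast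
  then obtain b where "\<forall>a\<in>S. b a \<in> carrier (Qp p) \<and> a = incl (b a)" using bchoice by meson
  hence b: "b a \<in> carrier (Qp p)" "a = incl (b a)" if "a \<in> S" for a using that by blast+
  define B where "B = Max (insert 1 ((\<lambda>a. Qp_abs p (b a)) ` S))"
  have B: "Qp_abs p (b a) \<le> B" if "a \<in> S" for a
    unfolding B_def using assms(1) that by (intro Max_ge) auto
  obtain j where j: "B < real p ^ j" using real_arch_pow[OF p_gt_1] by blast
  have "incl P [^]\<^bsub>L\<^esub> j \<otimes>\<^bsub>L\<^esub> a \<in> Zp" if a: "a \<in> S" for a
  proof -
    have eq: "incl P [^]\<^bsub>L\<^esub> j \<otimes>\<^bsub>L\<^esub> a = incl (P [^]\<^bsub>Qp p\<^esub> j \<otimes>\<^bsub>Qp p\<^esub> b a)"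
      using b[OF a] P_carr by (metis incl.hom_mult incl_pow VQp.nat_pow_closed)
    have "Qp_abs p (P [^]\<^bsub>Qp p\<^esub> j \<otimes>\<^bsub>Qp p\<^esub> b a) = (1 / real p) ^ j * Qp_abs p (b a)"
      using b[OF a] P_carr by (simp add: VQp.v_mult Qp_abs_pow Qp_abs_P)
    also have "\<dots> \<le> (1 / real p) ^ j * real p ^ j"
      using B[OF a] j by (intro mult_left_mono) auto
    also have "\<dots> = 1" using p_pos by (simp add: power_one_over)
    finally show ?thesis unfolding eq Zp_def using b[OF a] P_carr by (intro imageI) auto
  qed
  thus ?thesis by blast
qed

text \<open>Justifies the choice in \<open>Qp_closure_abs\<close>. The extension theorem for Z_p,
  which lacks 1/p, gives \<open>v\<close> with v <= 1 on Z_p and v(p) = 1/p; agreement with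
  \<open>Qp_abs\<close> is deduced from these two facts.\<close>

lemma ex_extension_abs:
  "\<exists>v. absolute_value L v \<and> (\<forall>x\<in>carrier (Qp p). v (incl x) = Qp_abs p x)"
proof -
  have PL: "incl P \<in> Zp" unfolding Zp_def using P_carr Qp_abs_P p_gt_1 by (intro imageI) auto
  have PLnz: "incl P \<noteq> \<zero>\<^bsub>L\<^esub>" using incl_inj[OF P_carr VQp.zero_closed] P_nz by simp
  have inv: "inv\<^bsub>L\<^esub> (incl P) \<notin> Zp"
  proof
    assume "inv\<^bsub>L\<^esub> (incl P) \<in> Zp"
    then obtain x where x: "x \<in> carrier (Qp p)" "Qp_abs p x \<le> 1" "inv\<^bsub>L\<^esub> (incl P) = incl x" by (auto simp: Zp_def)
    have "incl P \<otimes>\<^bsub>L\<^esub> incl x = \<one>\<^bsub>L\<^esub>"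
      using L.nonzero_inv(2)[OF incl.hom_closed[OF P_carr] PLnz] x(3) by simp
    hence "incl (P \<otimes>\<^bsub>Qp p\<^esub> x) = incl \<one>\<^bsub>Qp p\<^esub>" using P_carr x(1) by simp
    hence "P \<otimes>\<^bsub>Qp p\<^esub> x = \<one>\<^bsub>Qp p\<^esub>" using incl_inj[OF VQp.m_closed[OF P_carr x(1)] VQp.one_closed] by blast
    hence "1 / real p * Qp_abs p x = 1" using VQp.v_mult[OF P_carr x(1)] by (simp add: Qp_abs_P)
    hence "Qp_abs p x = real p" using p_pos by (simp add: field_simps)
    thus False using x(2) p_gt_1 by simp
  qed
  have alg: "\<exists>F (j::nat) (k::nat). F \<noteq> [] \<and> set F \<subseteq> carrier L \<and> hd F \<noteq> \<zero>\<^bsub>L\<^esub> \<and> L.eval F z = \<zero>\<^bsub>L\<^esub> \<and>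
      (\<forall>a\<in>set F. incl P [^]\<^bsub>L\<^esub> j \<otimes>\<^bsub>L\<^esub> a \<in> Zp) \<and> incl P [^]\<^bsub>L\<^esub> k \<otimes>\<^bsub>L\<^esub> inv\<^bsub>L\<^esub> (hd F) \<in> Zp"
    if z: "z \<in> carrier L" for z
  proof -
    obtain F where F: "F \<in> carrier ((incl ` carrier (Qp p))[X]\<^bsub>L\<^esub>)" "F \<noteq> []" "L.eval F z = \<zero>\<^bsub>L\<^esub>"
      using L.algebraicE[OF L.subring_axioms z L.algebraic_extension[OF z]] by blast
    have FK: "set F \<subseteq> incl ` carrier (Qp p)" and hd: "hd F \<noteq> \<zero>\<^bsub>L\<^esub>"
      using F(1,2) by (auto simp: univ_poly_def polynomial_def)
    have hdK: "hd F \<in> incl ` carrier (Qp p)" using FK F(2) by auto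
    have "inv\<^bsub>L\<^esub> (hd F) \<in> incl ` carrier (Qp p)"
      using L.subfield_m_inv(1)[OF L.subfield_axioms] hdK hd by blast
    then obtain k :: nat where "incl P [^]\<^bsub>L\<^esub> k \<otimes>\<^bsub>L\<^esub> inv\<^bsub>L\<^esub> (hd F) \<in> Zp"
      using power_P_mult_in_Zp[of "{inv\<^bsub>L\<^esub> (hd F)}"] by auto
    moreover obtain j :: nat where "\<forall>a\<in>set F. incl P [^]\<^bsub>L\<^esub> j \<otimes>\<^bsub>L\<^esub> a \<in> Zp"
      using power_P_mult_in_Zp[OF _ FK] by auto
    moreover have "set F \<subseteq> carrier L" using FK incl.hom_closed by auto
    ultimately show ?thesis using F(2,3) hd by blast
  qed
  obtain v where v: "absolute_value L v" "\<forall>x\<in>Zp. v x \<le> 1" "v (incl P) = 1 / real p"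
    using L.ex_absolute_value_extending[OF subring_Zp PL PLnz inv p_gt_1 alg] by blast
  interpret vL: valued_field L v
    by (intro valued_field.intro valued_field_axioms.intro L.field_axioms v(1))
  have powL: "v (y [^]\<^bsub>L\<^esub> (n::nat)) = v y ^ n" if "y \<in> carrier L" for y n
    using that by (induction n) (auto simp: vL.v_mult)
  have pos: "Qp_abs p x > 0" "v (incl x) > 0" if x: "x \<in> carrier (Qp p)" "x \<noteq> \<zero>\<^bsub>Qp p\<^esub>" for x
  proof -
    show "Qp_abs p x > 0" using VQp.v_nonneg[OF x(1)] VQp.v_eq_0_iff[OF x(1)] x(2) by linarith
    have "incl x \<noteq> \<zero>\<^bsub>L\<^esub>" using incl_inj[OF x(1) VQp.zero_closed] x(2) by simp
    thus "v (incl x) > 0" using vL.v_nonneg[OF incl.hom_closed[OF x(1)]] vL.v_eq_0_iff[OF incl.hom_closed[OF x(1)]] by linarith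
  qed
  have le: "v (incl x) \<le> Qp_abs p x" if x: "x \<in> carrier (Qp p)" "x \<noteq> \<zero>\<^bsub>Qp p\<^esub>" for x
  proof (rule real_le_by_powers[OF p_gt_1 pos[OF x]])
    fix n a b :: nat assume "n > 0" and h: "Qp_abs p x ^ n * real p ^ b \<le> real p ^ a"
    define I where "I = inv\<^bsub>Qp p\<^esub> P"
    have I: "I \<in> carrier (Qp p)" "P \<otimes>\<^bsub>Qp p\<^esub> I = \<one>\<^bsub>Qp p\<^esub>" using VQp.nonzero_inv[OF P_carr P_nz] by (auto simp: I_def)
    have "1 / real p * Qp_abs p I = 1" using VQp.v_mult[OF P_carr I(1)] I(2) by (simp add: Qp_abs_P)
    hence aI: "Qp_abs p I = real p" using p_pos by (simp add: field_simps)
    have "incl P \<otimes>\<^bsub>L\<^esub> incl I = \<one>\<^bsub>L\<^esub>" using I P_carr by (metis incl.hom_mult incl.hom_one)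
    hence "1 / real p * v (incl I) = 1"
      using vL.v_mult[OF incl.hom_closed[OF P_carr] incl.hom_closed[OF I(1)]] v(3) by simp
    hence vI: "v (incl I) = real p" using p_pos by (simp add: field_simps)
    \<comment> \<open>\<open>y\<close> is x^n p^(a - b), with \<open>I\<close> for 1/p; the
      inequality \<open>h\<close> says exactly that it lies in Z_p.\<close>
    define y where "y = x [^]\<^bsub>Qp p\<^esub> n \<otimes>\<^bsub>Qp p\<^esub> I [^]\<^bsub>Qp p\<^esub> b \<otimes>\<^bsub>Qp p\<^esub> P [^]\<^bsub>Qp p\<^esub> a"
    have y: "y \<in> carrier (Qp p)" unfolding y_def using x I P_carr by simp
    have "Qp_abs p y = Qp_abs p x ^ n * real p ^ b * (1 / real p) ^ a"
      unfolding y_def using x I P_carr by (simp add: VQp.v_mult Qp_abs_pow aI Qp_abs_P)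
    also have "\<dots> \<le> real p ^ a * (1 / real p) ^ a" using h by (intro mult_right_mono) auto
    also have "\<dots> = 1" using p_pos by (simp add: power_one_over)
    finally have "incl y \<in> Zp" unfolding Zp_def using y by (intro imageI) auto
    hence "v (incl y) \<le> 1" using v(2) by blast
    moreover have "v (incl y) = v (incl x) ^ n * real p ^ b * (1 / real p) ^ a"
      unfolding y_def using x I P_carr by (simp add: vL.v_mult powL incl_pow vI v(3))
    ultimately have "v (incl x) ^ n * real p ^ b * (1 / real p) ^ a * real p ^ a \<le> 1 * real p ^ a"
      by (intro mult_right_mono) auto
    thus "v (incl x) ^ n * real p ^ b \<le> real p ^ a" using p_pos by (simp add: power_one_over)
  qed
  have "v (incl x) = Qp_abs p x" if x: "x \<in> carrier (Qp p)" for x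
  proof (cases "x = \<zero>\<^bsub>Qp p\<^esub>")
    case False
    \<comment> \<open>The reverse inequality comes from \<open>le\<close> applied to the
      inverse.\<close>
    define y where "y = inv\<^bsub>Qp p\<^esub> x"
    have y: "y \<in> carrier (Qp p)" "x \<otimes>\<^bsub>Qp p\<^esub> y = \<one>\<^bsub>Qp p\<^esub>" "y \<noteq> \<zero>\<^bsub>Qp p\<^esub>"
      using VQp.nonzero_inv[OF x False] by (auto simp: y_def)
    have e1: "Qp_abs p x * Qp_abs p y = 1" using VQp.v_mult[OF x y(1)] y(2) by simp
    have "incl x \<otimes>\<^bsub>L\<^esub> incl y = \<one>\<^bsub>L\<^esub>" using x y by (metis incl.hom_mult incl.hom_one)
    hence e2: "v (incl x) * v (incl y) = 1"
      using vL.v_mult[OF incl.hom_closed[OF x] incl.hom_closed[OF y(1)]] by simp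
    have "1 = v (incl x) * v (incl y)" using e2 by simp
    also have "\<dots> \<le> v (incl x) * Qp_abs p y"
      using le[OF y(1,3)] pos[OF x False] by (intro mult_left_mono) auto
    finally have "Qp_abs p x * Qp_abs p y \<le> v (incl x) * Qp_abs p y" using e1 by simp
    hence "Qp_abs p x \<le> v (incl x)" using pos(1)[OF y(1,3)] by simp
    thus ?thesis using le[OF x False] by simp
  qed simp
  thus ?thesis using v(1) by blast
qed

lemma absolute_value_L: "absolute_value L (Qp_closure_abs p)"
  and Qp_closure_abs_incl: "x \<in> carrier (Qp p) \<Longrightarrow> Qp_closure_abs p (incl x) = Qp_abs p x"
  using someI_ex[OF ex_extension_abs] unfolding Qp_closure_abs_def incl_def by blast+

end

section \<open>Embeddings into the field of complex \<open>p\<close>-adic numbers\<close>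

lemma (in ring) type_hom_zero:
  assumes "s \<in> ring_hom (ring_of_type_algebra :: 'k::field ring) R"
  shows "s 0 = \<zero>"
proof -
  have carr: "s 0 \<in> carrier R" using ring_hom_closed[OF assms] by simp
  have "s 0 = s 0 \<oplus> s 0" using ring_hom_add[OF assms, of 0 0] by simp
  thus ?thesis by (metis add.l_cancel_one' carr)
qed

text \<open>For comparing an arbitrary embedding of the number field with the canonical map of the
  rationals, which fixes its p-adic size on natural numbers.\<close>

lemma (in ring) type_hom_of_nat_eq:
  fixes f :: "'x::field \<Rightarrow> 'a" and g :: "'y::field \<Rightarrow> 'a"
  assumes f: "f \<in> ring_hom ring_of_type_algebra R" and g: "g \<in> ring_hom ring_of_type_algebra R"
  shows "f (of_nat n) = g (of_nat n)"
proof (induction n)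
  case (Suc n)
  thus ?case
    using ring_hom_add[OF f, of 1 "of_nat n"] ring_hom_add[OF g, of 1 "of_nat n"] ring_hom_one[OF f] ring_hom_one[OF g]
    by simp
qed (simp add: type_hom_zero[OF f] type_hom_zero[OF g])

context valued_field
begin

context
  fixes s :: "'k::field_char_0 \<Rightarrow> 'a"
  assumes s: "s \<in> ring_hom ring_of_type_algebra R"
begin

private lemma carr: "s x \<in> carrier R"
  using ring_hom_closed[OF s] by simp

private lemma hom_add: "s (x + y) = s x \<oplus> s y"
  using ring_hom_add[OF s, of x y] by simp

private lemma hom_mult: "v (s (x * y)) = v (s x) * v (s y)"
  using ring_hom_mult[OF s, of x y] by (simp add: v_mult carr)

private lemma hom_eq_0_iff: "v (s x) = 0 \<longleftrightarrow> x = 0"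
proof
  assume "v (s x) = 0"
  hence "v (s (x * inverse x)) = 0" unfolding hom_mult by simp
  thus "x = 0" using ring_hom_one[OF s] by (cases "x = 0") auto
qed (simp add: type_hom_zero[OF s])

lemma nonarch_abs_hom:
  assumes "\<And>n::nat. v (s (of_nat n)) \<le> 1"
  shows "nonarch_abs (\<lambda>x. v (s x))"
  by (rule nonarch_absI_bounded) (simp_all add: v_nonneg carr hom_eq_0_iff hom_mult hom_add v_add assms)

lemma inj_type_hom: "inj s"
proof (rule injI)
  fix a b assume eq: "s a = s b"
  have "s b = s (a - b) \<oplus> s b" using hom_add[of "a - b" b] eq by simp
  hence "s (a - b) = \<zero>" by (metis add.r_cancel_one' carr)
  hence "a - b = 0" using hom_eq_0_iff[of "a - b"] by simp
  thus "a = b" by simp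
qed

end

end

lemma (in nonarch_abs) coeff_prod_linear_le_1:
  assumes "\<And>s. s \<in># A \<Longrightarrow> w s \<le> 1"
  shows "w (Polynomial.coeff (\<Prod>s\<in>#A. [:- s, 1:]) i) \<le> 1"
  using assms
proof (induction A arbitrary: i)
  case empty
  have "w 0 \<le> 1" using of_nat_le_1[of 0] by simp
  thus ?case by (simp add: coeff_1)
next
  case (add s A)
  define g where "g = (\<Prod>s\<in>#A. [:- s, 1:])"
  have g: "w (Polynomial.coeff g i) \<le> 1" for i unfolding g_def using add by simp
  have "w (- s * Polynomial.coeff g i) \<le> 1 * 1" unfolding mult using g add.prems[of s] by (intro mult_mono) auto
  moreover have "w (Polynomial.coeff (pCons 0 g) i) \<le> 1"
    using g of_nat_le_1[of 0] by (cases i) simp_all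
  moreover have "Polynomial.coeff (\<Prod>s\<in>#add_mset s A. [:- s, 1:]) i
      = - s * Polynomial.coeff g i + Polynomial.coeff (pCons 0 g) i"
    unfolding g_def[symmetric] by (simp add: g_def[symmetric])
  ultimately show ?case using ultra[of "- s * Polynomial.coeff g i" "Polynomial.coeff (pCons 0 g) i"] by simp
qed

lemma ex_minimal_rat_poly:
  fixes x :: "'a::field_char_0"
  assumes "Polynomial.algebraic x"
  shows "\<exists>m. Polynomial.lead_coeff m = 1 \<and> poly (map_poly of_rat m) x = 0 \<and>
    (\<forall>f. f \<noteq> 0 \<longrightarrow> poly (map_poly of_rat f) x = 0 \<longrightarrow> Polynomial.degree m \<le> Polynomial.degree f)"
proof -
  define R where "R = (\<lambda>f::rat poly. f \<noteq> 0 \<and> poly (map_poly of_rat f) x = 0)"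
  obtain g where g: "g \<noteq> 0" "poly (map_poly of_int g) x = 0" using algebraicE'[OF assms] by blast
  have "map_poly of_rat (map_poly of_int g :: rat poly) = (map_poly of_int g :: 'a poly)"
    by (intro poly_eqI) (simp add: coeff_map_poly)
  moreover have "map_poly rat_of_int g \<noteq> 0"
  proof
    assume 0: "map_poly rat_of_int g = 0"
    have "Polynomial.coeff (map_poly rat_of_int g) (Polynomial.degree g) = of_int (Polynomial.lead_coeff g)"
      by (simp add: coeff_map_poly)
    thus False using g(1) 0 by simp
  qed
  ultimately have "R (map_poly of_int g)" using g by (simp add: R_def)
  then obtain m where m: "R m" "\<And>f. R f \<Longrightarrow> Polynomial.degree m \<le> Polynomial.degree f"
    using arg_min_nat_lemma[of R _ Polynomial.degree] by blast
  define c where "c = inverse (Polynomial.lead_coeff m)"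
  have c: "c \<noteq> 0" using m(1) by (simp add: c_def R_def)
  have "map_poly of_rat (smult c m) = (smult (of_rat c) (map_poly of_rat m) :: 'a poly)"
    by (intro poly_eqI) (simp add: coeff_map_poly of_rat_mult)
  hence "poly (map_poly of_rat (smult c m)) x = 0" using m(1) by (simp add: R_def)
  moreover have "Polynomial.lead_coeff (smult c m) = 1" using m(1) by (simp add: c_def R_def)
  moreover have "Polynomial.degree (smult c m) = Polynomial.degree m" using c by simp
  ultimately show ?thesis using m(2) unfolding R_def by metis
qed

lemma algebraic_rat_alg_closure: "Polynomial.algebraic (x :: rat alg_closure)"
proof -
  obtain g where g: "g \<noteq> 0" "poly (map_poly to_ac g) x = 0" by (rule alg_closure_algebraic)
  have "to_ac (q::rat) \<in> \<rat>" for q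
  proof -
    obtain a b where "q = of_int a / of_int b" by (metis Fract_of_int_quotient Rat_cases)
    thus ?thesis by simp
  qed
  moreover have "map_poly to_ac g \<noteq> 0"
  proof
    assume 0: "map_poly to_ac g = 0"
    have "to_ac (Polynomial.coeff g i) = 0" for i using arg_cong[OF 0, of "\<lambda>f. Polynomial.coeff f i"] by (simp add: coeff_map_poly)
    thus False using g(1) by (simp add: poly_eq_iff)
  qed
  ultimately show ?thesis using g(2) by (intro algebraicI'[of "map_poly to_ac g"]) (auto simp: coeff_map_poly)
qed

context prime_number
begin

sublocale vL: valued_field L "Qp_closure_abs p"
  by (intro valued_field.intro valued_field_axioms.intro L.field_axioms absolute_value_L)

definition f0 :: "rat \<Rightarrow> qp_closure" where "f0 = incl \<circ> emb"

lemma f0_hom: "f0 \<in> ring_hom ring_of_type_algebra L"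
  unfolding f0_def by (rule ring_hom_trans[OF emb_hom incl_hom])

lemma abs_f0: "Qp_closure_abs p (f0 q) = padic_abs p q"
  by (simp add: f0_def Qp_closure_abs_incl emb_carr Qp_abs_emb)

lemma L_closed:
  assumes "g \<in> carrier (poly_ring L)" "length g > 1"
  shows "\<exists>x\<in>carrier L. L.eval g x = \<zero>\<^bsub>L\<^esub>"
proof -
  have "L.splitted g" using L.roots_over_carrier[OF assms(1)] .
  hence "size (L.roots g) > 0" unfolding L.splitted_def using assms(2) by simp
  then obtain x where "x \<in># L.roots g" by (metis multiset_nonemptyE nonempty_has_size)
  hence "L.is_root g x" using L.roots_mem_iff_is_root[OF assms(1)] by blast
  thus ?thesis by (auto simp: L.is_root_def)
qed

sublocale T: embedding_target L f0
  by (intro embedding_target.intro embedding_target_axioms.intro L.field_axioms f0_hom L_closed)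

abbreviation "Cp_abs \<equiv> completion_abs L (Qp_closure_abs p)"

abbreviation "toC \<equiv> completion_embed L (Qp_closure_abs p)"

lemma valued_field_Cp: "valued_field (Cp p) Cp_abs"
  unfolding Cp_def by (rule vL.valued_field_completion)

lemma toC_hom: "toC \<in> ring_hom L (Cp p)"
  unfolding Cp_def by (rule vL.completion_embed_hom)

text \<open>\<open>\<sigma>\<close> agrees with the canonical map on natural numbers, so the pulled
  back absolute value is the p-adic one there. Being at most 1 on them, it satisfies the ultrametric
  inequality.\<close>

lemma padic_nonarch_abs_Cp:
  fixes \<sigma> :: "'k::field_char_0 \<Rightarrow> (nat \<Rightarrow> qp_closure) set"
  assumes \<sigma>: "\<sigma> \<in> ring_hom ring_of_type_algebra (Cp p)"
  shows "padic_nonarch_abs (\<lambda>x. Cp_abs (\<sigma> x)) p"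
proof -
  interpret C: valued_field "Cp p" Cp_abs by (rule valued_field_Cp)
  have g: "toC \<circ> f0 \<in> ring_hom ring_of_type_algebra (Cp p)" by (rule ring_hom_trans[OF f0_hom toC_hom])
  have n: "Cp_abs (\<sigma> (of_nat n)) = padic_abs p (of_nat n)" for n
    unfolding C.type_hom_of_nat_eq[OF \<sigma> g] by (simp add: vL.completion_abs_embed abs_f0)
  have "nonarch_abs (\<lambda>x. Cp_abs (\<sigma> x))"
    by (rule C.nonarch_abs_hom[OF \<sigma>]) (simp add: n Q.of_nat_le_1)
  moreover have "Cp_abs (\<sigma> (of_nat p)) < 1" unfolding n padic_abs_p using p_gt_1 by simp
  ultimately show ?thesis by (intro padic_nonarch_abs.intro padic_nonarch_abs_axioms.intro prime)
qed

lemma Cp_valuation_ring_iff: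
  assumes "\<sigma> \<in> ring_hom (ring_of_type_algebra :: 'k::field ring) (Cp p)"
  shows "\<sigma> x \<in> Cp_valuation_ring p \<longleftrightarrow> Cp_abs (\<sigma> x) \<le> 1"
  using ring_hom_closed[OF assms, of x] by (simp add: Cp_valuation_ring_def completion_valuation_ring_def Cp_def)

text \<open>
  Every root of the minimal polynomial of \<open>x\<close> in the closure of \<open>\<rat>\<^sub>p\<close> is the image of \<open>x\<close> under an
  embedding. So if all images of \<open>x\<close> are integral, then so are the coefficients of that polynomial.
\<close>

lemma le_1_if_all_embeddings:
  fixes x :: "'k::field_char_0"
  assumes alg: "\<And>y::'k. Polynomial.algebraic y"
    and int: "\<And>\<sigma>. \<sigma> \<in> ring_hom (ring_of_type_algebra :: 'k ring) (Cp p) \<Longrightarrow> inj \<sigma> \<Longrightarrow> \<sigma> x \<in> Cp_valuation_ring p"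
    and w: "padic_nonarch_abs w p"
  shows "w x \<le> 1"
proof -
  interpret w: padic_nonarch_abs w p by fact
  interpret C: valued_field "Cp p" Cp_abs by (rule valued_field_Cp)
  obtain m where m: "Polynomial.lead_coeff m = 1" "poly (map_poly of_rat m) x = 0"
    "\<And>f. f \<noteq> 0 \<Longrightarrow> poly (map_poly of_rat f) x = 0 \<Longrightarrow> Polynomial.degree m \<le> Polynomial.degree f"
    using ex_minimal_rat_poly[OF alg] by blast
  \<comment> \<open>The minimal polynomial is split in the type \<open>rat alg_closure\<close>;
    \<open>u\<close> pulls the absolute value of the closure of Q_p back to it, so that integrality
    passes from the roots to the coefficients there.\<close>
  obtain \<rho> where \<rho>: "\<rho> \<in> ring_hom (ring_of_type_algebra :: rat alg_closure ring) L" "\<And>q. \<rho> (of_rat q) = f0 q"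
    using T.ex_embedding[OF algebraic_rat_alg_closure] by blast
  define u where "u = (\<lambda>s. Qp_closure_abs p (\<rho> s))"
  have u_rat: "u (of_rat q) = padic_abs p q" for q by (simp add: u_def \<rho>(2) abs_f0)
  interpret u: nonarch_abs u
    unfolding u_def
  proof (rule vL.nonarch_abs_hom[OF \<rho>(1)])
    show "Qp_closure_abs p (\<rho> (of_nat n)) \<le> 1" for n
      using u_rat[of "of_nat n"] Q.of_nat_le_1[of n] by (simp add: u_def)
  qed
  define M :: "rat alg_closure poly" where "M = map_poly of_rat m"
  have lM: "Polynomial.lead_coeff M = 1" using m(1) by (simp add: M_def degree_map_poly coeff_map_poly)
  hence "M \<noteq> 0" by auto
  then obtain A where A: "M = (\<Prod>s\<in>#A. [:- s, 1:])"
    using alg_closed_imp_factorization[of M] lM by auto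
  have root: "u s \<le> 1" if s: "s \<in># A" for s
  proof -
    have "[:- s, 1:] dvd M" unfolding A using s by (intro dvd_prod_mset) auto
    hence "poly M s = 0" by (simp add: poly_eq_0_iff_dvd)
    hence "T.horner f0 (\<rho> s) m = \<zero>\<^bsub>L\<^esub>"
      using T.hom_horner[OF \<rho>, of m s] L.type_hom_zero[OF \<rho>(1)] by (simp add: M_def)
    moreover have "\<rho> s \<in> carrier L" using ring_hom_closed[OF \<rho>(1)] by simp
    ultimately obtain \<tau> where \<tau>: "\<tau> \<in> ring_hom (ring_of_type_algebra :: 'k ring) L" "\<tau> x = \<rho> s"
      using T.ex_embedding_root[OF alg m] by blast
    have \<sigma>: "toC \<circ> \<tau> \<in> ring_hom ring_of_type_algebra (Cp p)" by (rule ring_hom_trans[OF \<tau>(1) toC_hom])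
    have "(toC \<circ> \<tau>) x \<in> Cp_valuation_ring p" by (rule int[OF \<sigma> C.inj_type_hom[OF \<sigma>]])
    hence "Cp_abs (toC (\<rho> s)) \<le> 1" using Cp_valuation_ring_iff[OF \<sigma>, of x] \<tau>(2) by simp
    thus ?thesis using \<open>\<rho> s \<in> carrier L\<close> by (simp add: u_def vL.completion_abs_embed)
  qed
  \<comment> \<open>The coefficients are rational: p-integral means a fraction with denominator
    prime to \<open>p\<close>, and such a fraction has \<open>w <= 1\<close> for every
    \<open>w\<close> above \<open>p\<close>.\<close>
  have "w (of_rat (Polynomial.coeff m i)) \<le> 1" for i
  proof -
    have "u (Polynomial.coeff M i) \<le> 1" unfolding A by (rule u.coeff_prod_linear_le_1[OF root])
    hence "padic_abs p (Polynomial.coeff m i) \<le> 1" by (simp add: M_def coeff_map_poly u_rat)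
    then obtain a b where ab: "Polynomial.coeff m i = of_int a / of_int b" "b \<noteq> 0" "\<not> int p dvd b"
      by (rule padic_abs_le_1E)
    hence "w (of_rat (Polynomial.coeff m i)) = w (of_int a)"
      using w.not_dvd_int_eq_1[OF ab(3)] by (simp add: of_rat_divide w.divide)
    thus ?thesis using w.of_int_le_1 by simp
  qed
  hence "w (Polynomial.coeff (map_poly of_rat m) i) \<le> 1" for i by (simp add: coeff_map_poly)
  moreover have "Polynomial.lead_coeff (map_poly of_rat m :: 'k poly) = 1"
    using m(1) by (simp add: coeff_map_poly degree_map_poly)
  ultimately show ?thesis using w.monic_root_le_1[OF m(2)] by blast
qed

end

section \<open>The equivalence\<close>

lemma N_integral_iff: "N_integral F \<longleftrightarrow> (\<exists>c. c \<noteq> 0 \<and> (\<forall>n. algebraic_int (c ^ n * fps_nth F n)))"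
  by (simp add: N_integral_def fps_compose_linear ring_of_integers_def)

text \<open>\<open>m\<close> clears the denominator of 1/c. Where w(m) = 1, integrality of m / c
  gives \<open>w c >= 1\<close>, and integrality of c^n times the n-th coefficient then bounds that
  coefficient. Exceptional primes thus divide \<open>m\<close>, for ideals and embeddings
  alike.\<close>

lemma N_integral_imp_abs_le_1:
  fixes F :: "'k::field_char_0 fps"
  assumes "N_integral F" and alg: "\<And>x::'k. Polynomial.algebraic x"
  shows "\<exists>m::nat. m > 0 \<and> (\<forall>w n. nonarch_abs w \<longrightarrow> w (of_nat m) = 1 \<longrightarrow> w (fps_nth F n) \<le> 1)"
proof -
  obtain c where c: "c \<noteq> 0" "\<And>n. algebraic_int (c ^ n * fps_nth F n)"
    using assms(1) unfolding N_integral_iff by blast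
  obtain m :: int where m: "m > 0" "algebraic_int (of_int m * inverse c)"
    using algebraic_imp_int_mult[OF alg] by blast
  have "w (fps_nth F n) \<le> 1" if w: "nonarch_abs w" "w (of_nat (nat m)) = 1" for w n
  proof -
    interpret nonarch_abs w by fact
    have "w (of_int m * inverse c) \<le> 1" using algebraic_int_le_1[OF m(2)] .
    hence "inverse (w c) \<le> 1" using w(2) m(1) by (simp add: mult inverse)
    hence "w c \<ge> 1" using pos[OF c(1)] by (simp add: field_simps)
    hence "w c ^ n \<ge> 1" by (rule one_le_power)
    hence "1 * w (fps_nth F n) \<le> w c ^ n * w (fps_nth F n)" by (intro mult_right_mono) auto
    also have "\<dots> \<le> 1" using algebraic_int_le_1[OF c(2)] by (simp add: mult power)
    finally show ?thesis by simp
  qed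
  thus ?thesis using m(1) by (intro exI[of _ "nat m"]) auto
qed

lemma (in nf_prime) prime_embed_integral_iff:
  "prime_embed P x \<in> prime_valuation_ring P \<longleftrightarrow> prime_abs P (x::'k) \<le> 1"
  unfolding prime_embed_def prime_valuation_ring_def
  by (rule valued_field.embed_in_valuation_ring_iff[OF valued_field_nonarch[OF nonarch_prime_abs]]) simp

definition bad_primes :: "'k::field_char_0 fps \<Rightarrow> nat set" where
  "bad_primes F = {p. Factorial_Ring.prime p \<and>
    \<not> (\<forall>\<sigma>. \<sigma> \<in> ring_hom (ring_of_type_algebra :: 'k ring) (Cp p) \<and> inj \<sigma> \<longrightarrow>
         (\<forall>n. \<sigma> (fps_nth F n) \<in> Cp_valuation_ring p))}"

context number_field
begin

definition bad_ideals :: "'k fps \<Rightarrow> 'k set set" where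
  "bad_ideals F = {P. nf_prime d P \<and> \<not> (\<forall>n. prime_abs P (fps_nth F n) \<le> 1)}"

lemma finite_bad_ideals_if_N_integral:
  assumes "N_integral F"
  shows "finite (bad_ideals F)"
proof -
  obtain m where m: "m > 0" "\<And>w n. nonarch_abs w \<Longrightarrow> w (of_nat m) = 1 \<Longrightarrow> w (fps_nth F n) \<le> 1"
    using N_integral_imp_abs_le_1[OF assms all_algebraic] by blast
  have "bad_ideals F \<subseteq> (\<Union>q\<in>{q. Factorial_Ring.prime q \<and> q dvd m}. {P :: 'k set. nf_prime d P \<and> of_nat q \<in> P})"
  proof
    fix P assume P: "P \<in> bad_ideals F"
    then interpret nf_prime d P by (simp add: bad_ideals_def)
    obtain q where q: "Factorial_Ring.prime q" "of_nat q \<in> P" using ex_prime by blast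
    have "q dvd m"
    proof (rule ccontr)
      assume "\<not> q dvd m"
      hence "prime_abs P (of_nat m) = 1" using padic_nonarch_abs.not_dvd_nat_eq_1[OF padic_prime_abs[OF q]] by blast
      hence "\<forall>n. prime_abs P (fps_nth F n) \<le> 1" using m(2)[OF nonarch_prime_abs] by blast
      thus False using P by (simp add: bad_ideals_def)
    qed
    thus "P \<in> (\<Union>q\<in>{q. Factorial_Ring.prime q \<and> q dvd m}. {P :: 'k set. nf_prime d P \<and> of_nat q \<in> P})"
      using q nf_prime_axioms by blast
  qed
  moreover have "finite {q. Factorial_Ring.prime q \<and> q dvd m}"
    using m(1) by (auto intro: finite_subset[OF _ finite_divisors_nat[of m]])
  moreover have "finite {P :: 'k set. nf_prime d P \<and> of_nat q \<in> P}" if "Factorial_Ring.prime q" for q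
    using finite_primes_containing[of q] prime_gt_0_nat[OF that] by simp
  ultimately show ?thesis by (auto intro: finite_subset)
qed

lemma finite_bad_primes_if_N_integral:
  fixes F :: "'k fps"
  assumes "N_integral F"
  shows "finite (bad_primes F)"
proof -
  obtain m where m: "m > 0" "\<And>w n. nonarch_abs w \<Longrightarrow> w (of_nat m) = 1 \<Longrightarrow> w (fps_nth F n) \<le> 1"
    using N_integral_imp_abs_le_1[OF assms all_algebraic] by blast
  have "bad_primes F \<subseteq> {q. q dvd m}"
  proof
    fix q assume q: "q \<in> bad_primes F"
    then interpret prime_number q by unfold_locales (simp add: bad_primes_def)
    have "\<sigma> (fps_nth F n) \<in> Cp_valuation_ring q"
      if \<sigma>: "\<sigma> \<in> ring_hom (ring_of_type_algebra :: 'k ring) (Cp q)" and nd: "\<not> q dvd m" for \<sigma> n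
    proof -
      interpret padic_nonarch_abs "\<lambda>x. Cp_abs (\<sigma> x)" q by (rule padic_nonarch_abs_Cp[OF \<sigma>])
      show ?thesis
        unfolding Cp_valuation_ring_iff[OF \<sigma>] using m(2)[OF nonarch_abs_axioms not_dvd_nat_eq_1[OF nd]] .
    qed
    thus "q \<in> {q. q dvd m}" using q unfolding bad_primes_def by blast
  qed
  thus ?thesis using m(1) by (auto intro: finite_subset[OF _ finite_divisors_nat[of m]])
qed

lemma finite_bad_ideals_if_finite_bad_primes:
  assumes "finite (bad_primes F)"
  shows "finite (bad_ideals F)"
proof -
  have "bad_ideals F \<subseteq> (\<Union>p\<in>bad_primes F. {P :: 'k set. nf_prime d P \<and> of_nat p \<in> P})"
  proof
    fix P assume P: "P \<in> bad_ideals F"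
    then interpret nf_prime d P by (simp add: bad_ideals_def)
    obtain q where q: "Factorial_Ring.prime q" "of_nat q \<in> P" using ex_prime by blast
    have "q \<in> bad_primes F"
    proof (rule ccontr)
      assume "q \<notin> bad_primes F"
      hence int: "\<sigma> (fps_nth F n) \<in> Cp_valuation_ring q"
        if "\<sigma> \<in> ring_hom (ring_of_type_algebra :: 'k ring) (Cp q)" "inj \<sigma>" for \<sigma> n
        using q(1) that unfolding bad_primes_def by blast
      have pn: "prime_number q" by (intro prime_number.intro q(1))
      have "prime_abs P (fps_nth F n) \<le> 1" for n
        by (rule prime_number.le_1_if_all_embeddings[OF pn all_algebraic int padic_prime_abs[OF q]])
      thus False using P by (simp add: bad_ideals_def)
    qed
    thus "P \<in> (\<Union>p\<in>bad_primes F. {P :: 'k set. nf_prime d P \<and> of_nat p \<in> P})" using q nf_prime_axioms by blast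
  qed
  moreover have "finite {P :: 'k set. nf_prime d P \<and> of_nat q \<in> P}" if "q \<in> bad_primes F" for q
    using finite_primes_containing[of q] that by (simp add: bad_primes_def prime_gt_0_nat)
  ultimately show ?thesis using assms by (auto intro: finite_subset)
qed

lemma N_integral_if_finite_bad_ideals:
  fixes as bs :: "'k list"
  defines "F \<equiv> hypergeometric_series as bs"
  assumes "set bs \<inter> \<int>\<^sub>\<le>\<^sub>0 = {}" and fin: "finite (bad_ideals F)"
  shows "N_integral F"
proof -
  obtain N where N: "\<And>w p n. padic_nonarch_abs w p \<Longrightarrow> w (of_nat p) ^ (N * n) * w (fps_nth F n) \<le> 1"
    unfolding F_def using hypergeometric_growth[OF all_algebraic assms(2), of as] by blast
  \<comment> \<open>A prime ideal contains only one prime number, since an integer prime to it has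
    absolute value 1; this makes the set \<open>S\<close> of primes below bad ideals finite.\<close>
  have single: "q = q'"
    if "nf_prime d P" "Factorial_Ring.prime q" "of_nat q \<in> P" "Factorial_Ring.prime q'" "of_nat q' \<in> P" for P q q'
  proof -
    interpret nf_prime d P by fact
    interpret w: padic_nonarch_abs "prime_abs P" q by (rule padic_prime_abs[OF that(2,3)])
    have "q dvd q'" using w.not_dvd_nat_eq_1[of q'] prime_abs_less_1[OF that(5)] by force
    thus ?thesis using that by (simp add: primes_dvd_imp_eq)
  qed
  define S where "S = (\<Union>P\<in>bad_ideals F. {q. Factorial_Ring.prime q \<and> of_nat q \<in> P})"
  have "finite {q. Factorial_Ring.prime q \<and> of_nat q \<in> P}" if "P \<in> bad_ideals F" for P
  proof -
    have "nf_prime d P" using that by (simp add: bad_ideals_def)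
    hence "is_singleton {q. Factorial_Ring.prime q \<and> of_nat q \<in> P} \<or> {q. Factorial_Ring.prime q \<and> of_nat q \<in> P} = {}"
      using single[of P] by (auto intro!: is_singletonI')
    thus ?thesis unfolding is_singleton_def by (metis finite.emptyI finite.insertI)
  qed
  hence S: "finite S" using fin by (simp add: S_def)
  define C where "C = (\<Prod>q\<in>S. q ^ N)"
  have "C \<noteq> 0" using S by (auto simp: C_def S_def)
  have "algebraic_int (of_nat C ^ n * fps_nth F n)" for n
  proof (rule algebraic_int_if_prime_abs_le_1)
    fix P :: "'k set" assume "nf_prime d P"
    then interpret nf_prime d P .
    show "prime_abs P (of_nat C ^ n * fps_nth F n) \<le> 1"
    proof (cases "P \<in> bad_ideals F")
      case False
      hence "prime_abs P (fps_nth F n) \<le> 1" using nf_prime_axioms by (simp add: bad_ideals_def)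
      hence "prime_abs P (of_nat (C ^ n)) * prime_abs P (fps_nth F n) \<le> 1 * 1"
        using w.of_nat_le_1[of "C ^ n"] by (intro mult_mono) auto
      thus ?thesis by (simp add: w.mult)
    next
      case True
      obtain q where q: "Factorial_Ring.prime q" "of_nat q \<in> P" using ex_prime by blast
      hence "q \<in> S" using True by (auto simp: S_def)
      \<comment> \<open>Only the factor q^N is needed at \<open>P\<close>; the remaining factor
        \<open>E\<close> is an integer, of absolute value at most 1.\<close>
      define E where "E = (\<Prod>q\<in>S - {q}. q ^ N)"
      have "C = q ^ N * E" unfolding C_def E_def using S \<open>q \<in> S\<close> by (rule prod.remove)
      hence "of_nat C ^ n * fps_nth F n = of_nat (E ^ n) * (of_nat q ^ (N * n) * fps_nth F n)"
        by (simp add: power_mult_distrib power_mult mult_ac)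
      hence "prime_abs P (of_nat C ^ n * fps_nth F n)
          = prime_abs P (of_nat (E ^ n)) * (prime_abs P (of_nat q) ^ (N * n) * prime_abs P (fps_nth F n))"
        by (simp only: w.mult w.power)
      also have "\<dots> \<le> 1 * 1"
        using N[OF padic_prime_abs[OF q], of n] w.of_nat_le_1[of "E ^ n"] by (intro mult_mono) auto
      finally show ?thesis by simp
    qed
  qed
  thus ?thesis unfolding N_integral_iff using \<open>C \<noteq> 0\<close> by (intro exI[of _ "of_nat C"]) auto
qed

end

theorem theorem1p3:
  fixes as bs :: "'k::field_char_0 list"
  defines "F \<equiv> hypergeometric_series as bs"
  assumes number_field:
    "\<exists>B. finite_dimensional_vector_space (\<lambda>(q::rat) (x::'k). of_rat q * x) B"
  assumes "set as \<inter> \<int>\<^sub>\<le>\<^sub>0 = {}" and "set bs \<inter> \<int>\<^sub>\<le>\<^sub>0 = {}"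
  shows
    "(N_integral F \<longleftrightarrow>
        finite {P. primeideal P (ring_of_integers :: 'k ring) \<and> P \<noteq> {0} \<and>
                   \<not> (\<forall>n. prime_embed P (fps_nth F n) \<in> prime_valuation_ring P)}) \<and>
     (N_integral F \<longleftrightarrow>
        finite {p::nat. Factorial_Ring.prime p \<and>
                   \<not> (\<forall>\<sigma>. \<sigma> \<in> ring_hom (ring_of_type_algebra :: 'k ring) (Cp p) \<and> inj \<sigma> \<longrightarrow>
                         (\<forall>n. \<sigma> (fps_nth F n) \<in> Cp_valuation_ring p))})"
proof -
  obtain d where d: "number_field TYPE('k) d" using number_fieldI[OF number_field] by blast
  have prime_iff: "nf_prime d P \<longleftrightarrow> primeideal P ring_of_integers \<and> P \<noteq> {0}" for P :: "'k set"
    by (simp add: nf_prime_def nf_prime_axioms_def d)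
  have eq: "{P. primeideal P (ring_of_integers :: 'k ring) \<and> P \<noteq> {0} \<and>
          \<not> (\<forall>n. prime_embed P (fps_nth F n) \<in> prime_valuation_ring P)} = number_field.bad_ideals d F"
    using nf_prime.prime_embed_integral_iff prime_iff unfolding number_field.bad_ideals_def[OF d] by blast
  have ideals: "N_integral F \<longleftrightarrow> finite (number_field.bad_ideals d F)"
    using number_field.finite_bad_ideals_if_N_integral[OF d]
      number_field.N_integral_if_finite_bad_ideals[OF d assms(4), of as]
    unfolding F_def by (rule iffI)
  \<comment> \<open>The return from prime numbers to N-integrality passes through the
    ideals.\<close>
  moreover have "N_integral F \<longleftrightarrow> finite (bad_primes F)"
    using number_field.finite_bad_primes_if_N_integral[OF d, of F]
      number_field.finite_bad_ideals_if_finite_bad_primes[OF d, of F]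
    unfolding ideals by (rule iffI)
  ultimately show ?thesis unfolding eq bad_primes_def[symmetric] by (rule conjI)
qed

end
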